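(* Assume that either ($n=2$ and $\omega\ne0$) or $n\ge3$. If $f(x)$ and $f(1-x)$ have the same Taylor series at $x=0$ (that is, $f^{(j)}(0)=(-1)^jf^{(j)}(1)$ for all $j\ge0$), then as $m\to\infty$ $$\lambda_m^+-\lambda_m^-=\mathcal O(\mu_m^{-\infty}),$$ i.e. $\lambda_m^+-\lambda_m^-=\mathcal O(\mu_m^{-p})$ for every $p\ge0$.
   Context: Setting. $n\ge2$ is an integer, $K$ is a connected closed (compact, without boundary) smooth manifold of dimension $n-1$ with a smooth Riemannian metric $g_K$, $f:[0,1]\to(0,\infty)$ is smooth, and $M=[0,1]\times K$ carries the metric $g=f(x)[dx^2+g_K]$. The boundary is $\partial M=\Gamma_0\cup\Gamma_1$ with $\Gamma_j=\{j\}\times K$, equipped with the induced metric. $\Delta_g$ and $\Delta_K$ are the Laplace–Beltrami operators of $(M,g)$ and $(K,g_K)$ ($-\Delta\ge0$). $\omega\in\mathbb R$ is a fixed frequency not in the Dirichlet spectrum of $-\Delta_g$. The Dirichlet-to-Neumann operator is $\Lambda_g(\omega)\psi=(\partial_\nu u)|_{\partial M}$ ($\nu$ the outward unit normal), where for $\psi\in H^{1/2}(\partial M)$, $u\in H^1(M)$ is the unique solution of $-\Delta_g u=\omega u$ on $M$, $u=\psi$ on $\partial M$. It is selfadjoint on $L^2(\partial M)$. $0=\mu_0<\mu_1\le\mu_2\le\cdots\to+\infty$ are the eigenvalues of $-\Delta_K$ counted with multiplicity and $(Y_m)_{m\ge0}$ is a fixed orthonormal basis of $L^2(K)$ with $-\Delta_KY_m=\mu_mY_m$.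 For each $m$ the two-dimensional space $\mathcal H_m$ of functions on $\partial M$ equal to $aY_m$ on $\Gamma_0$ and $bY_m$ on $\Gamma_1$ ($a,b\in\mathbb C$) is invariant under $\Lambda_g(\omega)$, and $\Lambda_g(\omega)|_{\mathcal H_m}$ has two distinct real eigenvalues, denoted $\lambda_m^-<\lambda_m^+$ (the Steklov eigenvalues). *)

theory Defs
  imports "HOL-Analysis.Analysis" "HOL-Library.Landau_Symbols"
begin

section \<open>Smooth functions\<close>

text \<open>
  The derivative is taken within \<open>S\<close>. The sets used are open sets, \<open>[0,1]\<close>, and products \<open>[0,1] \<times> V\<close>
  with \<open>V\<close> open; on these the derivative within \<open>S\<close> is unique, and at boundary points it is the
  one-sided derivative.
\<close>

primrec Ck_on :: "nat \<Rightarrow> 'a::euclidean_space set \<Rightarrow> ('a \<Rightarrow> 'b::real_normed_vector) \<Rightarrow> bool" where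
  "Ck_on 0 S f \<longleftrightarrow> continuous_on S f"
| "Ck_on (Suc k) S f \<longleftrightarrow> f differentiable_on S \<and>
     (\<forall>v. Ck_on k S (\<lambda>z. frechet_derivative f (at z within S) v))"

definition smooth_on :: "'a::euclidean_space set \<Rightarrow> ('a \<Rightarrow> 'b::real_normed_vector) \<Rightarrow> bool" where
  "smooth_on S f \<longleftrightarrow> (\<forall>k. Ck_on k S f)"

primrec deriv01 :: "nat \<Rightarrow> (real \<Rightarrow> real) \<Rightarrow> real \<Rightarrow> real" where
  "deriv01 0 f = f"
| "deriv01 (Suc j) f = (\<lambda>x. vector_derivative (deriv01 j f) (at x within {0..1}))"


section \<open>Riemannian manifolds\<close>

text \<open>
  A manifold is a subset of a topological space with an indexed atlas. \<open>metric R i z v w\<close> is the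
  metric, read in the chart \<open>i\<close>, at the point with coordinates \<open>z\<close>, applied to the coordinate
  vectors \<open>v\<close> and \<open>w\<close>. The dimension is \<open>DIM('e)\<close>.
\<close>

record ('i, 'p, 'e) riem =
  index :: "'i set"
  chart_dom :: "'i \<Rightarrow> 'p set"
  coord :: "'i \<Rightarrow> 'p \<Rightarrow> 'e"
  metric :: "'i \<Rightarrow> 'e \<Rightarrow> 'e \<Rightarrow> 'e \<Rightarrow> real"

definition points :: "('i, 'p, 'e) riem \<Rightarrow> 'p set" where
  "points R = (\<Union>i\<in>index R. chart_dom R i)"

definition coord_range :: "('i, 'p, 'e) riem \<Rightarrow> 'i \<Rightarrow> 'e set" where
  "coord_range R i = coord R i ` chart_dom R i"

definition param :: "('i, 'p, 'e) riem \<Rightarrow> 'i \<Rightarrow> 'e \<Rightarrow> 'p" where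
  "param R i = inv_into (chart_dom R i) (coord R i)"

definition transition :: "('i, 'p, 'e) riem \<Rightarrow> 'i \<Rightarrow> 'i \<Rightarrow> 'e \<Rightarrow> 'e" where
  "transition R i j = coord R j \<circ> param R i"

definition closed_riemannian_manifold ::
    "('i, 'p::{second_countable_topology, t2_space}, 'e::euclidean_space) riem \<Rightarrow> bool" where
  "closed_riemannian_manifold R \<longleftrightarrow>
     compact (UNIV :: 'p set) \<and> points R = UNIV \<and>
     (\<forall>i\<in>index R. open (chart_dom R i) \<and> open (coord_range R i) \<and>
        homeomorphism (chart_dom R i) (coord_range R i) (coord R i) (param R i)) \<and>
     (\<forall>i\<in>index R. \<forall>j\<in>index R.
        smooth_on (coord R i ` (chart_dom R i \<inter> chart_dom R j)) (transition R i j)) \<and>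
     (\<forall>i\<in>index R. \<forall>z\<in>coord_range R i.
        bilinear (metric R i z) \<and>
        (\<forall>v w. metric R i z v w = metric R i z w v) \<and>
        (\<forall>v. v \<noteq> 0 \<longrightarrow> metric R i z v v > 0)) \<and>
     (\<forall>i\<in>index R. \<forall>v w. smooth_on (coord_range R i) (\<lambda>z. metric R i z v w)) \<and>
     (\<forall>i\<in>index R. \<forall>j\<in>index R. \<forall>z\<in>coord R i ` (chart_dom R i \<inter> chart_dom R j). \<forall>v w.
        metric R i z v w =
        metric R j (transition R i j z)
          (frechet_derivative (transition R i j) (at z) v)
          (frechet_derivative (transition R i j) (at z) w))"

text \<open>The determinant of the Gram matrix of \<open>B\<close> in the standard basis (Leibniz formula).\<close>

definition gram_det :: "('e::euclidean_space \<Rightarrow> 'e \<Rightarrow> real) \<Rightarrow> real" where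
  "gram_det B = (\<Sum>\<pi> | \<pi> permutes (Basis :: 'e set). of_int (sign \<pi>) * (\<Prod>b\<in>Basis. B b (\<pi> b)))"

text \<open>On a compact manifold there is exactly one such measure.\<close>

definition riemannian_volume ::
    "('i, 'p::topological_space, 'e::euclidean_space) riem \<Rightarrow> 'p measure \<Rightarrow> bool" where
  "riemannian_volume R \<mu> \<longleftrightarrow>
     sets \<mu> = sets (restrict_space borel (points R)) \<and>
     (\<forall>i\<in>index R. \<forall>A\<in>sets \<mu>. A \<subseteq> chart_dom R i \<longrightarrow>
        emeasure \<mu> A =
        (\<integral>\<^sup>+z. ennreal (sqrt (gram_det (metric R i z))) * indicator (coord R i ` A) z \<partial>lborel))"

definition smooth_fun :: "('i, 'p, 'e::euclidean_space) riem \<Rightarrow> ('p \<Rightarrow> complex) \<Rightarrow> bool" where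
  "smooth_fun R u \<longleftrightarrow> (\<forall>i\<in>index R. smooth_on (coord_range R i) (u \<circ> param R i))"

definition coord_diff ::
    "('i, 'p, 'e::euclidean_space) riem \<Rightarrow> 'i \<Rightarrow> ('p \<Rightarrow> real) \<Rightarrow> 'e \<Rightarrow> 'e \<Rightarrow> real" where
  "coord_diff R i u z = frechet_derivative (u \<circ> param R i) (at z within coord_range R i)"

definition coord_grad ::
    "('i, 'p, 'e::euclidean_space) riem \<Rightarrow> 'i \<Rightarrow> ('p \<Rightarrow> real) \<Rightarrow> 'e \<Rightarrow> 'e" where
  "coord_grad R i u z = (THE v. \<forall>w. metric R i z v w = coord_diff R i u z w)"

text \<open>The value of \<open>g(\<nabla>u, \<nabla>h)\<close> at \<open>p\<close> does not depend on the chart, so any chart at \<open>p\<close> may be used.\<close>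

definition real_grad_inner ::
    "('i, 'p, 'e::euclidean_space) riem \<Rightarrow> ('p \<Rightarrow> real) \<Rightarrow> ('p \<Rightarrow> real) \<Rightarrow> 'p \<Rightarrow> real" where
  "real_grad_inner R u h p =
     (let i = (SOME i. i \<in> index R \<and> p \<in> chart_dom R i); z = coord R i p
      in metric R i z (coord_grad R i u z) (coord_grad R i h z))"

text \<open>The sesquilinear extension to complex functions, conjugate-linear in the second argument.\<close>

definition grad_inner ::
    "('i, 'p, 'e::euclidean_space) riem \<Rightarrow> ('p \<Rightarrow> complex) \<Rightarrow> ('p \<Rightarrow> complex) \<Rightarrow> 'p \<Rightarrow> complex" where
  "grad_inner R u h p =
     Complex
       (real_grad_inner R (Re \<circ> u) (Re \<circ> h) p + real_grad_inner R (Im \<circ> u) (Im \<circ> h) p)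
       (real_grad_inner R (Im \<circ> u) (Re \<circ> h) p - real_grad_inner R (Re \<circ> u) (Im \<circ> h) p)"


section \<open>Sobolev space and Laplacian\<close>

definition L2 :: "'p measure \<Rightarrow> ('p \<Rightarrow> complex) set" where
  "L2 \<mu> = {u \<in> borel_measurable \<mu>. integrable \<mu> (\<lambda>p. (cmod (u p))\<^sup>2)}"

definition L2_tendsto :: "'p measure \<Rightarrow> (nat \<Rightarrow> 'p \<Rightarrow> complex) \<Rightarrow> ('p \<Rightarrow> complex) \<Rightarrow> bool" where
  "L2_tendsto \<mu> s u \<longleftrightarrow> (\<lambda>k. LINT p|\<mu>. (cmod (s k p - u p))\<^sup>2) \<longlonglongrightarrow> 0"

definition H1_norm :: "('i, 'p, 'e::euclidean_space) riem \<Rightarrow> 'p measure \<Rightarrow> ('p \<Rightarrow> complex) \<Rightarrow> real" where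
  "H1_norm R \<mu> u = sqrt (LINT p|\<mu>. (cmod (u p))\<^sup>2 + Re (grad_inner R u u p))"

text \<open>
  \<open>H\<^sup>1\<close> is the completion of the smooth functions (smooth up to the boundary) in the \<open>H\<^sup>1\<close> norm; its
  elements are represented by Cauchy sequences \<open>s\<close>, with limit \<open>u\<close> in \<open>L\<^sup>2\<close>. Expressions continuous
  on \<open>H\<^sup>1\<close> (the energy form, the trace) are evaluated as limits along \<open>s\<close>.
\<close>

definition H1_element ::
    "('i, 'p, 'e::euclidean_space) riem \<Rightarrow> 'p measure \<Rightarrow> (nat \<Rightarrow> 'p \<Rightarrow> complex) \<Rightarrow> ('p \<Rightarrow> complex) \<Rightarrow> bool" where
  "H1_element R \<mu> s u \<longleftrightarrow>
     (\<forall>k. smooth_fun R (s k)) \<and>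
     (\<forall>e>0. \<exists>N. \<forall>k\<ge>N. \<forall>l\<ge>N. H1_norm R \<mu> (\<lambda>p. s k p - s l p) < e) \<and>
     u \<in> L2 \<mu> \<and> L2_tendsto \<mu> s u"

text \<open>
  \<open>laplacian_eq R \<mu> B s h\<close> says \<open>\<Delta>u = h\<close> for the \<open>H\<^sup>1\<close> element \<open>u\<close> represented by \<open>s\<close>, where
  \<open>\<Delta> = div \<nabla>\<close> is taken weakly: \<open>\<integral> h cnj \<phi> d\<mu> = - \<integral> \<langle>\<nabla>u, \<nabla>\<phi>\<rangle> d\<mu>\<close> for the smooth \<open>\<phi>\<close> that vanish near the
  boundary \<open>B\<close>. A closed manifold has \<open>B = {}\<close>, and this is then the self-adjoint Laplace--Beltrami
  operator on \<open>L\<^sup>2\<close>.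
\<close>

definition test_fun ::
    "('i, 'p::topological_space, 'e::euclidean_space) riem \<Rightarrow> 'p set \<Rightarrow> ('p \<Rightarrow> complex) \<Rightarrow> bool" where
  "test_fun R B \<phi> \<longleftrightarrow>
     smooth_fun R \<phi> \<and> (\<exists>W. open W \<and> B \<subseteq> W \<and> (\<forall>p \<in> W \<inter> points R. \<phi> p = 0))"

definition laplacian_eq ::
    "('i, 'p::topological_space, 'e::euclidean_space) riem \<Rightarrow> 'p measure \<Rightarrow> 'p set \<Rightarrow>
     (nat \<Rightarrow> 'p \<Rightarrow> complex) \<Rightarrow> ('p \<Rightarrow> complex) \<Rightarrow> bool" where
  "laplacian_eq R \<mu> B s h \<longleftrightarrow>
     (\<forall>\<phi>. test_fun R B \<phi> \<longrightarrow>
        (\<lambda>k. LINT p|\<mu>. grad_inner R (s k) \<phi> p) \<longlonglongrightarrow> - (LINT p|\<mu>. h p * cnj (\<phi> p)))"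

definition helmholtz_solution ::
    "('i, 'p::topological_space, 'e::euclidean_space) riem \<Rightarrow> 'p measure \<Rightarrow> 'p set \<Rightarrow> real \<Rightarrow>
     (nat \<Rightarrow> 'p \<Rightarrow> complex) \<Rightarrow> ('p \<Rightarrow> complex) \<Rightarrow> bool" where
  "helmholtz_solution R \<mu> B \<omega> s u \<longleftrightarrow>
     H1_element R \<mu> s u \<and> laplacian_eq R \<mu> B s (\<lambda>p. - complex_of_real \<omega> * u p)"

text \<open>
  Below, \<open>\<sigma>\<close> is the volume measure of the boundary, carried by the points of the boundary, and
  \<open>L2_tendsto \<sigma> s \<psi>\<close> says that \<open>\<psi>\<close> is the trace of the \<open>H\<^sup>1\<close> element \<open>s\<close>.

  The Dirichlet Laplacian has compact resolvent, so that its spectrum consists of eigenvalues. The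
  eigenfunction is nonzero as an element of the completion.
\<close>

definition dirichlet_spectrum ::
    "('i, 'p::topological_space, 'e::euclidean_space) riem \<Rightarrow> 'p measure \<Rightarrow> 'p set \<Rightarrow> 'p measure \<Rightarrow> real set" where
  "dirichlet_spectrum R \<mu> B \<sigma> =
     {\<omega>. \<exists>s u. helmholtz_solution R \<mu> B \<omega> s u \<and> L2_tendsto \<sigma> s (\<lambda>_. 0) \<and>
           \<not> (\<lambda>k. H1_norm R \<mu> (s k)) \<longlonglongrightarrow> 0}"

text \<open>
  The graph in \<open>L\<^sup>2(\<sigma>)\<close> of the Dirichlet-to-Neumann operator. The outward normal derivative \<open>\<eta>\<close> of an
  \<open>H\<^sup>1\<close> solution \<open>u\<close> is given by Green's formula
  \<open>\<integral> \<langle>\<nabla>u, \<nabla>\<phi>\<rangle> - \<omega> u cnj \<phi> d\<mu> = \<integral> \<eta> cnj \<phi> d\<sigma>\<close> for all \<open>\<phi>\<close> smooth up to the boundary.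
\<close>

definition dn_graph ::
    "('i, 'p::topological_space, 'e::euclidean_space) riem \<Rightarrow> 'p measure \<Rightarrow> 'p set \<Rightarrow> 'p measure \<Rightarrow> real \<Rightarrow>
     ('p \<Rightarrow> complex) \<Rightarrow> ('p \<Rightarrow> complex) \<Rightarrow> bool" where
  "dn_graph R \<mu> B \<sigma> \<omega> \<psi> \<eta> \<longleftrightarrow>
     \<psi> \<in> L2 \<sigma> \<and> \<eta> \<in> L2 \<sigma> \<and>
     (\<exists>s u. helmholtz_solution R \<mu> B \<omega> s u \<and> L2_tendsto \<sigma> s \<psi> \<and>
        (\<forall>\<phi>. smooth_fun R \<phi> \<longrightarrow>
           (\<lambda>k. LINT p|\<mu>. grad_inner R (s k) \<phi> p - complex_of_real \<omega> * s k p * cnj (\<phi> p))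
             \<longlonglongrightarrow> (LINT p|\<sigma>. \<eta> p * cnj (\<phi> p))))"

definition laplace_eigenfunction ::
    "('i, 'p::topological_space, 'e::euclidean_space) riem \<Rightarrow> 'p measure \<Rightarrow> real \<Rightarrow> ('p \<Rightarrow> complex) \<Rightarrow> bool" where
  "laplace_eigenfunction R \<mu> ev y \<longleftrightarrow> (\<exists>s. helmholtz_solution R \<mu> {} ev s y)"

definition L2_inner :: "'p measure \<Rightarrow> ('p \<Rightarrow> complex) \<Rightarrow> ('p \<Rightarrow> complex) \<Rightarrow> complex" where
  "L2_inner \<mu> u h = (LINT p|\<mu>. u p * cnj (h p))"

definition L2_orthonormal_basis :: "'p measure \<Rightarrow> (nat \<Rightarrow> 'p \<Rightarrow> complex) \<Rightarrow> bool" where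
  "L2_orthonormal_basis \<mu> Y \<longleftrightarrow>
     (\<forall>m. Y m \<in> L2 \<mu>) \<and>
     (\<forall>m l. L2_inner \<mu> (Y m) (Y l) = (if m = l then 1 else 0)) \<and>
     (\<forall>h\<in>L2 \<mu>. L2_tendsto \<mu> (\<lambda>N p. \<Sum>m<N. L2_inner \<mu> h (Y m) * Y m p) h)"

definition laplace_eigenbasis ::
    "('i, 'p::topological_space, 'e::euclidean_space) riem \<Rightarrow> 'p measure \<Rightarrow> (nat \<Rightarrow> real) \<Rightarrow>
     (nat \<Rightarrow> 'p \<Rightarrow> complex) \<Rightarrow> bool" where
  "laplace_eigenbasis R \<mu> ev Y \<longleftrightarrow>
     ev 0 = 0 \<and> ev 0 < ev 1 \<and> mono ev \<and> filterlim ev at_top sequentially \<and>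
     L2_orthonormal_basis \<mu> Y \<and>
     (\<forall>m. laplace_eigenfunction R \<mu> (ev m) (Y m))"


section \<open>The product \<open>[0,1] \<times> K\<close>\<close>

text \<open>The metric \<open>f(x) (dx\<^sup>2 + g\<^sub>K)\<close>.\<close>

definition warped_product ::
    "(real \<Rightarrow> real) \<Rightarrow> ('i, 'k, 'e::euclidean_space) riem \<Rightarrow> ('i, real \<times> 'k, real \<times> 'e) riem" where
  "warped_product f K =
     \<lparr> index = index K,
       chart_dom = (\<lambda>i. {0..1} \<times> chart_dom K i),
       coord = (\<lambda>i (x, p). (x, coord K i p)),
       metric = (\<lambda>i (x, z) (a, v) (b, w). f x * (a * b + metric K i z v w)) \<rparr>"

text \<open>
  The boundary \<open>\<Gamma>\<^sub>0 \<union> \<Gamma>\<^sub>1\<close> with the induced metric: \<open>(0, v)\<close> is the image of the tangent vector \<open>v\<close> of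
  \<open>\<Gamma>\<^sub>j\<close> under the inclusion.
\<close>

definition warped_boundary ::
    "(real \<Rightarrow> real) \<Rightarrow> ('i, 'k, 'e::euclidean_space) riem \<Rightarrow> (real \<times> 'i, real \<times> 'k, 'e) riem" where
  "warped_boundary f K =
     \<lparr> index = {0, 1} \<times> index K,
       chart_dom = (\<lambda>(j, i). {j} \<times> chart_dom K i),
       coord = (\<lambda>(j, i) (x, p). coord K i p),
       metric = (\<lambda>(j, i) z v w. metric (warped_product f K) i (j, z) (0, v) (0, w)) \<rparr>"

definition boundary_mode :: "('k \<Rightarrow> complex) \<Rightarrow> complex \<Rightarrow> complex \<Rightarrow> real \<times> 'k \<Rightarrow> complex" where
  "boundary_mode y a b = (\<lambda>(x, p). (if x = 0 then a else b) * y p)"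

text \<open>
  The real eigenvalues of the restriction of the Dirichlet-to-Neumann operator to the space
  \<open>{boundary_mode y a b | a b}\<close>. For \<open>y\<close> an eigenfunction on \<open>K\<close> there are exactly two, so that
  \<open>Min\<close> and \<open>Max\<close> are \<open>\<lambda>\<^sup>-\<close> and \<open>\<lambda>\<^sup>+\<close>.
\<close>

definition steklov_eigenvalues ::
    "(real \<Rightarrow> real) \<Rightarrow> ('i, 'k::topological_space, 'e::euclidean_space) riem \<Rightarrow>
     (real \<times> 'k) measure \<Rightarrow> (real \<times> 'k) measure \<Rightarrow> real \<Rightarrow> ('k \<Rightarrow> complex) \<Rightarrow> real set" where
  "steklov_eigenvalues f K \<mu> \<sigma> \<omega> y =
     {ev. \<exists>a b. (a, b) \<noteq> (0, 0) \<and>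
        dn_graph (warped_product f K) \<mu> (points (warped_boundary f K)) \<sigma> \<omega>
          (boundary_mode y a b) (\<lambda>q. complex_of_real ev * boundary_mode y a b q)}"

definition steklov_minus ::
    "(real \<Rightarrow> real) \<Rightarrow> ('i, 'k::topological_space, 'e::euclidean_space) riem \<Rightarrow>
     (real \<times> 'k) measure \<Rightarrow> (real \<times> 'k) measure \<Rightarrow> real \<Rightarrow> ('k \<Rightarrow> complex) \<Rightarrow> real" where
  "steklov_minus f K \<mu> \<sigma> \<omega> y = Min (steklov_eigenvalues f K \<mu> \<sigma> \<omega> y)"

definition steklov_plus ::
    "(real \<Rightarrow> real) \<Rightarrow> ('i, 'k::topological_space, 'e::euclidean_space) riem \<Rightarrow>
     (real \<times> 'k) measure \<Rightarrow> (real \<times> 'k) measure \<Rightarrow> real \<Rightarrow> ('k \<Rightarrow> complex) \<Rightarrow> real" where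
  "steklov_plus f K \<mu> \<sigma> \<omega> y = Max (steklov_eigenvalues f K \<mu> \<sigma> \<omega> y)"

end

theory Submission
  imports Defs
begin

text \<open>Let \<open>u\<close> solve the Helmholtz equation with boundary data in the mode \<open>Y = Y m\<close>, an eigenvector of the
Dirichlet-to-Neumann operator with eigenvalue \<open>\<lambda>\<close>, and let \<open>S x = \<integral> u(x, \<cdot>) cnj Y\<close>. Separation of variables
turns the eigenvalue equation into a weak equation on \<open>[0,1]\<close>:
\<open>B(S, w) = \<kappa> (S 0 * w 0 + S 1 * w 1)\<close> for all \<open>w\<close>, where \<open>B(v, w) = \<integral> p v' w' + q v w\<close> with
\<open>p = f powr (n/2 - 1)\<close>, \<open>q = \<mu> p - \<omega> (f powr (n/2))\<close> and \<open>\<kappa> = (f 0) powr ((n-1)/2) * \<lambda>\<close>. This is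
\<open>steklov_weak_mode\<close>; the rest of the argument concerns \<open>B\<close>, which is coercive for large \<open>\<mu>\<close>.

From here on let \<open>u\<close> and \<open>v\<close> be two such functions \<open>S\<close> on \<open>[0,1]\<close>, called modes, with values \<open>\<kappa>1\<close>, \<open>\<kappa>2\<close>
and real unit boundary vectors \<open>(a1, b1)\<close>, \<open>(a2, b2)\<close>. Three choices of test function give three relations. Symmetry of \<open>B\<close> gives
\<open>(\<kappa>1 - \<kappa>2) (a1 a2 + b1 b2) = 0\<close>. Testing each mode with the reflection \<open>x \<mapsto> 1 - x\<close> of the other gives
\<open>(\<kappa>1 - \<kappa>2) (a1 b2 + b1 a2)\<close> as an integral that contains only the differences of \<open>p\<close> and \<open>q\<close> from their
reflections; since \<open>f x\<close> and \<open>f (1 - x)\<close> have the same Taylor series at both ends, these vanish there to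
infinite order. Testing each mode with a cut-off of the other, whose derivative is a high power of
\<open>x (1 - x)\<close>, gives a multiple of \<open>(\<kappa>1 - \<kappa>2) b1 b2\<close> as an integral over that power. When the vectors are
orthogonal, \<open>(a1 b2 + b1 a2)\<^sup>2 + 4 (b1 b2)\<^sup>2 = 1\<close>, so that \<open>a1 b2 + b1 a2\<close> and \<open>b1 b2\<close> are not both small. Hence
\<open>\<bar>\<kappa>1 - \<kappa>2\<bar>\<close> is bounded by energies of the modes with weight a high power of \<open>x (1 - x)\<close>
(\<open>weak_mode_gap\<close>).

These energies are small because a mode lives in a layer of width \<open>1 / sqrt \<mu>\<close> at the ends: testing the
equation with \<open>\<zeta>\<^sup>2 u\<close> for a power \<open>\<zeta>\<close> of \<open>x (1 - x)\<close> shows that each further factor \<open>x (1 - x)\<close> in \<open>\<zeta>\<close>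
gains \<open>1 / \<mu>\<close> (\<open>layer_energy_step\<close>), while the total energy is at most a multiple of \<open>\<mu>\<close>, by comparison
with a linear function. So the gap is \<open>\<O>(\<mu> powr (1 - N))\<close> for every \<open>N\<close> (\<open>radial_gap\<close>).

The passage to \<open>[0,1]\<close> must cope with elements of \<open>H\<^sup>1\<close> given by Cauchy sequences \<open>s\<close> of smooth functions,
and with eigenfunctions \<open>Y\<close> that are themselves only limits of smooth functions \<open>y l\<close>. The test functions
are \<open>P x * y l p\<close> with \<open>P\<close> a polynomial: as \<open>l\<close> tends to infinity, the form converges for each member of
\<open>s\<close>, and Cauchy's criterion holds uniformly along \<open>s\<close>, so the two limits may be interchanged
(\<open>radial_weak_form\<close>). Polynomials are dense enough in the continuously differentiable functions for
the other tests (\<open>weak_mode_of_polynomials\<close>). The geometric input is that the Riemannian volumes are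
product measures (\<open>M_product\<close>, \<open>bdry_product\<close>) and that the gradient product splits
(\<open>grad_inner_W\<close>) and is continuous (\<open>grad_inner_K_cont\<close>).\<close>

section \<open>Differentiable functions on the unit interval\<close>

text \<open>The derivative is carried along as a second function, so that sequences in \<open>H\<^sup>1\<close> are pairs of sequences and
no choice of a one-sided derivative at the ends enters the integrals.\<close>

definition C1 :: "(real \<Rightarrow> real) \<Rightarrow> (real \<Rightarrow> real) \<Rightarrow> bool" where
  "C1 u u' \<longleftrightarrow> (\<forall>x\<in>{0..1}. (u has_real_derivative u' x) (at x within {0..1})) \<and> continuous_on {0..1} u'"

definition bform where
  "bform p q u u' v v' = integral {0..1} (\<lambda>x::real. p x * (u' x * v' x) + q x * (u x * v x) :: real)"

definition sobolev_sq where
  "sobolev_sq u u' = integral {0..1} (\<lambda>x::real. (u' x)\<^sup>2 + (u x)\<^sup>2 :: real)"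

definition sobolev_cauchy :: "(nat \<Rightarrow> real \<Rightarrow> real) \<Rightarrow> (nat \<Rightarrow> real \<Rightarrow> real) \<Rightarrow> bool" where
  "sobolev_cauchy u u' \<longleftrightarrow> (\<forall>k. C1 (u k) (u' k)) \<and>
     (\<forall>e>0. \<exists>N. \<forall>k\<ge>N. \<forall>l\<ge>N. sobolev_sq (\<lambda>x. u k x - u l x) (\<lambda>x. u' k x - u' l x) < e)"

lemma C1_cont: assumes "C1 u u'" shows "continuous_on {0..1} u" "continuous_on {0..1} u'"
  using assms unfolding C1_def by (auto intro: DERIV_continuous_on)

lemma C1_diff: "C1 u u' \<Longrightarrow> C1 v v' \<Longrightarrow> C1 (\<lambda>x. u x - v x) (\<lambda>x. u' x - v' x)"
  unfolding C1_def by (auto intro!: continuous_intros derivative_eq_intros)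

lemma C1_mult: "C1 u u' \<Longrightarrow> C1 v v' \<Longrightarrow> C1 (\<lambda>x. u x * v x) (\<lambda>x. u' x * v x + u x * v' x)"
  using C1_cont[of u u'] C1_cont[of v v']
  unfolding C1_def by (auto intro!: continuous_intros derivative_eq_intros simp: algebra_simps)

lemma C1_reflect: assumes "C1 u u'" shows "C1 (\<lambda>x. u (1 - x)) (\<lambda>x. - u' (1 - x))"
proof -
  have im: "(\<lambda>x::real. 1 - x) ` {0..1} = {0..1}"
    by (auto intro: image_eqI[of _ _ "1 - _"])
  have "((\<lambda>x. u (1 - x)) has_real_derivative u' (1 - x) * (- 1)) (at x within {0..1})" if x: "x \<in> {0..1}" for x
  proof (rule DERIV_image_chain[where f = u and g = "\<lambda>x. 1 - x", unfolded o_def])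
    show "(u has_real_derivative u' (1 - x)) (at (1 - x) within (\<lambda>x. 1 - x) ` {0..1})"
      unfolding im using assms x unfolding C1_def by auto
    show "((-) 1 has_real_derivative - 1) (at x within {0..1})"
      by (auto intro!: derivative_eq_intros)
  qed
  moreover have "continuous_on {0..1} (\<lambda>x. - u' (1 - x))"
    by (rule continuous_intros, rule continuous_on_compose2[OF C1_cont(2)[OF assms]])
      (auto intro!: continuous_intros)
  ultimately show ?thesis unfolding C1_def by simp
qed

lemma C1_linear: "C1 (\<lambda>x. a + b * x) (\<lambda>x. b)"
  unfolding C1_def by (auto intro!: continuous_intros derivative_eq_intros)

lemma integrable_cont01: "continuous_on {0..1} f \<Longrightarrow> (f::real\<Rightarrow>real) integrable_on {0..1}"
  by (rule integrable_continuous_interval)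

lemma integral_mono01:
  assumes "continuous_on {0..1} f" "continuous_on {0..1} g" "\<And>x. x\<in>{0..1} \<Longrightarrow> f x \<le> (g x :: real)"
  shows "integral {0..1} f \<le> integral {0..1::real} g"
  using assms by (intro integral_le integrable_cont01) auto

lemma integral_abs01:
  assumes "continuous_on {0..1} f" "continuous_on {0..1} g" "\<And>x. x\<in>{0..1} \<Longrightarrow> \<bar>f x\<bar> \<le> (g x :: real)"
  shows "\<bar>integral {0..1::real} f\<bar> \<le> integral {0..1} g"
  using integral_norm_bound_integral[of f "{0..1}" g] assms by (auto intro!: integrable_cont01)

lemma integral_add01:
  assumes "continuous_on {0..1} f" "continuous_on {0..1} g"
  shows "integral {0..1::real} (\<lambda>x. f x + g x :: real) = integral {0..1} f + integral {0..1} g"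
  by (intro integral_add integrable_cont01 assms)

lemma integral_diff01:
  assumes "continuous_on {0..1} f" "continuous_on {0..1} g"
  shows "integral {0..1::real} (\<lambda>x. f x - g x :: real) = integral {0..1} f - integral {0..1} g"
  by (intro integral_diff integrable_cont01 assms)

text \<open>The weight \<open>t\<close> does the work of the Cauchy--Schwarz inequality: a small \<open>t\<close> makes the first term small
against a bound, after which the second tends to zero along a Cauchy sequence.\<close>

lemma weighted_amgm: assumes "t > (0::real)" shows "\<bar>a * b\<bar> \<le> t * a\<^sup>2 + b\<^sup>2 / t"
proof -
  have s: "2 * (sqrt t * \<bar>a\<bar>) * (\<bar>b\<bar> / sqrt t) = 2 * \<bar>a * b\<bar>" using assms by (simp add: abs_mult)
  have "2 * (sqrt t * \<bar>a\<bar>) * (\<bar>b\<bar> / sqrt t) \<le> (sqrt t * \<bar>a\<bar>)\<^sup>2 + (\<bar>b\<bar> / sqrt t)\<^sup>2"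
    by (rule sum_squares_bound)
  also have "\<dots> = t * a\<^sup>2 + b\<^sup>2 / t" using assms by (simp add: power_mult_distrib power_divide)
  finally have "2 * \<bar>a * b\<bar> \<le> t * a\<^sup>2 + b\<^sup>2 / t" unfolding s .
  moreover have "\<bar>a * b\<bar> \<le> 2 * \<bar>a * b\<bar>" by simp
  ultimately show ?thesis by (rule order_trans[rotated])
qed

lemma sobolev_sq_nonneg: assumes "C1 u u'" shows "0 \<le> sobolev_sq u u'"
  unfolding sobolev_sq_def by (intro integral_nonneg integrable_cont01) (auto intro!: continuous_intros C1_cont[OF assms])

lemma bform_bound:
  assumes u: "C1 u u'" and v: "C1 v v'" and pq: "continuous_on {0..1} p" "continuous_on {0..1} q"
    and M: "\<And>x. x \<in> {0..1} \<Longrightarrow> \<bar>p x\<bar> \<le> M" "\<And>x. x \<in> {0..1} \<Longrightarrow> \<bar>q x\<bar> \<le> M" and t: "t > 0"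
  shows "\<bar>bform p q u u' v v'\<bar> \<le> M * (t * sobolev_sq u u' + sobolev_sq v v' / t)"
proof -
  note c = C1_cont[OF u] C1_cont[OF v]
  have "\<bar>bform p q u u' v v'\<bar> \<le> integral {0..1} (\<lambda>x. M * (t * ((u' x)\<^sup>2 + (u x)\<^sup>2) + ((v' x)\<^sup>2 + (v x)\<^sup>2) / t))"
    unfolding bform_def
  proof (rule integral_abs01)
    fix x :: real assume x: "x \<in> {0..1}"
    have M0: "M \<ge> 0" using M(1)[OF x] by linarith
    have "\<bar>p x * (u' x * v' x)\<bar> \<le> M * (t * (u' x)\<^sup>2 + (v' x)\<^sup>2 / t)"
      using mult_mono[OF M(1)[OF x] weighted_amgm[OF t, of "u' x" "v' x"] M0] by (simp add: abs_mult)
    moreover have "\<bar>q x * (u x * v x)\<bar> \<le> M * (t * (u x)\<^sup>2 + (v x)\<^sup>2 / t)"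
      using mult_mono[OF M(2)[OF x] weighted_amgm[OF t, of "u x" "v x"] M0] by (simp add: abs_mult)
    ultimately show "\<bar>p x * (u' x * v' x) + q x * (u x * v x)\<bar> \<le> M * (t * ((u' x)\<^sup>2 + (u x)\<^sup>2) + ((v' x)\<^sup>2 + (v x)\<^sup>2) / t)"
      using abs_triangle_ineq[of "p x * (u' x * v' x)" "q x * (u x * v x)"] 
      by (simp add: distrib_left add_divide_distrib)
  qed (use t in \<open>auto intro!: continuous_intros c pq\<close>)
  also have "\<dots> = M * (t * sobolev_sq u u' + sobolev_sq v v' / t)"
    unfolding sobolev_sq_def by (subst integral_mult_right, subst integral_add01)
       (use t in \<open>auto intro!: continuous_intros c pq\<close>)
  finally show ?thesis .
qed

lemma bform_diff_right:
  assumes u: "C1 u u'" and v: "C1 v v'" and w: "C1 w w'" and pq: "continuous_on {0..1} p" "continuous_on {0..1} q"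
  shows "bform p q u u' (\<lambda>x. v x - w x) (\<lambda>x. v' x - w' x) = bform p q u u' v v' - bform p q u u' w w'"
  unfolding bform_def
  by (subst integral_diff01[symmetric])
    (auto intro!: continuous_intros C1_cont[OF u] C1_cont[OF v] C1_cont[OF w] pq simp: algebra_simps)

lemma bform_sym: "bform p q u u' v v' = bform p q v v' u u'"
  unfolding bform_def by (simp add: mult_ac)

lemma sobolev_sq_le_double:
  assumes u: "C1 u u'" and v: "C1 v v'" 
  shows "sobolev_sq u u' \<le> 2 * sobolev_sq (\<lambda>x. u x - v x) (\<lambda>x. u' x - v' x) + 2 * sobolev_sq v v'"
proof -
  note c = C1_cont[OF u] C1_cont[OF v]
  have *: "(a::real)\<^sup>2 \<le> 2 * (a - b)\<^sup>2 + 2 * b\<^sup>2" for a b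
    using sum_squares_bound[of "a - b" b] by (simp add: power2_eq_square algebra_simps)
  have "sobolev_sq u u' \<le> integral {0..1} (\<lambda>x. 2 * ((u' x - v' x)\<^sup>2 + (u x - v x)\<^sup>2) + 2 * ((v' x)\<^sup>2 + (v x)\<^sup>2))"
    unfolding sobolev_sq_def
  proof (rule integral_mono01)
    fix x show "(u' x)\<^sup>2 + (u x)\<^sup>2 \<le> 2 * ((u' x - v' x)\<^sup>2 + (u x - v x)\<^sup>2) + 2 * ((v' x)\<^sup>2 + (v x)\<^sup>2)"
      using *[of "u x" "v x"] *[of "u' x" "v' x"] by argo
  qed (auto intro!: continuous_intros c)
  also have "\<dots> = 2 * sobolev_sq (\<lambda>x. u x - v x) (\<lambda>x. u' x - v' x) + 2 * sobolev_sq v v'"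
    unfolding sobolev_sq_def
    by (subst integral_add01) (intro continuous_intros c, intro continuous_intros c, simp only: integral_mult_right)
  finally show ?thesis .
qed

lemma sobolev_cauchy_bounded:
  assumes "sobolev_cauchy u u'"
  obtains C N where "C > 0" "\<And>k. k \<ge> N \<Longrightarrow> sobolev_sq (u k) (u' k) \<le> C"
proof -
  obtain N where N: "\<And>k l. k \<ge> N \<Longrightarrow> l \<ge> N \<Longrightarrow> sobolev_sq (\<lambda>x. u k x - u l x) (\<lambda>x. u' k x - u' l x) < 1"
    using assms unfolding sobolev_cauchy_def by (metis zero_less_one)
  have C: "C1 (u k) (u' k)" for k using assms unfolding sobolev_cauchy_def by blast
  show ?thesis
  proof (rule that[of "2 + 2 * sobolev_sq (u N) (u' N)" N])
    show "2 + 2 * sobolev_sq (u N) (u' N) > 0" using sobolev_sq_nonneg[OF C[of N]] by linarith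
    fix k assume "k \<ge> N"
    then show "sobolev_sq (u k) (u' k) \<le> 2 + 2 * sobolev_sq (u N) (u' N)"
      using sobolev_sq_le_double[OF C[of k] C[of N]] N[of k N] by auto
  qed
qed

lemma cont_bounded01: assumes "continuous_on {0..1::real} (p :: real \<Rightarrow> real)"
  obtains M where "M > 0" "\<And>x. x \<in> {0..1} \<Longrightarrow> \<bar>p x\<bar> \<le> M"
proof -
  have "bounded (p ` {0..1})" by (intro compact_imp_bounded compact_continuous_image assms) auto
  then obtain M where "\<forall>y\<in>p ` {0..1}. norm y \<le> M" unfolding bounded_iff by blast
  then show ?thesis by (intro that[of "\<bar>M\<bar> + 1"]) (auto intro: order_trans[of _ "M"])
qed

lemma cont_bounded01_2: assumes "continuous_on {0..1::real} (p :: real \<Rightarrow> real)" "continuous_on {0..1::real} (q :: real \<Rightarrow> real)"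
  obtains M where "M > 0" "\<And>x. x \<in> {0..1} \<Longrightarrow> \<bar>p x\<bar> \<le> M" "\<And>x. x \<in> {0..1} \<Longrightarrow> \<bar>q x\<bar> \<le> M"
proof -
  obtain M1 where M1: "M1 > 0" "\<And>x. x \<in> {0..1} \<Longrightarrow> \<bar>p x\<bar> \<le> M1" by (rule cont_bounded01[OF assms(1)]) blast
  obtain M2 where M2: "M2 > 0" "\<And>x. x \<in> {0..1} \<Longrightarrow> \<bar>q x\<bar> \<le> M2" by (rule cont_bounded01[OF assms(2)]) blast
  show ?thesis by (rule that[of "max M1 M2"]) (use M1 M2 in force)+
qed

section \<open>Weak modes\<close>

text \<open>A Cauchy sequence \<open>u\<close> in \<open>H\<^sup>1(0,1)\<close> with boundary values \<open>a\<close>, \<open>b\<close> whose limit satisfies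
\<open>- (p u')' + q u = 0\<close> with fluxes \<open>p u' (1) = \<kappa> b\<close> and \<open>- p u' (0) = \<kappa> a\<close>. Keeping the sequence
instead of its limit leaves all functions continuously differentiable.\<close>

definition weak_mode where
  "weak_mode p q \<kappa> a b u u' \<longleftrightarrow> sobolev_cauchy u u' \<and> (\<lambda>k. u k 0) \<longlonglongrightarrow> a \<and> (\<lambda>k. u k 1) \<longlonglongrightarrow> b \<and>
     (\<forall>w w'. C1 w w' \<longrightarrow> (\<lambda>k. bform p q (u k) (u' k) w w') \<longlonglongrightarrow> \<kappa> * (a * w 0 + b * w 1))"

text \<open>The form is bounded on \<open>H\<^sup>1\<close>, so the test function may run along a Cauchy sequence together with the mode.
This allows a mode, multiplied by a function or reflected, to be tested against another mode.\<close>

lemma weak_mode_sequence: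
  assumes u: "weak_mode p q \<kappa> a b u u'" and w: "sobolev_cauchy w w'"
    and lim: "(\<lambda>k. w k 0) \<longlonglongrightarrow> \<alpha>" "(\<lambda>k. w k 1) \<longlonglongrightarrow> \<beta>"
    and pq: "continuous_on {0..1} p" "continuous_on {0..1} q"
  shows "(\<lambda>k. bform p q (u k) (u' k) (w k) (w' k)) \<longlonglongrightarrow> \<kappa> * (a * \<alpha> + b * \<beta>)"
proof (rule LIMSEQ_I)
  fix e :: real assume e: "e > 0"
  have cu: "C1 (u k) (u' k)" and cw: "C1 (w k) (w' k)" for k
    using u w unfolding weak_mode_def sobolev_cauchy_def by blast+
  obtain M where M: "M > 0" "\<And>x. x \<in> {0..1} \<Longrightarrow> \<bar>p x\<bar> \<le> M" "\<And>x. x \<in> {0..1} \<Longrightarrow> \<bar>q x\<bar> \<le> M"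
    by (rule cont_bounded01_2[OF pq]) blast
  obtain C N0 where C: "C > 0" "\<And>k. k \<ge> N0 \<Longrightarrow> sobolev_sq (u k) (u' k) \<le> C"
    using sobolev_cauchy_bounded u unfolding weak_mode_def by metis
  \<comment> \<open>the weight at which the first term of \<open>bform_bound\<close> is \<open>e / 8\<close>\<close>
  define t where "t = e / (8 * M * C)"
  have t: "t > 0" unfolding t_def using e M C by simp
  have "e * t / (8 * M) > 0" using e t M by simp
  then obtain N1 where N1: "\<And>k l. k \<ge> N1 \<Longrightarrow> l \<ge> N1 \<Longrightarrow> sobolev_sq (\<lambda>x. w k x - w l x) (\<lambda>x. w' k x - w' l x) < e * t / (8 * M)"
    using w unfolding sobolev_cauchy_def by metis
  have close: "\<bar>bform p q (u k) (u' k) (w k) (w' k) - bform p q (u k) (u' k) (w l) (w' l)\<bar> \<le> e / 4"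
    if k: "k \<ge> N0" "k \<ge> N1" and l: "l \<ge> N1" for k l
  proof -
    have "\<bar>bform p q (u k) (u' k) (\<lambda>x. w k x - w l x) (\<lambda>x. w' k x - w' l x)\<bar>
      \<le> M * (t * sobolev_sq (u k) (u' k) + sobolev_sq (\<lambda>x. w k x - w l x) (\<lambda>x. w' k x - w' l x) / t)"
      by (rule bform_bound) (use M t pq in \<open>auto intro: C1_diff cu cw\<close>)
    also have "\<dots> \<le> M * (t * C + (e * t / (8 * M)) / t)"
      using C(2)[OF k(1)] N1[OF k(2) l] M t by (intro mult_left_mono add_mono divide_right_mono) auto
    also have "\<dots> = e / 4" unfolding t_def using M C e by (simp add: field_simps)
    finally show ?thesis by (simp add: bform_diff_right[OF cu cw cw pq])
  qed
  have "(\<lambda>j. \<kappa> * (a * w j 0 + b * w j 1)) \<longlonglongrightarrow> \<kappa> * (a * \<alpha> + b * \<beta>)"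
    by (intro tendsto_intros lim)
  from LIMSEQ_D[OF this, of "e/4"] obtain N2 where N2: "\<And>j. j \<ge> N2 \<Longrightarrow> \<bar>\<kappa> * (a * w j 0 + b * w j 1) - \<kappa> * (a * \<alpha> + b * \<beta>)\<bar> < e / 4"
    using e by auto
  define l where "l = max N1 N2"
  have "(\<lambda>k. bform p q (u k) (u' k) (w l) (w' l)) \<longlonglongrightarrow> \<kappa> * (a * w l 0 + b * w l 1)"
    using u cw unfolding weak_mode_def by blast
  from LIMSEQ_D[OF this, of "e/4"] obtain N3 where N3: "\<And>k. k \<ge> N3 \<Longrightarrow> \<bar>bform p q (u k) (u' k) (w l) (w' l) - \<kappa> * (a * w l 0 + b * w l 1)\<bar> < e / 4"
    using e by auto
  show "\<exists>no. \<forall>n\<ge>no. norm (bform p q (u n) (u' n) (w n) (w' n) - \<kappa> * (a * \<alpha> + b * \<beta>)) < e"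
  proof (intro exI allI impI)
    fix k assume k: "k \<ge> max N0 (max N1 N3)"
    show "norm (bform p q (u k) (u' k) (w k) (w' k) - \<kappa> * (a * \<alpha> + b * \<beta>)) < e"
      using close[of k l] N3[of k] N2[of l] k e unfolding l_def real_norm_def by (simp add: abs_if split: if_splits)
  qed
qed

lemma sobolev_cauchy_mult:
  assumes z: "C1 z z'" and u: "sobolev_cauchy u u'"
  shows "sobolev_cauchy (\<lambda>k x. z x * u k x) (\<lambda>k x. z' x * u k x + z x * u' k x)"
  unfolding sobolev_cauchy_def
proof (intro conjI allI impI)
  have cu: "C1 (u k) (u' k)" for k using u unfolding sobolev_cauchy_def by blast
  show "C1 (\<lambda>x. z x * u k x) (\<lambda>x. z' x * u k x + z x * u' k x)" for k
    by (rule C1_mult[OF z cu])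
  fix e :: real assume e: "e > 0"
  obtain M where M: "M > 0" "\<And>x. x \<in> {0..1} \<Longrightarrow> \<bar>z x\<bar> \<le> M" "\<And>x. x \<in> {0..1} \<Longrightarrow> \<bar>z' x\<bar> \<le> M"
    by (rule cont_bounded01_2[OF C1_cont[OF z]]) blast
  have "e / (3 * M\<^sup>2) > 0" using e M by simp
  then obtain N where N: "\<And>k l. k \<ge> N \<Longrightarrow> l \<ge> N \<Longrightarrow> sobolev_sq (\<lambda>x. u k x - u l x) (\<lambda>x. u' k x - u' l x) < e / (3 * M\<^sup>2)"
    using u unfolding sobolev_cauchy_def by metis
  show "\<exists>N. \<forall>k\<ge>N. \<forall>l\<ge>N. sobolev_sq (\<lambda>x. z x * u k x - z x * u l x) 
        (\<lambda>x. z' x * u k x + z x * u' k x - (z' x * u l x + z x * u' l x)) < e"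
  proof (intro exI allI impI)
    fix k l assume kl: "k \<ge> N" "l \<ge> N"
    note c = C1_cont[OF cu] C1_cont[OF z]
    have "sobolev_sq (\<lambda>x. z x * u k x - z x * u l x) (\<lambda>x. z' x * u k x + z x * u' k x - (z' x * u l x + z x * u' l x))
      \<le> integral {0..1} (\<lambda>x. 3 * M\<^sup>2 * ((u' k x - u' l x)\<^sup>2 + (u k x - u l x)\<^sup>2))"
      unfolding sobolev_sq_def
    proof (rule integral_mono01)
      fix x :: real assume x: "x \<in> {0..1}"
      define d d' where "d = u k x - u l x" and "d' = u' k x - u' l x"
      have zM: "(z x)\<^sup>2 \<le> M\<^sup>2" "(z' x)\<^sup>2 \<le> M\<^sup>2"
        using M(2,3)[OF x] by (metis abs_ge_zero power2_abs power_mono)+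
      have zd: "(z x)\<^sup>2 * d\<^sup>2 \<le> M\<^sup>2 * d\<^sup>2" "(z' x)\<^sup>2 * d\<^sup>2 \<le> M\<^sup>2 * d\<^sup>2" "(z x)\<^sup>2 * d'\<^sup>2 \<le> M\<^sup>2 * d'\<^sup>2"
        using zM by (auto intro!: mult_right_mono)
      have nn: "0 \<le> M\<^sup>2 * d'\<^sup>2" by simp
      have "(z' x * d + z x * d')\<^sup>2 \<le> 2 * ((z' x)\<^sup>2 * d\<^sup>2) + 2 * ((z x)\<^sup>2 * d'\<^sup>2)"
        using sum_squares_bound[of "z' x * d" "z x * d'"] by (simp add: power2_sum power_mult_distrib mult_ac)
      moreover have "(z x * d)\<^sup>2 = (z x)\<^sup>2 * d\<^sup>2" by (simp add: power_mult_distrib)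
      ultimately have "(z' x * d + z x * d')\<^sup>2 + (z x * d)\<^sup>2 \<le> 3 * M\<^sup>2 * (d'\<^sup>2 + d\<^sup>2)"
        using zd nn unfolding distrib_left mult.assoc by linarith
      then show "(z' x * u k x + z x * u' k x - (z' x * u l x + z x * u' l x))\<^sup>2 + (z x * u k x - z x * u l x)\<^sup>2
          \<le> 3 * M\<^sup>2 * ((u' k x - u' l x)\<^sup>2 + (u k x - u l x)\<^sup>2)"
        by (simp add: d_def d'_def algebra_simps)
    qed (auto intro!: continuous_intros c)
    also have "\<dots> = 3 * M\<^sup>2 * sobolev_sq (\<lambda>x. u k x - u l x) (\<lambda>x. u' k x - u' l x)"
      unfolding sobolev_sq_def by (rule integral_mult_right)
    also have "\<dots> < e" using N[OF kl] M e by (simp add: field_simps)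
    finally show "sobolev_sq (\<lambda>x. z x * u k x - z x * u l x) (\<lambda>x. z' x * u k x + z x * u' k x - (z' x * u l x + z x * u' l x)) < e" .
  qed
qed

lemma integral_reflect01:
  assumes "continuous_on {0..1} g"
  shows "integral {0..1} (\<lambda>x. g (1 - x)) = integral {0..1::real} (g :: real \<Rightarrow> real)"
proof -
  have im: "(\<lambda>x::real. 1 - x) ` {0..1} = {0..1}"
    by (auto intro: image_eqI[of _ _ "1 - _"])
  have "(g has_integral integral {0..1} g) (cbox 0 1)"
    using integrable_integral[OF integrable_cont01[OF assms]] by simp
  from has_integral_affinity[OF this, of "-1" 1]
  have "((\<lambda>x. g (1 - x)) has_integral integral {0..1} g) {0..1}"
    by (simp add: im)
  then show ?thesis by (rule integral_unique)
qed

section \<open>Decay away from the ends\<close>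

text \<open>The weight that measures the distance to the ends. It is symmetric under reflection.\<close>

definition \<zeta> :: "nat \<Rightarrow> real \<Rightarrow> real" where "\<zeta> N x = (x * (1 - x)) ^ N"

lemma zeta_cont[continuous_intros]: "continuous_on S (\<zeta> N)"
  unfolding \<zeta>_def by (intro continuous_intros)

lemma zeta_reflect: "\<zeta> N (1 - x) = \<zeta> N x"
  unfolding \<zeta>_def by (simp add: mult.commute)

definition layer_energy where
  "layer_energy p q N u u' = integral {0..1} (\<lambda>x. (\<zeta> N x)\<^sup>2 * (p x * (u' x)\<^sup>2 + q x * (u x)\<^sup>2))"

lemma layer_energy_0: "layer_energy p q 0 u u' = bform p q u u' u u'"
  unfolding layer_energy_def bform_def \<zeta>_def by (simp add: power2_eq_square)

definition agmon_const :: "nat \<Rightarrow> real" where "agmon_const N = (\<Prod>j=1..N. 8 * (real j)\<^sup>2)"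

lemma agmon_const_nonneg: "agmon_const N \<ge> 0" unfolding agmon_const_def by (intro prod_nonneg) auto

text \<open>The potential \<open>q\<close> is comparable to \<open>\<mu> p\<close>, with constants that do not depend on \<open>\<mu>\<close>; the point of the estimates
in this locale is how they depend on \<open>\<mu>\<close>.\<close>

locale coercive_form =
  fixes p q :: "real \<Rightarrow> real" and \<mu> p0 p1 :: real
  assumes cont: "continuous_on {0..1} p" "continuous_on {0..1} q"
    and p0: "p0 > 0" and \<mu>1: "\<mu> \<ge> 1"
    and p: "\<And>x. x \<in> {0..1} \<Longrightarrow> p0 \<le> p x" "\<And>x. x \<in> {0..1} \<Longrightarrow> p x \<le> p1"
    and q: "\<And>x. x \<in> {0..1} \<Longrightarrow> \<mu> * p x \<le> 2 * q x" "\<And>x. x \<in> {0..1} \<Longrightarrow> q x \<le> 2 * \<mu> * p x"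
begin

lemma p_pos: "x \<in> {0..1} \<Longrightarrow> p x > 0" using p(1) p0 by force
lemma q_pos: "x \<in> {0..1} \<Longrightarrow> q x > 0" using q(1)[of x] p_pos[of x] \<mu>1 mult_pos_pos[of \<mu> "p x"] by linarith
lemma p_le_q: "x \<in> {0..1} \<Longrightarrow> p x \<le> 2 * q x" using q(1)[of x] p_pos[of x] \<mu>1 mult_right_mono[of 1 \<mu> "p x"] by linarith

lemma C1_zeta_sq: "C1 (\<lambda>x. (\<zeta> (Suc N) x)\<^sup>2) (\<lambda>x. 2 * \<zeta> (Suc N) x * (real (Suc N) * (1 - 2 * x) * \<zeta> N x))"
proof -
  have "C1 (\<zeta> (Suc N)) (\<lambda>x. real (Suc N) * (1 - 2 * x) * \<zeta> N x)"
    unfolding C1_def \<zeta>_def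
  proof (intro conjI ballI)
    fix x :: real
    have "((\<lambda>x. x * (1 - x)) has_real_derivative 1 - 2 * x) (at x within {0..1})"
      by (auto intro!: derivative_eq_intros)
    from DERIV_power[OF this, of "Suc N"]
    show "((\<lambda>x. (x * (1 - x)) ^ Suc N) has_real_derivative real (Suc N) * (1 - 2 * x) * (x * (1 - x)) ^ N) (at x within {0..1})"
      by (simp only: diff_Suc_Suc diff_zero mult.assoc)
  qed (intro continuous_intros)
  from C1_mult[OF this this] show ?thesis
    by (simp add: power2_eq_square mult_ac)
qed

text \<open>An estimate of Agmon type. For \<open>\<zeta>\<close> of order \<open>N + 1\<close> the test function \<open>\<zeta>\<^sup>2 u\<close> vanishes at both ends, so
\<open>B(u, \<zeta>\<^sup>2 u)\<close> tends to zero. It equals the layer energy of order \<open>N + 1\<close> up to the cross term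
\<open>2 \<integral> p \<zeta> \<zeta>' u u'\<close>; half of the energy absorbs that term and leaves a multiple of \<open>\<integral> p (\<zeta>')\<^sup>2 u\<^sup>2\<close>. Since
\<open>\<zeta>'\<close> is at most \<open>N + 1\<close> times the weight of order \<open>N\<close> and \<open>\<mu> p \<le> 2 q\<close>, this is \<open>1 / \<mu>\<close> times the
layer energy of order \<open>N\<close>.\<close>

lemma layer_energy_step:
  assumes u: "weak_mode p q \<kappa> a b u u'"
  obtains \<delta> where "\<delta> \<longlonglongrightarrow> 0" "\<And>k. layer_energy p q (Suc N) (u k) (u' k) \<le> 8 * (real (Suc N))\<^sup>2 / \<mu> * layer_energy p q N (u k) (u' k) + \<delta> k"
proof -
  define w where "w = (\<lambda>k x. (\<zeta> (Suc N) x)\<^sup>2 * u k x)"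
  define w' where "w' = (\<lambda>k x. (2 * \<zeta> (Suc N) x * (real (Suc N) * (1 - 2 * x) * \<zeta> N x)) * u k x + (\<zeta> (Suc N) x)\<^sup>2 * u' k x)"
  define \<delta> where "\<delta> k = bform p q (u k) (u' k) (w k) (w' k)" for k
  have su: "sobolev_cauchy u u'" and cu: "C1 (u k) (u' k)" for k
    using u unfolding weak_mode_def sobolev_cauchy_def by blast+
  have "\<delta> \<longlonglongrightarrow> \<kappa> * (a * 0 + b * 0)"
    unfolding \<delta>_def
  proof (rule weak_mode_sequence[OF u _ _ _ cont])
    show "sobolev_cauchy w w'" unfolding w_def w'_def by (rule sobolev_cauchy_mult[OF C1_zeta_sq su])
  qed (simp_all add: w_def \<zeta>_def)
  then have lim: "(\<lambda>k. 2 * \<delta> k) \<longlonglongrightarrow> 0" using tendsto_mult_left[of \<delta> 0 sequentially 2] by simp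
  have main: "layer_energy p q (Suc N) (u k) (u' k) \<le> 8 * (real (Suc N))\<^sup>2 / \<mu> * layer_energy p q N (u k) (u' k) + 2 * \<delta> k" for k
  proof -
    note c = C1_cont[OF cu[of k]]
    define n where "n = real (Suc N)"
    have "layer_energy p q (Suc N) (u k) (u' k) \<le> integral {0..1} (\<lambda>x. 
        8 * n\<^sup>2 / \<mu> * ((\<zeta> N x)\<^sup>2 * (p x * (u' k x)\<^sup>2 + q x * (u k x)\<^sup>2)) + 
        2 * (p x * (u' k x * w' k x) + q x * (u k x * w k x)))"
      unfolding layer_energy_def
    proof (rule integral_mono01)
      fix x :: real assume x: "x \<in> {0..1}"
      define s z d where "s = \<zeta> (Suc N) x" and "z = \<zeta> N x" and "d = n * (1 - 2 * x)"
      have d: "d\<^sup>2 \<le> n\<^sup>2"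
      proof -
        have "(1 - 2 * x)\<^sup>2 \<le> 1\<^sup>2" using x by (intro abs_le_square_iff[THEN iffD1]) auto
        then show ?thesis unfolding d_def power_mult_distrib by (simp add: mult_left_le)
      qed
      have pp: "p x > 0" "q x > 0" using p_pos q_pos x by auto
      have "0 \<le> (s * u' k x + 2 * (d * z * u k x))\<^sup>2" by simp
      then have a1: "- (4 * (s * u' k x) * (d * z * u k x)) \<le> (s * u' k x)\<^sup>2 + 4 * (d * z * u k x)\<^sup>2"
        by (simp add: power2_sum power_mult_distrib algebra_simps)
      then have a2: "p x * (- (4 * (s * u' k x) * (d * z * u k x))) \<le> p x * ((s * u' k x)\<^sup>2 + 4 * (d * z * u k x)\<^sup>2)"
        using pp by (intro mult_left_mono) auto
      have "\<mu> * p x * (d * z * u k x)\<^sup>2 \<le> 2 * q x * (n * z * u k x)\<^sup>2"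
        using q(1)[OF x] d pp unfolding power_mult_distrib 
        using \<mu>1 by (intro mult_mono[of "_ * _" "_ * _"] mult_right_mono mult_nonneg_nonneg) auto
      then have a3: "4 * p x * (d * z * u k x)\<^sup>2 \<le> 8 * n\<^sup>2 / \<mu> * (z\<^sup>2 * (q x * (u k x)\<^sup>2))"
        using \<mu>1 by (simp add: field_simps power_mult_distrib)
      have a4: "0 \<le> q x * (s * u k x)\<^sup>2" "0 \<le> 8 * n\<^sup>2 / \<mu> * (z\<^sup>2 * (p x * (u' k x)\<^sup>2))"
        using pp \<mu>1 by auto
      have e1: "2 * (p x * (u' k x * w' k x) + q x * (u k x * w k x)) =
         2 * p x * (s * u' k x)\<^sup>2 + p x * (4 * (s * u' k x) * (d * z * u k x)) + 2 * (q x * (s * u k x)\<^sup>2)"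
        unfolding w_def w'_def s_def[symmetric] z_def[symmetric] n_def[symmetric] d_def[symmetric]
        by (simp add: power2_eq_square algebra_simps)
      have e2: "s\<^sup>2 * (p x * (u' k x)\<^sup>2 + q x * (u k x)\<^sup>2) = p x * (s * u' k x)\<^sup>2 + q x * (s * u k x)\<^sup>2"
        by (simp add: power_mult_distrib algebra_simps)
      have e3: "8 * n\<^sup>2 / \<mu> * (z\<^sup>2 * (p x * (u' k x)\<^sup>2 + q x * (u k x)\<^sup>2)) = 
        8 * n\<^sup>2 / \<mu> * (z\<^sup>2 * (p x * (u' k x)\<^sup>2)) + 8 * n\<^sup>2 / \<mu> * (z\<^sup>2 * (q x * (u k x)\<^sup>2))"
        by (simp only: distrib_left)
      show "(\<zeta> (Suc N) x)\<^sup>2 * (p x * (u' k x)\<^sup>2 + q x * (u k x)\<^sup>2)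
        \<le> 8 * n\<^sup>2 / \<mu> * ((\<zeta> N x)\<^sup>2 * (p x * (u' k x)\<^sup>2 + q x * (u k x)\<^sup>2)) + 
        2 * (p x * (u' k x * w' k x) + q x * (u k x * w k x))"
        unfolding e1 s_def[symmetric] z_def[symmetric] e2 e3
        using a2 a3 a4 unfolding distrib_left mult_minus_right by (simp only: mult.assoc)
    qed (use \<mu>1 in \<open>auto intro!: continuous_intros c cont simp: w_def w'_def\<close>)
    also have "\<dots> = 8 * n\<^sup>2 / \<mu> * layer_energy p q N (u k) (u' k) + 2 * \<delta> k"
      unfolding \<delta>_def layer_energy_def bform_def w_def w'_def
      by (subst integral_add01) ((intro continuous_intros c cont)+, simp only: integral_mult_right)
    finally show ?thesis unfolding n_def .
  qed
  show ?thesis by (rule that[OF lim main])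
qed

lemma layer_energy_decay:
  assumes u: "weak_mode p q \<kappa> a b u u'"
  shows "\<exists>\<delta>. \<delta> \<longlonglongrightarrow> 0 \<and> (\<forall>k. layer_energy p q N (u k) (u' k) \<le> agmon_const N / \<mu> ^ N * bform p q (u k) (u' k) (u k) (u' k) + \<delta> k)"
proof (induction N)
  case 0
  show ?case by (rule exI[of _ "\<lambda>_. 0"]) (simp add: layer_energy_0 agmon_const_def)
next
  case (Suc N)
  then obtain \<delta> where \<delta>: "\<delta> \<longlonglongrightarrow> 0" "\<And>k. layer_energy p q N (u k) (u' k) \<le> agmon_const N / \<mu> ^ N * bform p q (u k) (u' k) (u k) (u' k) + \<delta> k"
    by blast
  obtain \<epsilon> where \<epsilon>: "\<epsilon> \<longlonglongrightarrow> 0" "\<And>k. layer_energy p q (Suc N) (u k) (u' k) \<le> 8 * (real (Suc N))\<^sup>2 / \<mu> * layer_energy p q N (u k) (u' k) + \<epsilon> k"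
    by (rule layer_energy_step[OF u, of N]) blast
  define K where "K = 8 * (real (Suc N))\<^sup>2 / \<mu>"
  have K: "K \<ge> 0" unfolding K_def using \<mu>1 by auto
  have KA: "K * (agmon_const N / \<mu> ^ N) = agmon_const (Suc N) / \<mu> ^ Suc N"
    unfolding K_def agmon_const_def by (simp add: prod.atLeast_Suc_atMost_Suc_shift mult.commute)
  show ?case
  proof (intro exI conjI allI)
    show "(\<lambda>k. K * \<delta> k + \<epsilon> k) \<longlonglongrightarrow> 0"
      using tendsto_add[OF tendsto_mult_left[OF \<delta>(1), of K] \<epsilon>(1)] by simp
    show "layer_energy p q (Suc N) (u k) (u' k) \<le> agmon_const (Suc N) / \<mu> ^ Suc N * bform p q (u k) (u' k) (u k) (u' k) + (K * \<delta> k + \<epsilon> k)" for k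
      using \<epsilon>(2)[of k] mult_left_mono[OF \<delta>(2)[of k] K] unfolding K_def[symmetric] KA[symmetric] 
      by (simp add: algebra_simps)
  qed
qed

lemma bform_le_mean_energy:
  assumes u: "C1 u u'" and v: "C1 v v'"
  shows "2 * bform p q u u' v v' \<le> bform p q u u' u u' + bform p q v v' v v'"
proof -
  note c = C1_cont[OF u] C1_cont[OF v]
  have "2 * bform p q u u' v v' = integral {0..1} (\<lambda>x. 2 * (p x * (u' x * v' x) + q x * (u x * v x)))"
    unfolding bform_def by (rule integral_mult_right[symmetric])
  also have "\<dots> \<le> integral {0..1} (\<lambda>x. (p x * (u' x * u' x) + q x * (u x * u x)) + (p x * (v' x * v' x) + q x * (v x * v x)))"
  proof (rule integral_mono01)
    fix x :: real assume x: "x \<in> {0..1}"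
    have "0 \<le> p x * (u' x - v' x)\<^sup>2" "0 \<le> q x * (u x - v x)\<^sup>2" using p_pos[OF x] q_pos[OF x] by auto
    then show "2 * (p x * (u' x * v' x) + q x * (u x * v x)) \<le> (p x * (u' x * u' x) + q x * (u x * u x)) + (p x * (v' x * v' x) + q x * (v x * v x))"
      by (simp add: power2_eq_square algebra_simps)
  qed (auto intro!: continuous_intros c cont)
  also have "\<dots> = bform p q u u' u u' + bform p q v v' v v'"
    unfolding bform_def by (rule integral_add01) (auto intro!: continuous_intros c cont)
  finally show ?thesis .
qed

lemma weak_mode_energy:
  assumes u: "weak_mode p q \<kappa> a b u u'"
  shows "(\<lambda>k. bform p q (u k) (u' k) (u k) (u' k)) \<longlonglongrightarrow> \<kappa> * (a * a + b * b)"
  using u by (intro weak_mode_sequence[OF u _ _ _ cont]) (auto simp: weak_mode_def)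

text \<open>The mode minimises the energy for its boundary values, and its energy is \<open>\<kappa>\<close>. The linear function with
the same boundary values has values in \<open>[-1,1]\<close> and a slope of square at most \<open>2\<close>.\<close>

lemma weak_mode_eigenvalue_le:
  assumes u: "weak_mode p q \<kappa> a b u u'" and ab: "a\<^sup>2 + b\<^sup>2 = 1"
  shows "\<kappa> \<le> 6 * p1 * \<mu>"
proof -
  have cu: "C1 (u k) (u' k)" for k using u unfolding weak_mode_def sobolev_cauchy_def by blast
  have ab1: "a * a + b * b = 1" using ab by (simp add: power2_eq_square)
  define w where "w x = a + (b - a) * x" for x
  have w: "C1 w (\<lambda>x. b - a)" unfolding w_def by (rule C1_linear)
  have "(\<lambda>k. bform p q (u k) (u' k) w (\<lambda>x. b - a)) \<longlonglongrightarrow> \<kappa> * (a * w 0 + b * w 1)"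
    using u w unfolding weak_mode_def by blast
  then have "(\<lambda>k. 2 * bform p q (u k) (u' k) w (\<lambda>x. b - a)) \<longlonglongrightarrow> 2 * \<kappa>"
    using ab1 by (intro tendsto_mult_left) (simp add: w_def)
  moreover have "(\<lambda>k. bform p q (u k) (u' k) (u k) (u' k) + bform p q w (\<lambda>x. b - a) w (\<lambda>x. b - a)) \<longlonglongrightarrow> \<kappa> + bform p q w (\<lambda>x. b - a) w (\<lambda>x. b - a)"
    using weak_mode_energy[OF u] ab1 by (intro tendsto_intros) auto
  ultimately have "2 * \<kappa> \<le> \<kappa> + bform p q w (\<lambda>x. b - a) w (\<lambda>x. b - a)"
    by (rule LIMSEQ_le) (use bform_le_mean_energy[OF cu w] in blast)
  moreover have "bform p q w (\<lambda>x. b - a) w (\<lambda>x. b - a) \<le> integral {0..1} (\<lambda>x::real. 6 * p1 * \<mu>)"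
    unfolding bform_def
  proof (rule integral_mono01)
    fix x :: real assume x: "x \<in> {0..1}"
    have p1: "0 \<le> p1" using p(2)[OF x] p_pos[OF x] by linarith
    have "(b - a)\<^sup>2 + (b + a)\<^sup>2 = 2" using ab by (simp add: power2_eq_square algebra_simps)
    then have ba: "(b - a) * (b - a) \<le> 2" using zero_le_power2[of "b + a"] unfolding power2_eq_square by linarith
    have le1: "a\<^sup>2 \<le> 1" "b\<^sup>2 \<le> 1" using ab zero_le_power2[of a] zero_le_power2[of b] by linarith+
    then have "\<bar>a\<bar> \<le> 1" "\<bar>b\<bar> \<le> 1" by (simp_all add: abs_square_le_1)
    moreover have "w x = a * (1 - x) + b * x" unfolding w_def by (simp add: algebra_simps)
    moreover have "\<bar>a * (1 - x)\<bar> \<le> 1 * (1 - x)" "\<bar>b * x\<bar> \<le> 1 * x"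
      using mult_right_mono[OF calculation(1), of "1 - x"] mult_right_mono[OF calculation(2), of x] x by (simp_all add: abs_mult)
    ultimately have "\<bar>w x\<bar> \<le> 1"
      using abs_triangle_ineq[of "a * (1 - x)" "b * x"] by simp
    then have "(w x)\<^sup>2 \<le> 1" by (simp add: abs_square_le_1)
    then have w1: "w x * w x \<le> 1" by (simp add: power2_eq_square)
    have q1: "q x \<le> 2 * \<mu> * p1" using q(2)[OF x] mult_left_mono[OF p(2)[OF x], of "2*\<mu>"] \<mu>1 by linarith
    have "p x * ((b - a) * (b - a)) \<le> p1 * 2"
      using p(2)[OF x] p_pos[OF x] ba p1 by (intro mult_mono) auto
    moreover have "p1 * 2 \<le> p1 * (2 * \<mu>)" using p1 \<mu>1 by (intro mult_left_mono) auto
    moreover have "q x * (w x * w x) \<le> (2 * \<mu> * p1) * 1"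
      using q1 q_pos[OF x] w1 p1 \<mu>1 by (intro mult_mono) auto
    moreover have "0 \<le> p1 * \<mu>" using p1 \<mu>1 by simp
    ultimately show "p x * ((b - a) * (b - a)) + q x * (w x * w x) \<le> 6 * p1 * \<mu>"
      by (simp add: mult_ac)
  qed (auto intro!: continuous_intros cont simp: w_def)
  ultimately show ?thesis by simp
qed

section \<open>The distance between two eigenvalues of the radial form\<close>

text \<open>Both tests below produce a sequence that is bounded by layer energies; its limit inherits the decay of
these energies.\<close>

lemma limit_le_layer_energies:
  assumes u: "weak_mode p q \<kappa>1 a1 b1 u u'" and v: "weak_mode p q \<kappa>2 a2 b2 v v'"
    and norm: "a1\<^sup>2 + b1\<^sup>2 = 1" "a2\<^sup>2 + b2\<^sup>2 = 1"
    and X: "X \<longlonglongrightarrow> L" and C: "C \<ge> 0"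
    and le: "\<And>k. \<bar>X k\<bar> \<le> C * (layer_energy p q N (u k) (u' k) + layer_energy p q N (v k) (v' k))"
  shows "\<bar>L\<bar> \<le> C * (agmon_const N / \<mu> ^ N * (12 * p1 * \<mu>))"
proof -
  define A where "A = agmon_const N / \<mu> ^ N"
  have A: "A \<ge> 0" unfolding A_def using agmon_const_nonneg \<mu>1 by auto
  obtain \<delta> where \<delta>: "\<delta> \<longlonglongrightarrow> 0" "\<And>k. layer_energy p q N (u k) (u' k) \<le> A * bform p q (u k) (u' k) (u k) (u' k) + \<delta> k"
    using layer_energy_decay[OF u, of N] unfolding A_def by blast
  obtain \<epsilon> where \<epsilon>: "\<epsilon> \<longlonglongrightarrow> 0" "\<And>k. layer_energy p q N (v k) (v' k) \<le> A * bform p q (v k) (v' k) (v k) (v' k) + \<epsilon> k"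
    using layer_energy_decay[OF v, of N] unfolding A_def by blast
  have E: "(\<lambda>k. bform p q (u k) (u' k) (u k) (u' k)) \<longlonglongrightarrow> \<kappa>1" "(\<lambda>k. bform p q (v k) (v' k) (v k) (v' k)) \<longlonglongrightarrow> \<kappa>2"
    using weak_mode_energy[OF u] weak_mode_energy[OF v] norm by (simp_all add: power2_eq_square)
  have "(\<lambda>k. C * ((A * bform p q (u k) (u' k) (u k) (u' k) + \<delta> k) + (A * bform p q (v k) (v' k) (v k) (v' k) + \<epsilon> k)))
     \<longlonglongrightarrow> C * ((A * \<kappa>1 + 0) + (A * \<kappa>2 + 0))"
    by (intro tendsto_intros E \<delta> \<epsilon>)
  moreover have "(\<lambda>k. \<bar>X k\<bar>) \<longlonglongrightarrow> \<bar>L\<bar>" by (intro tendsto_intros X)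
  moreover have "\<bar>X k\<bar> \<le> C * ((A * bform p q (u k) (u' k) (u k) (u' k) + \<delta> k) + (A * bform p q (v k) (v' k) (v k) (v' k) + \<epsilon> k))" for k
    by (rule order_trans[OF le]) (intro mult_left_mono add_mono \<delta> \<epsilon> C)
  ultimately have "\<bar>L\<bar> \<le> C * ((A * \<kappa>1 + 0) + (A * \<kappa>2 + 0))"
    by (intro LIMSEQ_le[where X = "\<lambda>k. \<bar>X k\<bar>"]) auto
  also have "\<dots> = C * (A * (\<kappa>1 + \<kappa>2))" by (simp add: distrib_left)
  also have "\<dots> \<le> C * (A * (12 * p1 * \<mu>))"
    using weak_mode_eigenvalue_le[OF u norm(1)] weak_mode_eigenvalue_le[OF v norm(2)] A C
    by (intro mult_left_mono) auto
  finally show ?thesis unfolding A_def .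
qed

lemma weak_mode_orthogonality:
  assumes u: "weak_mode p q \<kappa>1 a1 b1 u u'" and v: "weak_mode p q \<kappa>2 a2 b2 v v'"
  shows "(\<kappa>1 - \<kappa>2) * (a1 * a2 + b1 * b2) = 0"
proof -
  have "(\<lambda>k. bform p q (u k) (u' k) (v k) (v' k)) \<longlonglongrightarrow> \<kappa>1 * (a1 * a2 + b1 * b2)"
    using v by (intro weak_mode_sequence[OF u _ _ _ cont]) (auto simp: weak_mode_def)
  moreover have "(\<lambda>k. bform p q (v k) (v' k) (u k) (u' k)) \<longlonglongrightarrow> \<kappa>2 * (a2 * a1 + b2 * b1)"
    using u by (intro weak_mode_sequence[OF v _ _ _ cont]) (auto simp: weak_mode_def)
  ultimately show ?thesis
    using LIMSEQ_unique unfolding bform_sym[of p q "v _"] by (fastforce simp: algebra_simps)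
qed

lemma sobolev_cauchy_reflect:
  assumes "sobolev_cauchy u u'"
  shows "sobolev_cauchy (\<lambda>k x. u k (1 - x)) (\<lambda>k x. - u' k (1 - x))"
  unfolding sobolev_cauchy_def
proof (intro conjI allI)
  have c: "C1 (u k) (u' k)" for k using assms unfolding sobolev_cauchy_def by blast
  then show "C1 (\<lambda>x. u k (1 - x)) (\<lambda>x. - u' k (1 - x))" for k by (rule C1_reflect)
  have eq: "sobolev_sq (\<lambda>x. u k (1 - x) - u l (1 - x)) (\<lambda>x. - u' k (1 - x) - - u' l (1 - x))
     = sobolev_sq (\<lambda>x. u k x - u l x) (\<lambda>x. u' k x - u' l x)" for k l
  proof -
    have "continuous_on {0..1} (\<lambda>x. (u' k x - u' l x)\<^sup>2 + (u k x - u l x)\<^sup>2)"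
      by (intro continuous_intros C1_cont[OF c])
    from integral_reflect01[OF this] show ?thesis unfolding sobolev_sq_def
      by (simp add: power2_commute)
  qed
  show "0 < e \<longrightarrow> (\<exists>N. \<forall>k\<ge>N. \<forall>l\<ge>N. sobolev_sq (\<lambda>x. u k (1 - x) - u l (1 - x)) (\<lambda>x. - u' k (1 - x) - - u' l (1 - x)) < e)" for e
    unfolding eq using assms unfolding sobolev_cauchy_def by blast
qed

lemma layer_energy_dominates:
  assumes u: "C1 u u'"
  shows "integral {0..1} (\<lambda>x. (\<zeta> N x)\<^sup>2 * ((u' x)\<^sup>2 + \<mu> * (u x)\<^sup>2)) \<le> 2 / p0 * layer_energy p q N u u'"
proof -
  note c = C1_cont[OF u]
  have "integral {0..1} (\<lambda>x. (\<zeta> N x)\<^sup>2 * ((u' x)\<^sup>2 + \<mu> * (u x)\<^sup>2)) \<le> 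
    integral {0..1} (\<lambda>x. 2 / p0 * ((\<zeta> N x)\<^sup>2 * (p x * (u' x)\<^sup>2 + q x * (u x)\<^sup>2)))"
  proof (rule integral_mono01)
    fix x :: real assume x: "x \<in> {0..1}"
    have "p0 * (u' x)\<^sup>2 \<le> 2 * (p x * (u' x)\<^sup>2)"
      using mult_right_mono[OF p(1)[OF x], of "(u' x)\<^sup>2"] p_pos[OF x] by (smt (verit) mult_nonneg_nonneg zero_le_power2)
    moreover have "p0 * \<mu> \<le> 2 * q x"
      using order_trans[OF mult_left_mono[OF p(1)[OF x], of \<mu>] q(1)[OF x]] \<mu>1 by (simp add: mult.commute)
    then have "p0 * \<mu> * (u x)\<^sup>2 \<le> 2 * q x * (u x)\<^sup>2" by (rule mult_right_mono) simp
    ultimately have "(u' x)\<^sup>2 + \<mu> * (u x)\<^sup>2 \<le> 2 / p0 * (p x * (u' x)\<^sup>2 + q x * (u x)\<^sup>2)"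
      using p0 by (simp add: field_simps)
    then have "(\<zeta> N x)\<^sup>2 * ((u' x)\<^sup>2 + \<mu> * (u x)\<^sup>2) \<le> (\<zeta> N x)\<^sup>2 * (2 / p0 * (p x * (u' x)\<^sup>2 + q x * (u x)\<^sup>2))"
      by (intro mult_left_mono) auto
    then show "(\<zeta> N x)\<^sup>2 * ((u' x)\<^sup>2 + \<mu> * (u x)\<^sup>2) \<le> 2 / p0 * ((\<zeta> N x)\<^sup>2 * (p x * (u' x)\<^sup>2 + q x * (u x)\<^sup>2))"
      by (simp only: mult.left_commute)
  qed (use p0 in \<open>auto intro!: continuous_intros c cont\<close>)
  then show ?thesis unfolding layer_energy_def integral_mult_right .
qed

text \<open>Reflecting the integration variable turns \<open>B(v, R u)\<close> into the form with reflected coefficients at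
\<open>(u, R v)\<close>. Hence its difference from \<open>B(u, R v)\<close> contains only \<open>p - R p\<close> and \<open>q - R q\<close>.\<close>

lemma weak_mode_reflection:
  assumes u: "weak_mode p q \<kappa>1 a1 b1 u u'" and v: "weak_mode p q \<kappa>2 a2 b2 v v'"
    and norm: "a1\<^sup>2 + b1\<^sup>2 = 1" "a2\<^sup>2 + b2\<^sup>2 = 1" and D: "D \<ge> 0"
    and sym: "\<And>x. x \<in> {0..1} \<Longrightarrow> \<bar>p x - p (1 - x)\<bar> \<le> D * (\<zeta> N x)\<^sup>2"
      "\<And>x. x \<in> {0..1} \<Longrightarrow> \<bar>q x - q (1 - x)\<bar> \<le> D * \<mu> * (\<zeta> N x)\<^sup>2"
  shows "\<bar>(\<kappa>1 - \<kappa>2) * (a1 * b2 + b1 * a2)\<bar> \<le> D / p0 * (agmon_const N / \<mu> ^ N * (12 * p1 * \<mu>))"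
proof (rule limit_le_layer_energies[OF u v norm])
  have su: "sobolev_cauchy u u'" and cu: "C1 (u k) (u' k)" and sv: "sobolev_cauchy v v'" and cv: "C1 (v k) (v' k)" for k
    using u v unfolding weak_mode_def sobolev_cauchy_def by blast+
  define X where "X k = bform p q (u k) (u' k) (\<lambda>x. v k (1 - x)) (\<lambda>x. - v' k (1 - x)) 
     - bform p q (v k) (v' k) (\<lambda>x. u k (1 - x)) (\<lambda>x. - u' k (1 - x))" for k
  have "X \<longlonglongrightarrow> \<kappa>1 * (a1 * b2 + b1 * a2) - \<kappa>2 * (a2 * b1 + b2 * a1)"
    unfolding X_def using u v
    by (intro tendsto_diff weak_mode_sequence[OF u _ _ _ cont] weak_mode_sequence[OF v _ _ _ cont] sobolev_cauchy_reflect)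
       (auto simp: weak_mode_def)
  then show "X \<longlonglongrightarrow> (\<kappa>1 - \<kappa>2) * (a1 * b2 + b1 * a2)" by (simp add: algebra_simps)
  show "0 \<le> D / p0" using D p0 by simp
  fix k
  note c = C1_cont[OF cu[of k]] C1_cont[OF cv[of k]] C1_cont[OF C1_reflect[OF cu[of k]]] C1_cont[OF C1_reflect[OF cv[of k]]]
  have rc: "continuous_on {0..1} (\<lambda>x. g (1 - x))" if "continuous_on {0..1} g" for g :: "real \<Rightarrow> real"
    by (rule continuous_on_compose2[OF that]) (auto intro!: continuous_intros)
  note c2 = rc[OF cont(1)] rc[OF cont(2)]  rc[OF C1_cont(2)[OF cv[of k]]] rc[OF C1_cont(1)[OF cv[of k]]] 
  have "bform p q (v k) (v' k) (\<lambda>x. u k (1 - x)) (\<lambda>x. - u' k (1 - x)) =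
    integral {0..1} (\<lambda>x. (\<lambda>y. p (1 - y) * (v' k (1 - y) * - u' k y) + q (1 - y) * (v k (1 - y) * u k y)) (1 - x))"
    unfolding bform_def by simp
  also have "\<dots> = integral {0..1} (\<lambda>y. p (1 - y) * (v' k (1 - y) * - u' k y) + q (1 - y) * (v k (1 - y) * u k y))"
    by (rule integral_reflect01) (intro continuous_intros c c2)
  finally have r: "bform p q (v k) (v' k) (\<lambda>x. u k (1 - x)) (\<lambda>x. - u' k (1 - x)) = \<dots>" .
  have "\<bar>X k\<bar> = \<bar>integral {0..1} (\<lambda>x. (p x * (u' k x * - v' k (1 - x)) + q x * (u k x * v k (1 - x))) 
     - (p (1 - x) * (v' k (1 - x) * - u' k x) + q (1 - x) * (v k (1 - x) * u k x)))\<bar>"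
    unfolding X_def r unfolding bform_def by (rule arg_cong[where f = abs], rule integral_diff01[symmetric]) (intro continuous_intros c c2 cont)+
  also have "\<dots> \<le> integral {0..1} (\<lambda>x. D / 2 * ((\<zeta> N x)\<^sup>2 * ((u' k x)\<^sup>2 + \<mu> * (u k x)\<^sup>2)) 
     + D / 2 * ((\<zeta> N (1 - x))\<^sup>2 * ((v' k (1 - x))\<^sup>2 + \<mu> * (v k (1 - x))\<^sup>2)))"
  proof (rule integral_abs01)
    fix x :: real assume x: "x \<in> {0..1}"
    have am: "\<bar>a * b\<bar> \<le> (a\<^sup>2 + b\<^sup>2) / 2" for a b :: real
      using sum_squares_bound[of "\<bar>a\<bar>" "\<bar>b\<bar>"] by (simp add: abs_mult)
    define P Q where "P = p x - p (1 - x)" and "Q = q x - q (1 - x)"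
    define z where "z = (\<zeta> N x)\<^sup>2"
    have z: "z \<ge> 0" unfolding z_def by simp
    have PQ: "\<bar>P\<bar> \<le> D * z" "\<bar>Q\<bar> \<le> D * \<mu> * z"
      using sym[OF x] unfolding P_def Q_def z_def by auto
    have "\<bar>P * (u' k x * v' k (1 - x))\<bar> \<le> (D * z) * (((u' k x)\<^sup>2 + (v' k (1 - x))\<^sup>2) / 2)"
      unfolding abs_mult[of P] using PQ am z D by (intro mult_mono) auto
    moreover have "\<bar>Q * (u k x * v k (1 - x))\<bar> \<le> (D * \<mu> * z) * (((u k x)\<^sup>2 + (v k (1 - x))\<^sup>2) / 2)"
      unfolding abs_mult[of Q] using PQ am z D \<mu>1 by (intro mult_mono) auto
    moreover have "(p x * (u' k x * - v' k (1 - x)) + q x * (u k x * v k (1 - x))) 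
     - (p (1 - x) * (v' k (1 - x) * - u' k x) + q (1 - x) * (v k (1 - x) * u k x)) = - (P * (u' k x * v' k (1 - x))) + Q * (u k x * v k (1 - x))"
      unfolding P_def Q_def by (simp add: algebra_simps)
    ultimately have "\<bar>(p x * (u' k x * - v' k (1 - x)) + q x * (u k x * v k (1 - x))) 
     - (p (1 - x) * (v' k (1 - x) * - u' k x) + q (1 - x) * (v k (1 - x) * u k x))\<bar>
      \<le> (D * z) * (((u' k x)\<^sup>2 + (v' k (1 - x))\<^sup>2) / 2) + (D * \<mu> * z) * (((u k x)\<^sup>2 + (v k (1 - x))\<^sup>2) / 2)"
      by linarith
    also have "\<dots> = D / 2 * (z * ((u' k x)\<^sup>2 + \<mu> * (u k x)\<^sup>2)) 
     + D / 2 * (z * ((v' k (1 - x))\<^sup>2 + \<mu> * (v k (1 - x))\<^sup>2))"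
      by (simp add: field_simps)
    finally show "\<bar>(p x * (u' k x * - v' k (1 - x)) + q x * (u k x * v k (1 - x))) 
     - (p (1 - x) * (v' k (1 - x) * - u' k x) + q (1 - x) * (v k (1 - x) * u k x))\<bar>
      \<le> D / 2 * ((\<zeta> N x)\<^sup>2 * ((u' k x)\<^sup>2 + \<mu> * (u k x)\<^sup>2)) 
     + D / 2 * ((\<zeta> N (1 - x))\<^sup>2 * ((v' k (1 - x))\<^sup>2 + \<mu> * (v k (1 - x))\<^sup>2))"
      unfolding zeta_reflect z_def .
  next
    show "continuous_on {0..1} (\<lambda>x. D / 2 * ((\<zeta> N x)\<^sup>2 * ((u' k x)\<^sup>2 + \<mu> * (u k x)\<^sup>2)) 
     + D / 2 * ((\<zeta> N (1 - x))\<^sup>2 * ((v' k (1 - x))\<^sup>2 + \<mu> * (v k (1 - x))\<^sup>2)))"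
      unfolding zeta_reflect by (intro continuous_intros c c2)
  qed (intro continuous_intros c c2 cont)
  also have "\<dots> = D / 2 * integral {0..1} (\<lambda>x. (\<zeta> N x)\<^sup>2 * ((u' k x)\<^sup>2 + \<mu> * (u k x)\<^sup>2)) 
     + D / 2 * integral {0..1} (\<lambda>x. (\<zeta> N x)\<^sup>2 * ((v' k x)\<^sup>2 + \<mu> * (v k x)\<^sup>2))"
  proof -
    have "continuous_on {0..1} (\<lambda>x. (\<zeta> N x)\<^sup>2 * ((v' k x)\<^sup>2 + \<mu> * (v k x)\<^sup>2))" by (intro continuous_intros c)
    note r = integral_reflect01[OF this]
    show ?thesis unfolding r[symmetric] 
      by (subst integral_add01) (unfold zeta_reflect integral_mult_right, intro continuous_intros c c2, intro continuous_intros c c2, rule refl)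
  qed
  also have "\<dots> \<le> D / 2 * (2 / p0 * layer_energy p q N (u k) (u' k)) + D / 2 * (2 / p0 * layer_energy p q N (v k) (v' k))"
    using D by (intro add_mono mult_left_mono layer_energy_dominates cu cv) auto
  also have "\<dots> = D / p0 * (layer_energy p q N (u k) (u' k) + layer_energy p q N (v k) (v' k))"
    using p0 by (simp add: field_simps)
  finally show "\<bar>X k\<bar> \<le> D / p0 * (layer_energy p q N (u k) (u' k) + layer_energy p q N (v k) (v' k))" .
qed

text \<open>The cut-off \<open>\<phi>\<close> with \<open>\<phi> 0 = 0\<close> and \<open>\<phi>' = (\<zeta> N)\<^sup>2\<close> sees only the end \<open>1\<close>. In
\<open>B(u, \<phi> v) - B(v, \<phi> u)\<close> all terms without \<open>\<phi>'\<close> cancel, and \<open>\<integral> p \<phi>' (u' v - v' u)\<close> remains.\<close>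

lemma weak_mode_cutoff:
  assumes u: "weak_mode p q \<kappa>1 a1 b1 u u'" and v: "weak_mode p q \<kappa>2 a2 b2 v v'"
    and norm: "a1\<^sup>2 + b1\<^sup>2 = 1" "a2\<^sup>2 + b2\<^sup>2 = 1"
  shows "integral {0..1} (\<lambda>x. (\<zeta> N x)\<^sup>2) * \<bar>(\<kappa>1 - \<kappa>2) * (b1 * b2)\<bar> \<le> 1 * (agmon_const N / \<mu> ^ N * (12 * p1 * \<mu>))"
proof -
  \<comment> \<open>a polynomial that behaves as a smooth step\<close>
  define \<phi> where "\<phi> x = integral {0..x} (\<lambda>x. (\<zeta> N x)\<^sup>2)" for x
  have zc: "continuous_on {0..1} (\<lambda>x. (\<zeta> N x)\<^sup>2)" by (intro continuous_intros)
  have \<phi>: "C1 \<phi> (\<lambda>x. (\<zeta> N x)\<^sup>2)"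
    unfolding C1_def \<phi>_def has_real_derivative_iff_has_vector_derivative 
    using zc by (auto intro: integral_has_vector_derivative)
  have \<phi>01: "\<phi> 0 = 0" "\<phi> 1 = integral {0..1} (\<lambda>x. (\<zeta> N x)\<^sup>2)" unfolding \<phi>_def by auto
  have \<phi>1: "\<phi> 1 \<ge> 0" unfolding \<phi>01 by (intro integral_nonneg integrable_cont01 zc) auto
  have su: "sobolev_cauchy u u'" and cu: "C1 (u k) (u' k)" and sv: "sobolev_cauchy v v'" and cv: "C1 (v k) (v' k)" for k
    using u v unfolding weak_mode_def sobolev_cauchy_def by blast+
  define X where "X k = bform p q (u k) (u' k) (\<lambda>x. \<phi> x * v k x) (\<lambda>x. (\<zeta> N x)\<^sup>2 * v k x + \<phi> x * v' k x)
     - bform p q (v k) (v' k) (\<lambda>x. \<phi> x * u k x) (\<lambda>x. (\<zeta> N x)\<^sup>2 * u k x + \<phi> x * u' k x)" for k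
  have vt: "(\<lambda>k. \<phi> 0 * v k 0) \<longlonglongrightarrow> 0" "(\<lambda>k. \<phi> 1 * v k 1) \<longlonglongrightarrow> \<phi> 1 * b2" 
    "(\<lambda>k. \<phi> 0 * u k 0) \<longlonglongrightarrow> 0" "(\<lambda>k. \<phi> 1 * u k 1) \<longlonglongrightarrow> \<phi> 1 * b1" 
    using u v by (auto simp: \<phi>01(1) weak_mode_def intro!: tendsto_mult_left)
  have "X \<longlonglongrightarrow> \<kappa>1 * (a1 * 0 + b1 * (\<phi> 1 * b2)) - \<kappa>2 * (a2 * 0 + b2 * (\<phi> 1 * b1))"
    unfolding X_def 
    by (intro tendsto_diff weak_mode_sequence[OF u sobolev_cauchy_mult[OF \<phi> sv] vt(1,2) cont] 
       weak_mode_sequence[OF v sobolev_cauchy_mult[OF \<phi> su] vt(3,4) cont])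
  then have X: "X \<longlonglongrightarrow> \<phi> 1 * ((\<kappa>1 - \<kappa>2) * (b1 * b2))" by (simp add: algebra_simps)
  have "\<bar>\<phi> 1 * ((\<kappa>1 - \<kappa>2) * (b1 * b2))\<bar> \<le> 1 * (agmon_const N / \<mu> ^ N * (12 * p1 * \<mu>))"
  proof (rule limit_le_layer_energies[OF u v norm X])
    fix k
    note c = C1_cont[OF cu[of k]] C1_cont[OF cv[of k]] C1_cont(1)[OF \<phi>] cont
    have "\<bar>X k\<bar> = \<bar>integral {0..1} (\<lambda>x. (p x * (u' k x * ((\<zeta> N x)\<^sup>2 * v k x + \<phi> x * v' k x)) + q x * (u k x * (\<phi> x * v k x)))
       - (p x * (v' k x * ((\<zeta> N x)\<^sup>2 * u k x + \<phi> x * u' k x)) + q x * (v k x * (\<phi> x * u k x))))\<bar>"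
      unfolding X_def bform_def by (rule arg_cong[where f = abs], rule integral_diff01[symmetric]) (intro continuous_intros c)+
    also have "\<dots> \<le> integral {0..1} (\<lambda>x. (\<zeta> N x)\<^sup>2 * (p x * (u' k x)\<^sup>2 + q x * (u k x)\<^sup>2) + (\<zeta> N x)\<^sup>2 * (p x * (v' k x)\<^sup>2 + q x * (v k x)\<^sup>2))"
    proof (rule integral_abs01)
      fix x :: real assume x: "x \<in> {0..1}"
      define z where "z = (\<zeta> N x)\<^sup>2"
      have am: "\<bar>a * b\<bar> \<le> (a\<^sup>2 + b\<^sup>2) / 2" for a b :: real
        using sum_squares_bound[of "\<bar>a\<bar>" "\<bar>b\<bar>"] by (simp add: abs_mult)
      have pq: "p x * w\<^sup>2 / 2 \<le> q x * w\<^sup>2" for w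
        using mult_right_mono[OF p_le_q[OF x], of "w\<^sup>2"] by simp
      have "\<bar>u' k x * v k x - v' k x * u k x\<bar> \<le> ((u' k x)\<^sup>2 + (v k x)\<^sup>2) / 2 + ((v' k x)\<^sup>2 + (u k x)\<^sup>2) / 2"
        using am[of "u' k x" "v k x"] am[of "v' k x" "u k x"] by linarith
      then have "\<bar>p x * (u' k x * v k x - v' k x * u k x)\<bar> \<le> p x * (((u' k x)\<^sup>2 + (v k x)\<^sup>2) / 2 + ((v' k x)\<^sup>2 + (u k x)\<^sup>2) / 2)"
        using p_pos[OF x] by (simp add: abs_mult)
      also have "\<dots> = p x * (u' k x)\<^sup>2 / 2 + p x * (v' k x)\<^sup>2 / 2 + p x * (u k x)\<^sup>2 / 2 + p x * (v k x)\<^sup>2 / 2"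
        by (simp add: algebra_simps add_divide_distrib)
      also have "\<dots> \<le> (p x * (u' k x)\<^sup>2 + q x * (u k x)\<^sup>2) + (p x * (v' k x)\<^sup>2 + q x * (v k x)\<^sup>2)"
        using pq[of "u k x"] pq[of "v k x"] mult_nonneg_nonneg[of "p x" "(u' k x)\<^sup>2"] mult_nonneg_nonneg[of "p x" "(v' k x)\<^sup>2"] p_pos[OF x] zero_le_power2
        by (smt (verit, best) field_sum_of_halves)
      finally have "z * \<bar>p x * (u' k x * v k x - v' k x * u k x)\<bar> \<le> z * ((p x * (u' k x)\<^sup>2 + q x * (u k x)\<^sup>2) + (p x * (v' k x)\<^sup>2 + q x * (v k x)\<^sup>2))"
        by (intro mult_left_mono) (auto simp: z_def)
      moreover have "z * \<bar>p x * (u' k x * v k x - v' k x * u k x)\<bar> = \<bar>z * (p x * (u' k x * v k x - v' k x * u k x))\<bar>"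
        by (simp add: abs_mult z_def)
      moreover have "(p x * (u' k x * (z * v k x + \<phi> x * v' k x)) + q x * (u k x * (\<phi> x * v k x)))
       - (p x * (v' k x * (z * u k x + \<phi> x * u' k x)) + q x * (v k x * (\<phi> x * u k x))) = z * (p x * (u' k x * v k x - v' k x * u k x))"
        by (simp add: algebra_simps)
      ultimately show "\<bar>(p x * (u' k x * ((\<zeta> N x)\<^sup>2 * v k x + \<phi> x * v' k x)) + q x * (u k x * (\<phi> x * v k x)))
       - (p x * (v' k x * ((\<zeta> N x)\<^sup>2 * u k x + \<phi> x * u' k x)) + q x * (v k x * (\<phi> x * u k x)))\<bar>
        \<le> (\<zeta> N x)\<^sup>2 * (p x * (u' k x)\<^sup>2 + q x * (u k x)\<^sup>2) + (\<zeta> N x)\<^sup>2 * (p x * (v' k x)\<^sup>2 + q x * (v k x)\<^sup>2)"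
        unfolding z_def[symmetric] by (simp only: distrib_left)
    qed (intro continuous_intros c)+
    also have "\<dots> = 1 * (layer_energy p q N (u k) (u' k) + layer_energy p q N (v k) (v' k))"
      unfolding layer_energy_def mult_1 by (rule integral_add01) (intro continuous_intros c)+
    finally show "\<bar>X k\<bar> \<le> 1 * (layer_energy p q N (u k) (u' k) + layer_energy p q N (v k) (v' k))" .
  qed simp
  then show ?thesis using \<phi>1 by (simp add: abs_mult \<phi>01)
qed

theorem weak_mode_gap:
  assumes u: "weak_mode p q \<kappa>1 a1 b1 u u'" and v: "weak_mode p q \<kappa>2 a2 b2 v v'"
    and norm: "a1\<^sup>2 + b1\<^sup>2 = 1" "a2\<^sup>2 + b2\<^sup>2 = 1" and D: "D \<ge> 0"
    and sym: "\<And>x. x \<in> {0..1} \<Longrightarrow> \<bar>p x - p (1 - x)\<bar> \<le> D * (\<zeta> N x)\<^sup>2"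
      "\<And>x. x \<in> {0..1} \<Longrightarrow> \<bar>q x - q (1 - x)\<bar> \<le> D * \<mu> * (\<zeta> N x)\<^sup>2"
  shows "\<bar>\<kappa>1 - \<kappa>2\<bar> \<le> (D / p0 + 2 / integral {0..1} (\<lambda>x. (\<zeta> N x)\<^sup>2)) * (agmon_const N / \<mu> ^ N * (12 * p1 * \<mu>))"
proof (cases "\<kappa>1 = \<kappa>2")
  case True
  have p1: "p1 > 0" using p(2)[of 0] p_pos[of 0] by auto
  have "integral {0..1} (\<lambda>x. (\<zeta> N x)\<^sup>2) \<ge> 0"
    by (intro integral_nonneg integrable_cont01 continuous_intros) auto
  then show ?thesis using True D p0 p1 \<mu>1 agmon_const_nonneg[of N] by auto
next
  case False
  define \<epsilon> where "\<epsilon> = agmon_const N / \<mu> ^ N * (12 * p1 * \<mu>)"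
  define I where "I = integral {0..1} (\<lambda>x. (\<zeta> N x)\<^sup>2)"
  have I: "I > 0"
  proof -
    have "continuous_on {0..1} (\<lambda>x. (\<zeta> N x)\<^sup>2)" by (intro continuous_intros)
    moreover have "(\<zeta> N (1/2))\<^sup>2 > 0" unfolding \<zeta>_def by simp
    ultimately have "I \<noteq> 0"
      using integral_eq_0_iff[of 0 1 "\<lambda>x. (\<zeta> N x)\<^sup>2"] unfolding I_def by force
    moreover have "I \<ge> 0" unfolding I_def
      by (intro integral_nonneg integrable_cont01 continuous_intros) auto
    ultimately show ?thesis by simp
  qed
  have o: "a1 * a2 + b1 * b2 = 0" using weak_mode_orthogonality[OF u v] False by simp
  \<comment> \<open>the norm of a product of complex numbers\<close>
  have "(a1 * b2 + b1 * a2)\<^sup>2 + (a1 * a2 - b1 * b2)\<^sup>2 = (a1\<^sup>2 + b1\<^sup>2) * (a2\<^sup>2 + b2\<^sup>2)"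
    by (simp add: power2_eq_square algebra_simps)
  moreover have "a1 * a2 - b1 * b2 = - (2 * (b1 * b2))" using o by linarith
  ultimately have "(a1 * b2 + b1 * a2)\<^sup>2 + (2 * (b1 * b2))\<^sup>2 = 1" using norm by simp
  then have "1 \<le> (\<bar>a1 * b2 + b1 * a2\<bar> + \<bar>2 * (b1 * b2)\<bar>)\<^sup>2"
    by (simp add: power2_sum)
  then have s: "1 \<le> \<bar>a1 * b2 + b1 * a2\<bar> + \<bar>2 * (b1 * b2)\<bar>"
    using power2_le_imp_le[of 1 "\<bar>a1 * b2 + b1 * a2\<bar> + \<bar>2 * (b1 * b2)\<bar>"] by simp
  have 1: "\<bar>\<kappa>1 - \<kappa>2\<bar> * \<bar>a1 * b2 + b1 * a2\<bar> \<le> D / p0 * \<epsilon>"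
    using weak_mode_reflection[OF u v norm D sym] unfolding \<epsilon>_def abs_mult by blast
  have "I * (\<bar>\<kappa>1 - \<kappa>2\<bar> * \<bar>b1 * b2\<bar>) \<le> \<epsilon>"
    using weak_mode_cutoff[OF u v norm, of N] unfolding \<epsilon>_def I_def abs_mult[of "\<kappa>1 - \<kappa>2"] by simp
  then have "\<bar>\<kappa>1 - \<kappa>2\<bar> * \<bar>b1 * b2\<bar> \<le> \<epsilon> / I" using I by (simp only: pos_le_divide_eq mult.commute)
  moreover have "\<bar>2 * (b1 * b2)\<bar> = 2 * \<bar>b1 * b2\<bar>" by (simp add: abs_mult)
  ultimately have 2: "\<bar>\<kappa>1 - \<kappa>2\<bar> * \<bar>2 * (b1 * b2)\<bar> \<le> 2 / I * \<epsilon>"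
    by simp
  have "\<bar>\<kappa>1 - \<kappa>2\<bar> * 1 \<le> \<bar>\<kappa>1 - \<kappa>2\<bar> * (\<bar>a1 * b2 + b1 * a2\<bar> + \<bar>2 * (b1 * b2)\<bar>)"
    using s by (intro mult_left_mono) auto
  also have "\<dots> \<le> D / p0 * \<epsilon> + 2 / I * \<epsilon>" using 1 2 by (simp only: distrib_left)
  finally show ?thesis unfolding \<epsilon>_def I_def by (simp only: distrib_right mult_1_right)
qed

end

section \<open>Polynomial test functions\<close>

lemma poly_antiderivative: "\<exists>Q :: real poly. pderiv Q = P"
proof (intro exI)
  have "pderiv (monom (coeff P i / (of_nat i + 1)) (Suc i)) = monom (coeff P i) i" for i
    by (simp add: pderiv_monom) (metis add.commute nonzero_mult_div_cancel_left of_nat_0_eq_iff of_nat_Suc nat.distinct(1))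
  then show "pderiv (\<Sum>i\<le>degree P. monom (coeff P i / (of_nat i + 1)) (Suc i)) = P"
    by (simp add: higher_pderiv_sum[of 1, simplified] poly_as_sum_of_monoms)
qed

lemma C1_poly: "C1 (poly P) (poly (pderiv P))"
  unfolding C1_def by (auto intro!: continuous_intros poly_DERIV DERIV_subset[OF poly_DERIV])

lemma C1_dense_poly:
  assumes w: "C1 w w'" and d: "d > 0"
  obtains P where "poly P 0 = w 0" "\<And>x. x \<in> {0..1} \<Longrightarrow> \<bar>w' x - poly (pderiv P) x\<bar> \<le> d" "\<And>x. x \<in> {0..1} \<Longrightarrow> \<bar>w x - poly P x\<bar> \<le> d"
proof -
  obtain g where g: "real_polynomial_function g" "\<And>x. x \<in> {0..1} \<Longrightarrow> \<bar>w' x - g x\<bar> < d"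
    using Stone_Weierstrass_real_polynomial_function[OF _ C1_cont(2)[OF w] d] by auto
  obtain a n where a: "g = (\<lambda>x. \<Sum>i\<le>n. a i * x ^ i)" using g(1) unfolding real_polynomial_function_iff_sum by blast
  define G where "G = (\<Sum>i\<le>n. monom (a i) i)"
  have G: "poly G x = g x" for x unfolding G_def a by (simp add: poly_sum poly_monom)
  obtain Q where Q: "pderiv Q = G" using poly_antiderivative by blast
  define P where "P = Q + [:w 0 - poly Q 0:]"
  have P: "pderiv P = G" "poly P 0 = w 0" unfolding P_def by (simp_all add: pderiv_add pderiv_pCons Q)
  have d': "\<bar>w' x - poly (pderiv P) x\<bar> \<le> d" if "x \<in> {0..1}" for x using g(2)[OF that] unfolding P G by simp
  have "\<bar>w x - poly P x\<bar> \<le> d" if x: "x \<in> {0..1}" for x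
  proof -
    have "norm ((w x - poly P x) - (w 0 - poly P 0)) \<le> d * norm (x - 0)"
    proof (rule field_differentiable_bound[of "{0..1}" "\<lambda>x. w x - poly P x" "\<lambda>x. w' x - poly (pderiv P) x"])
      show "((\<lambda>x. w x - poly P x) has_field_derivative w' z - poly (pderiv P) z) (at z within {0..1})" if "z \<in> {0..1}" for z
        using C1_diff[OF w C1_poly[of P]] that unfolding C1_def by blast
    qed (use x d' in auto)
    also have "\<dots> \<le> d * 1" using x d by (intro mult_left_mono) auto
    finally show ?thesis using P(2) by simp
  qed
  then show ?thesis using that[of P] P(2) d' by blast
qed

text \<open>By the Weierstrass theorem for \<open>w'\<close>, a polynomial approximates \<open>w\<close> together with its derivative.\<close>

lemma weak_mode_of_polynomials:
  assumes u: "sobolev_cauchy u u'" "(\<lambda>k. u k 0) \<longlonglongrightarrow> a" "(\<lambda>k. u k 1) \<longlonglongrightarrow> b"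
    and pq: "continuous_on {0..1} p" "continuous_on {0..1} q"
    and P: "\<And>P :: real poly. (\<lambda>k. bform p q (u k) (u' k) (poly P) (poly (pderiv P))) \<longlonglongrightarrow> \<kappa> * (a * poly P 0 + b * poly P 1)"
  shows "weak_mode p q \<kappa> a b u u'"
  unfolding weak_mode_def
proof (intro conjI allI impI u)
  fix w w' assume w: "C1 w w'"
  have cu: "C1 (u k) (u' k)" for k using u unfolding sobolev_cauchy_def by blast
  obtain M where M: "M > 0" "\<And>x. x \<in> {0..1} \<Longrightarrow> \<bar>p x\<bar> \<le> M" "\<And>x. x \<in> {0..1} \<Longrightarrow> \<bar>q x\<bar> \<le> M"
    by (rule cont_bounded01_2[OF pq]) blast
  obtain C N0 where C: "C > 0" "\<And>k. k \<ge> N0 \<Longrightarrow> sobolev_sq (u k) (u' k) \<le> C"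
    using sobolev_cauchy_bounded u by metis
  show "(\<lambda>k. bform p q (u k) (u' k) w w') \<longlonglongrightarrow> \<kappa> * (a * w 0 + b * w 1)"
  proof (rule LIMSEQ_I)
    fix e :: real assume e: "e > 0"
    define t where "t = e / (8 * M * C)"
    have t: "t > 0" unfolding t_def using e M C by simp
    define d where "d = min (min 1 (e * t / (16 * M))) (e / (4 * (\<bar>\<kappa> * b\<bar> + 1)))"
    have d: "d > 0" "d \<le> 1" "d \<le> e * t / (16 * M)" "d \<le> e / (4 * (\<bar>\<kappa> * b\<bar> + 1))"
      unfolding d_def using e t M by (auto simp: add_nonneg_pos)
    obtain P where P': "poly P 0 = w 0" "\<And>x. x \<in> {0..1} \<Longrightarrow> \<bar>w' x - poly (pderiv P) x\<bar> \<le> d" "\<And>x. x \<in> {0..1} \<Longrightarrow> \<bar>w x - poly P x\<bar> \<le> d"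
      by (rule C1_dense_poly[OF w d(1)]) blast
    note c = C1_cont[OF w] C1_cont[OF C1_poly[of P]]
    have "sobolev_sq (\<lambda>x. w x - poly P x) (\<lambda>x. w' x - poly (pderiv P) x) \<le> integral {0..1} (\<lambda>x::real. 2 * d)"
      unfolding sobolev_sq_def
    proof (rule integral_mono01)
      fix x :: real assume x: "x \<in> {0..1}"
      have sq: "y\<^sup>2 \<le> d" if "\<bar>y\<bar> \<le> d" for y
      proof -
        have "y\<^sup>2 \<le> d\<^sup>2" using that by (metis abs_ge_zero power2_abs power_mono)
        also have "\<dots> \<le> d" using d(1,2) by (simp add: power2_eq_square mult_left_le)
        finally show ?thesis .
      qed
      show "(w' x - poly (pderiv P) x)\<^sup>2 + (w x - poly P x)\<^sup>2 \<le> 2 * d"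
        using sq[OF P'(2)[OF x]] sq[OF P'(3)[OF x]] by linarith
    qed (auto intro!: continuous_intros c)
    then have sw: "sobolev_sq (\<lambda>x. w x - poly P x) (\<lambda>x. w' x - poly (pderiv P) x) \<le> e * t / (8 * M)"
      using d(3) by simp
    have close: "\<bar>bform p q (u k) (u' k) w w' - bform p q (u k) (u' k) (poly P) (poly (pderiv P))\<bar> \<le> e / 4" if k: "k \<ge> N0" for k
    proof -
      have "\<bar>bform p q (u k) (u' k) (\<lambda>x. w x - poly P x) (\<lambda>x. w' x - poly (pderiv P) x)\<bar>
        \<le> M * (t * sobolev_sq (u k) (u' k) + sobolev_sq (\<lambda>x. w x - poly P x) (\<lambda>x. w' x - poly (pderiv P) x) / t)"
        by (rule bform_bound) (use M t pq in \<open>auto intro: C1_diff cu w C1_poly\<close>)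
      also have "\<dots> \<le> M * (t * C + (e * t / (8 * M)) / t)"
        using C(2)[OF k] sw M t by (intro mult_left_mono add_mono divide_right_mono) auto
      also have "\<dots> = e / 4" unfolding t_def using M C e by (simp add: field_simps)
      finally show ?thesis by (simp add: bform_diff_right[OF cu w C1_poly pq])
    qed
    have "\<bar>\<kappa> * b * (poly P 1 - w 1)\<bar> \<le> (\<bar>\<kappa> * b\<bar> + 1) * (e / (4 * (\<bar>\<kappa> * b\<bar> + 1)))"
      unfolding abs_mult[of "\<kappa> * b"] using P'(3)[of 1] d(4) by (intro mult_mono) (auto simp: abs_minus_commute)
    also have "\<dots> = e / 4" by (simp add: field_simps add_nonneg_eq_0_iff)
    finally have bd: "\<bar>\<kappa> * (a * poly P 0 + b * poly P 1) - \<kappa> * (a * w 0 + b * w 1)\<bar> \<le> e / 4"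
      unfolding P'(1) by (simp add: algebra_simps)
    from LIMSEQ_D[OF P[of P], of "e / 4"] e obtain N1 where
      N1: "\<And>k. k \<ge> N1 \<Longrightarrow> \<bar>bform p q (u k) (u' k) (poly P) (poly (pderiv P)) - \<kappa> * (a * poly P 0 + b * poly P 1)\<bar> < e / 4"
      by auto
    show "\<exists>no. \<forall>k\<ge>no. norm (bform p q (u k) (u' k) w w' - \<kappa> * (a * w 0 + b * w 1)) < e"
    proof (intro exI allI impI)
      fix k assume "k \<ge> max N0 N1"
      then show "norm (bform p q (u k) (u' k) w w' - \<kappa> * (a * w 0 + b * w 1)) < e"
        using close[of k] N1[of k] bd e unfolding real_norm_def by (simp add: abs_if split: if_splits)
    qed
  qed
qed

lemma weak_mode_scale:
  assumes u: "weak_mode p q \<kappa> a b u u'"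
  shows "weak_mode p q \<kappa> (t * a) (t * b) (\<lambda>k x. t * u k x) (\<lambda>k x. t * u' k x)"
  unfolding weak_mode_def
proof (intro conjI allI impI)
  show "sobolev_cauchy (\<lambda>k x. t * u k x) (\<lambda>k x. t * u' k x)"
    using sobolev_cauchy_mult[OF C1_linear[of t 0], of u u'] u unfolding weak_mode_def by simp
  show "(\<lambda>k. t * u k 0) \<longlonglongrightarrow> t * a" "(\<lambda>k. t * u k 1) \<longlonglongrightarrow> t * b"
    using u unfolding weak_mode_def by (auto intro: tendsto_mult_left)
  fix w w' assume "C1 w w'"
  then have "(\<lambda>k. t * bform p q (u k) (u' k) w w') \<longlonglongrightarrow> t * (\<kappa> * (a * w 0 + b * w 1))"
    using u unfolding weak_mode_def by (intro tendsto_mult_left) blast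
  moreover have "t * bform p q (u k) (u' k) w w' = bform p q (\<lambda>x. t * u k x) (\<lambda>x. t * u' k x) w w'" for k
    unfolding bform_def integral_mult_right[symmetric] by (simp add: algebra_simps)
  ultimately show "(\<lambda>k. bform p q (\<lambda>x. t * u k x) (\<lambda>x. t * u' k x) w w') \<longlonglongrightarrow> \<kappa> * (t * a * w 0 + t * b * w 1)"
    by (simp add: algebra_simps)
qed

section \<open>Taylor coefficients and reflection\<close>

lemma frechet_derivative_cong:
  assumes "\<And>x. x \<in> S \<Longrightarrow> f x = g x" "z \<in> S"
  shows "frechet_derivative f (at z within S) = frechet_derivative g (at z within S)"
proof -
  have "(f has_derivative F) (at z within S) \<longleftrightarrow> (g has_derivative F) (at z within S)" for F
    using assms by (metis has_derivative_transform)
  then show ?thesis unfolding frechet_derivative_def by simp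
qed

lemma Ck_on_cong:
  assumes "\<And>x. x \<in> S \<Longrightarrow> f x = g x"
  shows "Ck_on k S f \<longleftrightarrow> Ck_on k S g"
  using assms
proof (induction k arbitrary: f g)
  case 0
  then show ?case by (simp cong: continuous_on_cong)
next
  case (Suc k)
  have "Ck_on k S (\<lambda>z. frechet_derivative f (at z within S) v) \<longleftrightarrow> Ck_on k S (\<lambda>z. frechet_derivative g (at z within S) v)" for v
    by (rule Suc.IH) (use frechet_derivative_cong[of S f g] Suc.prems in auto)
  moreover have "f differentiable_on S \<longleftrightarrow> g differentiable_on S"
    unfolding differentiable_on_def differentiable_def using Suc.prems by (metis has_derivative_transform)
  ultimately show ?case by simp
qed

lemma Ck_on_imp_continuous: "Ck_on k S f \<Longrightarrow> continuous_on S f"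
  by (cases k) (auto intro: differentiable_imp_continuous_on)

lemma Ck_on_decrease: "Ck_on (Suc k) S f \<Longrightarrow> Ck_on k S f"
proof (induction k arbitrary: f)
  case 0
  then show ?case using Ck_on_imp_continuous[of 1 S f] by simp
next
  case (Suc k)
  then show ?case by (subst Ck_on.simps) (metis Ck_on.simps(2))
qed

lemma smooth_on_imp_Ck: "smooth_on S f \<Longrightarrow> Ck_on k S f"
  unfolding smooth_on_def by blast

text \<open>The one-sided derivatives in \<open>deriv01\<close> are values of the Frechet derivative in the direction \<open>1\<close>.\<close>

lemma smooth_on_deriv01_step:
  fixes f :: "real \<Rightarrow> real"
  assumes "smooth_on {0..1} f"
  shows "smooth_on {0..1} (\<lambda>x. vector_derivative f (at x within {0..1}))"
    and "\<And>x. x \<in> {0..1} \<Longrightarrow> (f has_vector_derivative vector_derivative f (at x within {0..1})) (at x within {0..1::real})"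
proof -
  have d: "f differentiable (at x within {0..1})" if "x \<in> {0..1}" for x
    using smooth_on_imp_Ck[OF assms, of 1] that by (simp add: differentiable_on_def)
  then show hd: "(f has_vector_derivative vector_derivative f (at x within {0..1})) (at x within {0..1})" if "x \<in> {0..1}" for x
    using that vector_derivative_works by blast
  have eq: "frechet_derivative f (at x within {0..1}) 1 = vector_derivative f (at x within {0..1})" if x: "x \<in> {0..1}" for x
  proof -
    have "(f has_vector_derivative frechet_derivative f (at x within {0..1}) 1) (at x within {0..1})"
    proof -
      have F: "(f has_derivative frechet_derivative f (at x within {0..1})) (at x within {0..1})"
        using d[OF x] frechet_derivative_works by blast
      have "frechet_derivative f (at x within {0..1}) = (\<lambda>h. h *\<^sub>R frechet_derivative f (at x within {0..1}) 1)"
        (is "?F = _")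
      proof
        fix h
        have "?F (h *\<^sub>R 1) = h *\<^sub>R ?F 1" by (rule linear_cmul[OF has_derivative_linear[OF F]])
        then show "?F h = h *\<^sub>R ?F 1" by (simp only: real_scaleR_def mult_1_right)
      qed
      then show ?thesis using F unfolding has_vector_derivative_def by (rule subst[where P = "\<lambda>G. (f has_derivative G) (at x within {0..1})"])
    qed
    then show ?thesis using vector_derivative_within_closed_interval[of 0 1 x f] x by (auto simp: vector_derivative_within_cbox)
  qed
  show "smooth_on {0..1} (\<lambda>x. vector_derivative f (at x within {0..1}))"
    unfolding smooth_on_def
  proof
    fix k
    have "Ck_on k {0..1} (\<lambda>x. frechet_derivative f (at x within {0..1}) 1)"
      using smooth_on_imp_Ck[OF assms, of "Suc k"] by simp
    then show "Ck_on k {0..1} (\<lambda>x. vector_derivative f (at x within {0..1}))"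
      by (rule Ck_on_cong[THEN iffD1, rotated]) (rule eq)
  qed
qed

lemma deriv01_has_derivative:
  assumes "smooth_on {0..1} f" "x \<in> {0..1}"
  shows "(deriv01 j f has_real_derivative deriv01 (Suc j) f x) (at x within {0..1})"
proof -
  have "smooth_on {0..1} (deriv01 j f)"
    by (induction j) (use assms smooth_on_deriv01_step(1) in auto)
  from smooth_on_deriv01_step(2)[OF this assms(2)] show ?thesis
    by (simp add: has_real_derivative_iff_has_vector_derivative)
qed

text \<open>Taylor's theorem at a point where all derivatives vanish, by integrating \<open>N\<close> times.\<close>

lemma flat_at_0:
  assumes D: "\<And>j x. x \<in> {0..1} \<Longrightarrow> (D j has_real_derivative D (Suc j) x) (at x within {0..1})"
    and 0: "\<And>j. D j 0 = (0::real)"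
  shows "\<exists>C\<ge>0. \<forall>x\<in>{0..1}. \<bar>D j x\<bar> \<le> C * x ^ N"
proof (induction N arbitrary: j)
  case 0
  have "continuous_on {0..1} (D j)" using D by (blast intro: DERIV_continuous_on)
  then obtain M where "M > 0" "\<And>x. x \<in> {0..1} \<Longrightarrow> \<bar>D j x\<bar> \<le> M" by (rule cont_bounded01) blast
  then show ?case by (intro exI[of _ M]) auto
next
  case (Suc N)
  then obtain C where C: "C \<ge> 0" "\<And>x. x \<in> {0..1} \<Longrightarrow> \<bar>D (Suc j) x\<bar> \<le> C * x ^ N" by blast
  have "\<bar>D j x\<bar> \<le> C * x ^ Suc N" if x: "x \<in> {0..1}" for x
  proof -
    have "norm (D j x - D j 0) \<le> (C * x ^ N) * norm (x - 0)"
    proof (rule field_differentiable_bound[of "{0..x}" "D j" "D (Suc j)"])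
      fix z assume z: "z \<in> {0..x}"
      then have z1: "z \<in> {0..1}" using x by auto
      show "(D j has_field_derivative D (Suc j) z) (at z within {0..x})"
        by (rule DERIV_subset[OF D[OF z1]]) (use x in auto)
      have "\<bar>D (Suc j) z\<bar> \<le> C * z ^ N" by (rule C(2)[OF z1])
      also have "\<dots> \<le> C * x ^ N" using z C(1) by (intro mult_left_mono power_mono) auto
      finally show "norm (D (Suc j) z) \<le> C * x ^ N" by simp
    qed (use x in auto)
    then show ?thesis using x 0 by (simp add: mult_ac)
  qed
  then show ?case using C(1) by blast
qed

text \<open>The function \<open>d x = f x - f (1 - x)\<close> has vanishing Taylor series at \<open>0\<close>, hence \<open>\<bar>d x\<bar> \<le> C * x ^ (4 * N)\<close>. As
\<open>\<bar>d\<bar>\<close> is invariant under reflection, the same bound holds with \<open>1 - x\<close>; the geometric mean of both is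
the claim.\<close>

lemma taylor_symmetric_near_reflection:
  assumes f: "smooth_on {0..1} f" and sym: "\<forall>j. deriv01 j f 0 = (-1) ^ j * deriv01 j f 1"
  shows "\<exists>C\<ge>0. \<forall>x\<in>{0..1}. \<bar>f x - f (1 - x)\<bar> \<le> C * (\<zeta> N x)\<^sup>2"
proof -
  define D where "D j x = deriv01 j f x - (-1) ^ j * deriv01 j f (1 - x)" for j x
  have "(D j has_real_derivative D (Suc j) x) (at x within {0..1})" if x: "x \<in> {0..1}" for j x
  proof -
    have im: "(\<lambda>x::real. 1 - x) ` {0..1} = {0..1}"
      by (auto intro: image_eqI[of _ _ "1 - _"])
    have "((\<lambda>x. deriv01 j f (1 - x)) has_real_derivative deriv01 (Suc j) f (1 - x) * (- 1)) (at x within {0..1})"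
    proof (rule DERIV_image_chain[where f = "deriv01 j f" and g = "\<lambda>x. 1 - x", unfolded o_def])
      show "(deriv01 j f has_real_derivative deriv01 (Suc j) f (1 - x)) (at (1 - x) within (\<lambda>x. 1 - x) ` {0..1})"
        unfolding im by (rule deriv01_has_derivative[OF f]) (use x in auto)
      show "((-) 1 has_real_derivative - 1) (at x within {0..1})"
        by (auto intro!: derivative_eq_intros)
    qed
    from DERIV_diff[OF deriv01_has_derivative[OF f x, of j] DERIV_cmult[OF this, of "(-1) ^ j"]]
    show ?thesis unfolding D_def by simp
  qed
  moreover have "D j 0 = 0" for j unfolding D_def using sym by simp
  ultimately obtain C where C: "C \<ge> 0" "\<And>x. x \<in> {0..1} \<Longrightarrow> \<bar>D 0 x\<bar> \<le> C * x ^ (4 * N)"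
    using flat_at_0[of D 0 "4 * N"] by blast
  have "\<bar>f x - f (1 - x)\<bar> \<le> C * (\<zeta> N x)\<^sup>2" if x: "x \<in> {0..1}" for x
  proof -
    have 1: "\<bar>f x - f (1 - x)\<bar> \<le> C * x ^ (4 * N)" using C(2)[OF x] unfolding D_def by simp
    have 2: "\<bar>f x - f (1 - x)\<bar> \<le> C * (1 - x) ^ (4 * N)" using C(2)[of "1 - x"] x unfolding D_def by (simp add: abs_minus_commute)
    have "\<bar>f x - f (1 - x)\<bar> * \<bar>f x - f (1 - x)\<bar> \<le> (C * x ^ (4 * N)) * (C * (1 - x) ^ (4 * N))"
      using 1 2 C(1) x by (intro mult_mono) auto
    also have "\<dots> = (C * (\<zeta> N x)\<^sup>2)\<^sup>2"
    proof -
      have "y ^ (4 * N) = y ^ N * y ^ N * (y ^ N * y ^ N)" for y :: real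
        by (simp add: power_add[symmetric] numeral_eq_Suc add.assoc)
      then show ?thesis unfolding \<zeta>_def by (simp add: power2_eq_square power_mult_distrib mult_ac)
    qed
    finally have "\<bar>f x - f (1 - x)\<bar>\<^sup>2 \<le> (C * (\<zeta> N x)\<^sup>2)\<^sup>2" by (simp add: power2_eq_square)
    then show ?thesis by (rule power2_le_imp_le) (use C(1) in auto)
  qed
  then show ?thesis using C(1) by blast
qed

lemma C1_image_Lipschitz:
  assumes "\<And>y. y \<in> {m..M} \<Longrightarrow> (\<phi> has_real_derivative \<phi>' y) (at y within {m..M})" "continuous_on {m..M} \<phi>'"
  obtains L where "L \<ge> 0" "\<And>y z. y \<in> {m..M} \<Longrightarrow> z \<in> {m..M} \<Longrightarrow> \<bar>\<phi> y - \<phi> z\<bar> \<le> L * \<bar>y - (z::real)\<bar>"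
proof -
  have "bounded (\<phi>' ` {m..M})" by (intro compact_imp_bounded compact_continuous_image assms) auto
  then obtain L where L: "\<forall>y\<in>\<phi>' ` {m..M}. norm y \<le> L" unfolding bounded_iff by blast
  have "\<bar>\<phi> y - \<phi> z\<bar> \<le> \<bar>L\<bar> * \<bar>y - z\<bar>" if "y \<in> {m..M}" "z \<in> {m..M}" for y z
  proof -
    have "norm (\<phi> y - \<phi> z) \<le> \<bar>L\<bar> * norm (y - z)"
      by (rule field_differentiable_bound[of "{m..M}" \<phi> \<phi>']) (use assms L that in \<open>force simp: abs_le_iff\<close>)+
    then show ?thesis by simp
  qed
  then show ?thesis using that[of "\<bar>L\<bar>"] by simp
qed

section \<open>Gaps for the radial equation\<close>

text \<open>Up to a volume element of \<open>K\<close>, \<open>vol_weight\<close> is the density of the Riemannian volume, and \<open>grad_weight\<close> is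
the density multiplied by the factor \<open>1 / f\<close> of the squared gradient.\<close>

definition vol_weight :: "nat \<Rightarrow> (real \<Rightarrow> real) \<Rightarrow> real \<Rightarrow> real" where
  "vol_weight n f x = sqrt (f x ^ n)"

definition grad_weight :: "nat \<Rightarrow> (real \<Rightarrow> real) \<Rightarrow> real \<Rightarrow> real" where
  "grad_weight n f x = vol_weight n f x / f x"

text \<open>The weights are smooth functions of \<open>f\<close>, which stays in a compact subset of the positive reals, so they
inherit the flatness of \<open>f x - f (1 - x)\<close>. Coercivity needs \<open>\<mu> \<ge> 2 * \<bar>\<omega>\<bar> * F\<close>, with \<open>F\<close> a bound for \<open>f\<close>.\<close>

theorem radial_gap:
  assumes f: "smooth_on {0..1} f" and pos: "\<forall>x\<in>{0..1}. f x > 0" and sym: "\<forall>j. deriv01 j f 0 = (-1) ^ j * deriv01 j f 1"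
  shows "\<exists>C M. \<forall>\<mu>\<ge>M. \<forall>\<kappa>1 a1 b1 u u' \<kappa>2 a2 b2 v v'.
     (a1, b1) \<noteq> (0, 0) \<longrightarrow> (a2, b2) \<noteq> (0, 0) \<longrightarrow>
     weak_mode (grad_weight n f) (\<lambda>x. \<mu> * grad_weight n f x - \<omega> * vol_weight n f x) \<kappa>1 a1 b1 u u' \<longrightarrow>
     weak_mode (grad_weight n f) (\<lambda>x. \<mu> * grad_weight n f x - \<omega> * vol_weight n f x) \<kappa>2 a2 b2 v v' \<longrightarrow>
     \<bar>\<kappa>1 - \<kappa>2\<bar> \<le> C * (\<mu> / \<mu> ^ N)"
proof -
  have fc: "continuous_on {0..1} f" using smooth_on_imp_Ck[OF f, of 0] by simp
  obtain F where F: "F > 0" "\<And>x. x \<in> {0..1} \<Longrightarrow> \<bar>f x\<bar> \<le> F" by (rule cont_bounded01[OF fc]) blast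
  obtain x0 where x0: "x0 \<in> {0..1}" "\<And>x. x \<in> {0..1} \<Longrightarrow> f x0 \<le> f x"
    using continuous_attains_inf[OF _ _ fc] by auto
  define m where "m = f x0"
  have m: "m > 0" unfolding m_def using pos x0 by blast
  have fm: "f x \<in> {m..F}" "f (1 - x) \<in> {m..F}" if "x \<in> {0..1}" for x
    using that x0(2)[of x] x0(2)[of "1 - x"] F(2)[of x] F(2)[of "1 - x"] unfolding m_def by auto
  obtain C where C: "C \<ge> 0" "\<And>x. x \<in> {0..1} \<Longrightarrow> \<bar>f x - f (1 - x)\<bar> \<le> C * (\<zeta> N x)\<^sup>2"
    using taylor_symmetric_near_reflection[OF f sym] by blast
  let ?r' = "\<lambda>y::real. (real n * y ^ (n - 1)) * (inverse (sqrt (y ^ n)) / 2)"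
  have r: "((\<lambda>y. sqrt (y ^ n)) has_real_derivative ?r' y) (at y within {m..F})" if "y \<in> {m..F}" for y
    using that m by (auto intro!: derivative_eq_intros)
  have r'c: "continuous_on {m..F} ?r'" using m by (auto intro!: continuous_intros)
  have p: "((\<lambda>y. sqrt (y ^ n) / y) has_real_derivative (?r' y * y - sqrt (y ^ n)) / (y * y)) (at y within {m..F})" if "y \<in> {m..F}" for y
    using DERIV_divide[OF r[OF that] DERIV_ident] that m by auto
  have p'c: "continuous_on {m..F} (\<lambda>y. (?r' y * y - sqrt (y ^ n)) / (y * y))" using m by (auto intro!: continuous_intros)
  obtain Lr where Lr: "Lr \<ge> 0" "\<And>y z. y \<in> {m..F} \<Longrightarrow> z \<in> {m..F} \<Longrightarrow> \<bar>sqrt (y ^ n) - sqrt (z ^ n)\<bar> \<le> Lr * \<bar>y - z\<bar>"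
    by (rule C1_image_Lipschitz[OF r r'c]) blast+
  obtain Lp where Lp: "Lp \<ge> 0" "\<And>y z. y \<in> {m..F} \<Longrightarrow> z \<in> {m..F} \<Longrightarrow> \<bar>sqrt (y ^ n) / y - sqrt (z ^ n) / z\<bar> \<le> Lp * \<bar>y - z\<bar>"
    by (rule C1_image_Lipschitz[OF p p'c]) blast+
  define D where "D = Lp * C + \<bar>\<omega>\<bar> * (Lr * C)"
  have D: "D \<ge> 0" "Lp * C \<le> D" unfolding D_def using Lp Lr C by auto
  let ?p = "grad_weight n f" and ?r = "vol_weight n f"
  have psym: "\<bar>?p x - ?p (1 - x)\<bar> \<le> Lp * C * (\<zeta> N x)\<^sup>2" if x: "x \<in> {0..1}" for x
    using order_trans[OF Lp(2)[OF fm[OF x]] mult_left_mono[OF C(2)[OF x] Lp(1)]]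
    unfolding grad_weight_def vol_weight_def by (simp add: mult_ac)
  have rsym: "\<bar>?r x - ?r (1 - x)\<bar> \<le> Lr * C * (\<zeta> N x)\<^sup>2" if x: "x \<in> {0..1}" for x
    using order_trans[OF Lr(2)[OF fm[OF x]] mult_left_mono[OF C(2)[OF x] Lr(1)]]
    unfolding vol_weight_def by (simp add: mult_ac)
  have rc: "continuous_on {0..1} ?r" unfolding vol_weight_def by (intro continuous_intros fc)
  have pc: "continuous_on {0..1} ?p" unfolding grad_weight_def by (intro continuous_intros fc rc) (use pos in force)
  obtain p1 where p1: "\<And>x. x \<in> {0..1} \<Longrightarrow> \<bar>?p x\<bar> \<le> p1" by (rule cont_bounded01[OF pc]) blast
  obtain y0 where y0: "y0 \<in> {0..1}" "\<And>x. x \<in> {0..1} \<Longrightarrow> ?p y0 \<le> ?p x"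
    using continuous_attains_inf[OF _ _ pc] by auto
  define p0 where "p0 = ?p y0"
  have ppos: "?p x > 0" if "x \<in> {0..1}" for x using pos that unfolding grad_weight_def vol_weight_def by auto
  have p0: "p0 > 0" unfolding p0_def by (rule ppos[OF y0(1)])
  define M where "M = max 1 (2 * \<bar>\<omega>\<bar> * F)"
  define K where "K = (D / p0 + 2 / integral {0..1} (\<lambda>x. (\<zeta> N x)\<^sup>2)) * (agmon_const N * (12 * p1))"
  have "\<bar>\<kappa>1 - \<kappa>2\<bar> \<le> K * (\<mu> / \<mu> ^ N)"
    if \<mu>: "\<mu> \<ge> M" and ab: "(a1, b1) \<noteq> (0, 0)" "(a2, b2) \<noteq> (0, 0)" and
      u: "weak_mode ?p (\<lambda>x. \<mu> * ?p x - \<omega> * ?r x) \<kappa>1 a1 b1 u u'" and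
      v: "weak_mode ?p (\<lambda>x. \<mu> * ?p x - \<omega> * ?r x) \<kappa>2 a2 b2 v v'" for \<mu> \<kappa>1 a1 b1 u u' \<kappa>2 a2 b2 v v'
  proof -
    have \<mu>1: "\<mu> \<ge> 1" and \<mu>F: "2 * \<bar>\<omega>\<bar> * F \<le> \<mu>" using \<mu> unfolding M_def by auto
    have rp: "\<bar>\<omega> * ?r x\<bar> \<le> \<mu> * ?p x / 2" if x: "x \<in> {0..1}" for x
    proof -
      have "?r x = f x * ?p x" unfolding grad_weight_def using pos x by (simp add: less_imp_neq[symmetric])
      then have "2 * \<bar>\<omega> * ?r x\<bar> = (2 * \<bar>\<omega>\<bar> * \<bar>f x\<bar>) * ?p x" using ppos[OF x] by (simp add: abs_mult)
      also have "\<dots> \<le> (2 * \<bar>\<omega>\<bar> * F) * ?p x"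
        using F(2)[OF x] ppos[OF x] by (intro mult_right_mono mult_left_mono) auto
      also have "\<dots> \<le> \<mu> * ?p x" using \<mu>F ppos[OF x] by (intro mult_right_mono) auto
      finally show ?thesis by simp
    qed
    interpret coercive_form ?p "\<lambda>x. \<mu> * ?p x - \<omega> * ?r x" \<mu> p0 p1
    proof
      show "continuous_on {0..1} (\<lambda>x. \<mu> * ?p x - \<omega> * ?r x)" by (intro continuous_intros pc rc)
      fix x :: real assume x: "x \<in> {0..1}"
      show "p0 \<le> ?p x" unfolding p0_def by (rule y0(2)[OF x])
      show "?p x \<le> p1" using p1[OF x] by simp
      show "\<mu> * ?p x \<le> 2 * (\<mu> * ?p x - \<omega> * ?r x)" using abs_le_D1[OF rp[OF x]] by (simp add: algebra_simps)
      show "\<mu> * ?p x - \<omega> * ?r x \<le> 2 * \<mu> * ?p x" 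
      proof -
        have "0 \<le> \<mu> * ?p x" using \<mu>1 ppos[OF x] by simp
        then show ?thesis using abs_le_D2[OF rp[OF x]] by (simp add: algebra_simps)
      qed
    qed (use pc p0 \<mu>1 in auto)
    define t1 t2 where "t1 = 1 / sqrt (a1\<^sup>2 + b1\<^sup>2)" and "t2 = 1 / sqrt (a2\<^sup>2 + b2\<^sup>2)"
    have "a1\<^sup>2 + b1\<^sup>2 > 0" "a2\<^sup>2 + b2\<^sup>2 > 0" using ab by (auto simp: sum_power2_gt_zero_iff)
    then have norm: "(t1 * a1)\<^sup>2 + (t1 * b1)\<^sup>2 = 1" "(t2 * a2)\<^sup>2 + (t2 * b2)\<^sup>2 = 1"
      unfolding t1_def t2_def by (auto simp: power_mult_distrib power_divide add_divide_distrib[symmetric])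
    have "\<bar>\<kappa>1 - \<kappa>2\<bar> \<le> (D / p0 + 2 / integral {0..1} (\<lambda>x. (\<zeta> N x)\<^sup>2)) * (agmon_const N / \<mu> ^ N * (12 * p1 * \<mu>))"
    proof (rule weak_mode_gap[OF weak_mode_scale[OF u] weak_mode_scale[OF v] norm D(1)])
      fix x :: real assume x: "x \<in> {0..1}"
      have z: "(\<zeta> N x)\<^sup>2 \<ge> 0" by simp
      show "\<bar>?p x - ?p (1 - x)\<bar> \<le> D * (\<zeta> N x)\<^sup>2"
        using psym[OF x] mult_right_mono[OF D(2) z] by linarith
      have "\<bar>(\<mu> * ?p x - \<omega> * ?r x) - (\<mu> * ?p (1 - x) - \<omega> * ?r (1 - x))\<bar> \<le> \<mu> * \<bar>?p x - ?p (1 - x)\<bar> + \<bar>\<omega>\<bar> * \<bar>?r x - ?r (1 - x)\<bar>"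
      proof -
        have "(\<mu> * ?p x - \<omega> * ?r x) - (\<mu> * ?p (1 - x) - \<omega> * ?r (1 - x)) = \<mu> * (?p x - ?p (1 - x)) - \<omega> * (?r x - ?r (1 - x))"
          by (simp add: algebra_simps)
        then show ?thesis using abs_triangle_ineq4[of "\<mu> * (?p x - ?p (1 - x))" "\<omega> * (?r x - ?r (1 - x))"] \<mu>1
          by (simp add: abs_mult)
      qed
      also have "\<dots> \<le> \<mu> * (Lp * C * (\<zeta> N x)\<^sup>2) + \<bar>\<omega>\<bar> * (Lr * C * (\<zeta> N x)\<^sup>2)"
        using psym[OF x] rsym[OF x] \<mu>1 by (intro add_mono mult_left_mono) auto
      also have "\<dots> \<le> \<mu> * (Lp * C * (\<zeta> N x)\<^sup>2) + \<mu> * (\<bar>\<omega>\<bar> * (Lr * C * (\<zeta> N x)\<^sup>2))"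
        using \<mu>1 Lr(1) C(1) z mult_right_mono[of 1 \<mu> "\<bar>\<omega>\<bar> * (Lr * C * (\<zeta> N x)\<^sup>2)"] by simp
      also have "\<dots> = D * \<mu> * (\<zeta> N x)\<^sup>2" unfolding D_def by (simp add: algebra_simps)
      finally show "\<bar>(\<mu> * ?p x - \<omega> * ?r x) - (\<mu> * ?p (1 - x) - \<omega> * ?r (1 - x))\<bar> \<le> D * \<mu> * (\<zeta> N x)\<^sup>2" .
    qed
    then show ?thesis unfolding K_def by (simp add: mult_ac)
  qed
  then show ?thesis by blast
qed

section \<open>Gram determinants\<close>

lemma gram_det_scale: "gram_det (\<lambda>v w :: 'e::euclidean_space. c * B v w) = c ^ DIM('e) * gram_det B"
  unfolding gram_det_def by (simp add: prod.distrib sum_distrib_left mult_ac)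

text \<open>The determinant of the block matrix \<open>1 \<oplus> B\<close>: a permutation that moves the first basis vector meets a zero
entry in its row, and the others are permutations of the second factor.\<close>

lemma gram_det_product:
  fixes B :: "'e::euclidean_space \<Rightarrow> 'e \<Rightarrow> real"
  assumes B0: "\<And>w. B 0 w = 0"
  shows "gram_det (\<lambda>(a, v) (b, w). a * b + B v w) = gram_det B"
proof -
  define G :: "real \<times> 'e \<Rightarrow> real \<times> 'e \<Rightarrow> real" where "G = (\<lambda>(a, v) (b, w). a * b + B v w)"
  define \<iota> :: "'e \<Rightarrow> real \<times> 'e" where "\<iota> b = (0, b)" for b
  define A where "A = \<iota> ` Basis"
  have fin: "finite A" unfolding A_def by simp
  have inj: "inj_on \<iota> S" for S unfolding \<iota>_def by (simp add: inj_on_def)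
  have bij: "bij_betw \<iota> Basis A" unfolding A_def by (rule inj_on_imp_bij_betw[OF inj])
  have Basis: "(Basis :: (real \<times> 'e) set) = insert (1, 0) A"
    unfolding A_def \<iota>_def Basis_prod_def by auto
  have notin: "(1, 0) \<notin> A" unfolding A_def \<iota>_def by auto
  have "gram_det G = (\<Sum>\<pi> | \<pi> permutes insert (1, 0) A. of_int (sign \<pi>) * (\<Prod>b\<in>insert (1, 0) A. G b (\<pi> b)))"
    unfolding gram_det_def Basis ..
  also have "\<dots> = (\<Sum>\<pi> | \<pi> permutes A. of_int (sign \<pi>) * (\<Prod>b\<in>insert (1, 0) A. G b (\<pi> b)))"
  proof (rule sum.mono_neutral_right)
    show "finite {\<pi>. \<pi> permutes insert (1, 0) A}" using fin by (intro finite_permutations) auto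
    show "{\<pi>. \<pi> permutes A} \<subseteq> {\<pi>. \<pi> permutes insert (1, 0) A}"
      using permutes_subset[of _ A "insert (1, 0) A"] by blast
    show "\<forall>\<pi>\<in>{\<pi>. \<pi> permutes insert (1, 0) A} - {\<pi>. \<pi> permutes A}. of_int (sign \<pi>) * (\<Prod>b\<in>insert (1, 0) A. G b (\<pi> b)) = 0"
    proof
      fix \<pi> assume \<pi>: "\<pi> \<in> {\<pi>. \<pi> permutes insert (1, 0) A} - {\<pi>. \<pi> permutes A}"
      have "\<pi> (1, 0) \<noteq> (1, 0)"
        using \<pi> permutes_superset[of \<pi> "insert (1, 0) A" A] by auto
      moreover have "\<pi> (1, 0) \<in> insert (1, 0) A" using \<pi> permutes_in_image[of \<pi> "insert (1,0) A" "(1,0)"] by auto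
      ultimately obtain b where "\<pi> (1, 0) = (0, b)" unfolding A_def \<iota>_def by auto
      then have "G (1, 0) (\<pi> (1, 0)) = 0" unfolding G_def using B0 by simp
      then show "of_int (sign \<pi>) * (\<Prod>b\<in>insert (1, 0) A. G b (\<pi> b)) = 0"
        using fin notin by simp
    qed
  qed
  also have "\<dots> = (\<Sum>\<pi> | \<pi> permutes A. of_int (sign \<pi>) * (\<Prod>b\<in>A. G b (\<pi> b)))"
  proof (rule sum.cong[OF refl])
    fix \<pi> assume "\<pi> \<in> {\<pi>. \<pi> permutes A}"
    then have "\<pi> (1, 0) = (1, 0)" using notin permutes_not_in by fastforce
    then show "of_int (sign \<pi>) * (\<Prod>b\<in>insert (1, 0) A. G b (\<pi> b)) = of_int (sign \<pi>) * (\<Prod>b\<in>A. G b (\<pi> b))"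
      using fin notin by (simp add: G_def B0)
  qed
  also have "\<dots> = (\<Sum>\<pi> | \<pi> permutes (Basis :: 'e set). of_int (sign (map_permutation Basis \<iota> \<pi>)) * (\<Prod>b\<in>A. G b (map_permutation Basis \<iota> \<pi> b)))"
  proof (rule sum.reindex_bij_witness[of _ "map_permutation Basis \<iota>" "map_permutation A snd"])
    have s: "snd (\<iota> b) = b" for b unfolding \<iota>_def by simp
    have bij2: "bij_betw snd A Basis" unfolding A_def bij_betw_def image_image s inj_on_def by (auto simp: s)
    show "map_permutation A snd \<pi> \<in> {\<pi>. \<pi> permutes Basis}" if "\<pi> \<in> {\<pi>. \<pi> permutes A}" for \<pi>
      using that map_permutation_permutes[OF bij2] by auto
    show "map_permutation Basis \<iota> \<pi> \<in> {\<pi>. \<pi> permutes A}" if "\<pi> \<in> {\<pi>. \<pi> permutes Basis}" for \<pi>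
      using that map_permutation_permutes[OF bij] by auto
    show "map_permutation A snd (map_permutation Basis \<iota> \<pi>) = \<pi>" if "\<pi> \<in> {\<pi>. \<pi> permutes Basis}" for \<pi>
      using that by (intro map_permutation_compose_inv[OF bij]) (auto simp: s)
    have "\<iota> (snd x) = x" if "x \<in> A" for x using that unfolding A_def by (auto simp: s)
    then show r: "map_permutation Basis \<iota> (map_permutation A snd \<pi>) = \<pi>" if "\<pi> \<in> {\<pi>. \<pi> permutes A}" for \<pi>
      using that by (intro map_permutation_compose_inv[OF bij2]) auto
    show "of_int (sign (map_permutation Basis \<iota> (map_permutation A snd \<pi>))) * (\<Prod>b\<in>A. G b (map_permutation Basis \<iota> (map_permutation A snd \<pi>) b)) =
         of_int (sign \<pi>) * (\<Prod>b\<in>A. G b (\<pi> b))" if "\<pi> \<in> {\<pi>. \<pi> permutes A}" for \<pi>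
      unfolding r[OF that] ..
  qed
  also have "\<dots> = (\<Sum>\<pi> | \<pi> permutes (Basis :: 'e set). of_int (sign \<pi>) * (\<Prod>b\<in>Basis. B b (\<pi> b)))"
  proof (rule sum.cong[OF refl])
    fix \<pi> assume "\<pi> \<in> {\<pi>. \<pi> permutes (Basis :: 'e set)}"
    then have \<pi>: "\<pi> permutes Basis" by simp
    have "(\<Prod>b\<in>A. G b (map_permutation Basis \<iota> \<pi> b)) = (\<Prod>b\<in>Basis. G (\<iota> b) (map_permutation Basis \<iota> \<pi> (\<iota> b)))"
      unfolding A_def by (simp add: prod.reindex[OF inj])
    also have "\<dots> = (\<Prod>b\<in>Basis. B b (\<pi> b))"
    proof (rule prod.cong[OF refl])
      fix b :: 'e assume b: "b \<in> Basis"
      show "G (\<iota> b) (map_permutation Basis \<iota> \<pi> (\<iota> b)) = B b (\<pi> b)"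
        unfolding map_permutation_apply[OF inj b] by (simp add: G_def \<iota>_def)
    qed
    finally show "of_int (sign (map_permutation Basis \<iota> \<pi>)) * (\<Prod>b\<in>A. G b (map_permutation Basis \<iota> \<pi> b)) = of_int (sign \<pi>) * (\<Prod>b\<in>Basis. B b (\<pi> b))"
      by (simp add: sign_map_permutation[OF inj \<pi>])
  qed
  finally show ?thesis unfolding G_def gram_det_def .
qed

section \<open>Volume measures as products\<close>

lemma sets_restrict_pair:
  fixes X :: "real set"
  shows "sets (restrict_space borel X \<Otimes>\<^sub>M (borel :: 'k::second_countable_topology measure)) = sets (restrict_space borel (X \<times> UNIV))"
proof (rule antisym)
  let ?R = "restrict_space borel (X \<times> (UNIV :: 'k set))"
  have "A \<times> B \<in> sets ?R" if A: "A \<in> sets (restrict_space borel X)" and B: "B \<in> sets borel" for A B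
  proof -
    obtain A' where A': "A' \<in> sets borel" "A = X \<inter> A'" using A by (auto simp: sets_restrict_space)
    have "A' \<times> B \<in> sets borel" unfolding borel_prod[symmetric] using A'(1) B by (rule pair_measureI)
    moreover have "A \<times> B = (X \<times> UNIV) \<inter> (A' \<times> B)" using A' by auto
    ultimately show ?thesis unfolding sets_restrict_space by (intro image_eqI)
  qed
  then show "sets (restrict_space borel X \<Otimes>\<^sub>M borel) \<subseteq> sets ?R"
    by (intro sets_pair_in_sets) auto
  let ?P = "restrict_space borel X \<Otimes>\<^sub>M (borel :: 'k measure)"
  have "(\<lambda>z. (fst z, snd z)) \<in> measurable ?P (borel \<Otimes>\<^sub>M borel)"
    by (intro measurable_Pair measurable_compose[OF measurable_fst] measurable_snd measurable_restrict_space1) auto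
  then have id: "(\<lambda>z. z) \<in> measurable ?P borel" by (simp add: borel_prod)
  show "sets ?R \<subseteq> sets ?P"
  proof
    fix S assume "S \<in> sets ?R"
    then obtain S' where S': "S' \<in> sets borel" "S = (X \<times> UNIV) \<inter> S'" by (auto simp: sets_restrict_space)
    have "(\<lambda>z. z) -` S' \<inter> space ?P \<in> sets ?P" by (rule measurable_sets[OF id S'(1)])
    then show "S \<in> sets ?P" using S'(2) by (simp add: space_pair_measure space_restrict_space Int_commute)
  qed
qed

locale closed_manifold =
  fixes K :: "('i, 'k::{second_countable_topology, t2_space}, 'e::euclidean_space) riem"
  assumes K: "closed_riemannian_manifold K"
begin

lemma compact_K: "compact (UNIV :: 'k set)" and points_K: "points K = UNIV"
  and chart_open: "i \<in> index K \<Longrightarrow> open (chart_dom K i)"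
  and range_open: "i \<in> index K \<Longrightarrow> open (coord_range K i)"
  and chart_homeo: "i \<in> index K \<Longrightarrow> homeomorphism (chart_dom K i) (coord_range K i) (coord K i) (param K i)"
  and transition_smooth: "i \<in> index K \<Longrightarrow> j \<in> index K \<Longrightarrow> smooth_on (coord K i ` (chart_dom K i \<inter> chart_dom K j)) (transition K i j)"
  and metric_bilinear: "i \<in> index K \<Longrightarrow> z \<in> coord_range K i \<Longrightarrow> bilinear (metric K i z)"
  and metric_sym: "i \<in> index K \<Longrightarrow> z \<in> coord_range K i \<Longrightarrow> metric K i z v w = metric K i z w v"
  and metric_pos: "i \<in> index K \<Longrightarrow> z \<in> coord_range K i \<Longrightarrow> v \<noteq> 0 \<Longrightarrow> metric K i z v v > 0"
  and metric_smooth: "i \<in> index K \<Longrightarrow> smooth_on (coord_range K i) (\<lambda>z. metric K i z v w)"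
  and metric_transition: "i \<in> index K \<Longrightarrow> j \<in> index K \<Longrightarrow> z \<in> coord K i ` (chart_dom K i \<inter> chart_dom K j) \<Longrightarrow>
        metric K i z v w = metric K j (transition K i j z)
          (frechet_derivative (transition K i j) (at z) v) (frechet_derivative (transition K i j) (at z) w)"
  using K unfolding closed_riemannian_manifold_def by blast+

lemma coord_in: "i \<in> index K \<Longrightarrow> p \<in> chart_dom K i \<Longrightarrow> coord K i p \<in> coord_range K i"
  unfolding coord_range_def by blast

lemma param_coord: "i \<in> index K \<Longrightarrow> p \<in> chart_dom K i \<Longrightarrow> param K i (coord K i p) = p"
  using homeomorphism_apply1[OF chart_homeo] by blast

lemma coord_param: "i \<in> index K \<Longrightarrow> z \<in> coord_range K i \<Longrightarrow> coord K i (param K i z) = z"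
  using homeomorphism_apply2[OF chart_homeo] by blast

lemma param_in: "i \<in> index K \<Longrightarrow> z \<in> coord_range K i \<Longrightarrow> param K i z \<in> chart_dom K i"
  using homeomorphism_image2[OF chart_homeo] by blast

lemma param_cont: "i \<in> index K \<Longrightarrow> continuous_on (coord_range K i) (param K i)"
  and coord_cont: "i \<in> index K \<Longrightarrow> continuous_on (chart_dom K i) (coord K i)"
  using chart_homeo unfolding homeomorphism_def by blast+

lemma exists_chart: obtains i where "i \<in> index K" "p \<in> chart_dom K i"
  using points_K unfolding points_def by blast

lemma metric_cont: "i \<in> index K \<Longrightarrow> continuous_on (coord_range K i) (\<lambda>z. metric K i z v w)"
  using Ck_on_imp_continuous smooth_on_imp_Ck metric_smooth by blast

lemma gram_det_cont: "i \<in> index K \<Longrightarrow> continuous_on (coord_range K i) (\<lambda>z. gram_det (metric K i z))"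
  unfolding gram_det_def by (intro continuous_intros metric_cont)

lemma coord_image_borel:
  assumes i: "i \<in> index K" and B: "B \<in> sets borel" "B \<subseteq> chart_dom K i"
  shows "coord K i ` B \<in> sets borel"
proof -
  have "coord K i ` B = param K i -` B \<inter> coord_range K i"
    using B(2) i by (auto simp: param_coord coord_in) (metis coord_param imageI)
  moreover have "param K i -` B \<inter> space (restrict_space borel (coord_range K i)) \<in> sets (restrict_space borel (coord_range K i))"
    by (rule measurable_sets[OF borel_measurable_continuous_on_restrict[OF param_cont[OF i]] B(1)])
  ultimately show ?thesis using range_open[OF i]
    by (simp add: space_restrict_space sets_restrict_space_iff)
qed

lemma density_borel:
  assumes i: "i \<in> index K" and B: "B \<in> sets borel" "B \<subseteq> chart_dom K i"
  shows "(\<lambda>z. ennreal (sqrt (gram_det (metric K i z))) * indicator (coord K i ` B) z) \<in> borel_measurable borel"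
proof -
  have sub: "coord K i ` B \<subseteq> coord_range K i" using B(2) unfolding coord_range_def by blast
  have "(\<lambda>z. indicator (coord K i ` B) z *\<^sub>R sqrt (gram_det (metric K i z))) \<in> borel_measurable borel"
    by (intro borel_measurable_continuous_on_indicator coord_image_borel[OF i B] continuous_intros
        continuous_on_subset[OF gram_det_cont[OF i] sub])
  then have "(\<lambda>z. ennreal (indicator (coord K i ` B) z *\<^sub>R sqrt (gram_det (metric K i z)))) \<in> borel_measurable borel"
    by measurable
  moreover have "ennreal (indicator (coord K i ` B) z *\<^sub>R sqrt (gram_det (metric K i z))) = ennreal (sqrt (gram_det (metric K i z))) * indicator (coord K i ` B) z" for z
    by (auto simp: indicator_def)
  ultimately show ?thesis by simp
qed

lemma finite_charts: obtains I where "finite I" "I \<subseteq> index K" "(\<Union>i\<in>I. chart_dom K i) = UNIV"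
proof -
  have "\<exists>I\<subseteq>index K. finite I \<and> UNIV \<subseteq> (\<Union>i\<in>I. chart_dom K i)"
    using compact_K chart_open points_K unfolding points_def by (metis compactE_image subset_UNIV order_refl)
  then show ?thesis using that by blast
qed

end

locale riemannian_measure = closed_manifold +
  fixes V
  assumes V: "riemannian_volume K V"
begin

lemma sets_V[measurable_cong]: "sets V = sets borel"
  using V unfolding riemannian_volume_def points_K by (simp add: sets_restrict_space)

lemma space_V: "space V = UNIV" using sets_eq_imp_space_eq[OF sets_V] by simp

lemma emeasure_V: "i \<in> index K \<Longrightarrow> B \<in> sets borel \<Longrightarrow> B \<subseteq> chart_dom K i \<Longrightarrow>
   emeasure V B = (\<integral>\<^sup>+z. ennreal (sqrt (gram_det (metric K i z))) * indicator (coord K i ` B) z \<partial>lborel)"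
  using V sets_V unfolding riemannian_volume_def by blast

text \<open>Each point has a neighbourhood that is the image of a small ball in a chart, where the density is bounded.\<close>

lemma finite_V: "finite_measure V"
proof
  have "\<exists>U. open U \<and> p \<in> U \<and> emeasure V U < \<infinity>" for p
  proof -
    obtain i where i: "i \<in> index K" "p \<in> chart_dom K i" by (rule exists_chart)
    obtain r where r: "r > 0" "cball (coord K i p) r \<subseteq> coord_range K i"
      using open_contains_cball range_open[OF i(1)] coord_in[OF i] by blast
    define U where "U = param K i ` ball (coord K i p) r"
    have sub: "ball (coord K i p) r \<subseteq> coord_range K i" using r(2) ball_subset_cball by blast
    have "openin (top_of_set (chart_dom K i)) U"
      unfolding U_def
      by (rule homeomorphism_imp_open_map[OF homeomorphism_symD[OF chart_homeo[OF i(1)]] open_subset[OF sub open_ball]])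
    then have U: "open U" "U \<subseteq> chart_dom K i" using chart_open[OF i(1)] openin_open_eq by auto
    have cU: "coord K i ` U = ball (coord K i p) r"
      unfolding U_def image_image using sub i(1) by (auto simp: coord_param image_iff subset_iff)
    have "p \<in> U" unfolding U_def using r(1) param_coord[OF i] by (metis centre_in_ball imageI)
    have "continuous_on (cball (coord K i p) r) (\<lambda>z. sqrt (gram_det (metric K i z)))"
      by (intro continuous_intros continuous_on_subset[OF gram_det_cont[OF i(1)] r(2)])
    then have "bounded ((\<lambda>z. sqrt (gram_det (metric K i z))) ` cball (coord K i p) r)"
      by (intro compact_imp_bounded compact_continuous_image) auto
    then obtain C where "\<forall>y\<in>(\<lambda>z. sqrt (gram_det (metric K i z))) ` cball (coord K i p) r. norm y \<le> C"
      unfolding bounded_iff by blast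
    then have C: "\<bar>sqrt (gram_det (metric K i z))\<bar> \<le> C" if "z \<in> cball (coord K i p) r" for z
      using that by simp
    have "emeasure V U = (\<integral>\<^sup>+z. ennreal (sqrt (gram_det (metric K i z))) * indicator (ball (coord K i p) r) z \<partial>lborel)"
      using emeasure_V[OF i(1) _ U(2)] U(1) unfolding cU by simp
    also have "\<dots> \<le> (\<integral>\<^sup>+z. ennreal C * indicator (ball (coord K i p) r) z \<partial>lborel)"
    proof (rule nn_integral_mono)
      fix z
      have "sqrt (gram_det (metric K i z)) \<le> C" if "z \<in> ball (coord K i p) r"
        using C[of z] that ball_subset_cball[of "coord K i p" r] by (auto simp: subset_iff)
      then show "ennreal (sqrt (gram_det (metric K i z))) * indicator (ball (coord K i p) r) z \<le> ennreal C * indicator (ball (coord K i p) r) z"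
        by (auto simp: indicator_def intro: ennreal_leI)
    qed
    also have "\<dots> = ennreal C * emeasure lborel (ball (coord K i p) r)" by (rule nn_integral_cmult_indicator) simp
    also have "\<dots> < \<infinity>" using emeasure_bounded_finite[of "ball (coord K i p) r"] by (simp add: ennreal_mult_less_top)
    finally show ?thesis using U(1) \<open>p \<in> U\<close> by blast
  qed
  then obtain U where U: "\<And>p. open (U p) \<and> p \<in> U p \<and> emeasure V (U p) < \<infinity>" by metis
  obtain D where D: "finite D" "UNIV \<subseteq> (\<Union>p\<in>D. U p)"
    using compactE_image[OF compact_K, of UNIV U] U by (metis UNIV_I UN_I subsetI)
  have "emeasure V UNIV \<le> emeasure V (\<Union>p\<in>D. U p)"
    using D U by (intro emeasure_mono) (auto simp: sets_V)
  also have "\<dots> \<le> (\<Sum>p\<in>D. emeasure V (U p))"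
    using D U by (intro emeasure_subadditive_finite) (auto simp: sets_V)
  also have "\<dots> < \<infinity>" using D U by (simp add: less_top[symmetric])
  finally show "emeasure V (space V) \<noteq> \<infinity>" by (simp add: space_V)
qed

text \<open>The Riemannian volumes are prescribed on subsets of charts only. A Borel set of \<open>K\<close> is a finite disjoint
union of such subsets, and rectangles determine a product of finite measures.\<close>

lemma product_measure_eq:
  fixes X :: "real set"
  assumes \<nu>: "finite_measure \<nu>" "sets \<nu> = sets (restrict_space borel X)"
    and M: "sets M = sets (restrict_space borel (X \<times> UNIV))"
    and rect: "\<And>i A B. i \<in> index K \<Longrightarrow> A \<in> sets \<nu> \<Longrightarrow> B \<in> sets borel \<Longrightarrow> B \<subseteq> chart_dom K i \<Longrightarrow> emeasure M (A \<times> B) = emeasure \<nu> A * emeasure V B"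
  shows "\<nu> \<Otimes>\<^sub>M V = M"
proof (rule pair_measure_eqI)
  interpret n: finite_measure \<nu> by fact
  interpret v: finite_measure V by (rule finite_V)
  show "sigma_finite_measure \<nu>" "sigma_finite_measure V" by unfold_locales
  have s: "sets (\<nu> \<Otimes>\<^sub>M V) = sets (restrict_space borel X \<Otimes>\<^sub>M borel)"
    by (intro sets_pair_measure_cong \<nu>(2) sets_V)
  then show sM: "sets (\<nu> \<Otimes>\<^sub>M V) = sets M" unfolding M sets_restrict_pair .
  fix A B assume A: "A \<in> sets \<nu>" and B: "B \<in> sets V"
  obtain I where I: "finite I" "I \<subseteq> index K" "(\<Union>i\<in>I. chart_dom K i) = UNIV" by (rule finite_charts)
  have "emeasure M (A \<times> B) = emeasure \<nu> A * emeasure V B" if "B \<in> sets V" "B \<subseteq> (\<Union>i\<in>I. chart_dom K i)" for B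
    using I(1,2) that
  proof (induction I arbitrary: B rule: finite_induct)
    case empty
    then show ?case by simp
  next
    case (insert i I)
    define B1 B2 where "B1 = B \<inter> chart_dom K i" and "B2 = B - chart_dom K i"
    have m: "chart_dom K i \<in> sets V" using chart_open insert.prems by (auto simp: sets_V)
    have m2: "B1 \<in> sets V" "B2 \<in> sets V" unfolding B1_def B2_def using m insert.prems by auto
    have B: "B = B1 \<union> B2" "B1 \<inter> B2 = {}" unfolding B1_def B2_def by auto
    have AB: "A \<times> B1 \<in> sets M" "A \<times> B2 \<in> sets M" using m2 A sM by auto
    have "emeasure M (A \<times> B) = emeasure M (A \<times> B1) + emeasure M (A \<times> B2)"
    proof -
      have "A \<times> B1 \<inter> A \<times> B2 = {}" "A \<times> B = A \<times> B1 \<union> A \<times> B2" using B by blast+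
      then show ?thesis using plus_emeasure[OF AB] by simp
    qed
    also have "emeasure M (A \<times> B1) = emeasure \<nu> A * emeasure V B1"
      by (rule rect[of i]) (use A m2 insert.prems in \<open>auto simp: sets_V B1_def\<close>)
    also have "emeasure M (A \<times> B2) = emeasure \<nu> A * emeasure V B2"
      by (rule insert.IH) (use m2 insert.prems in \<open>auto simp: B2_def\<close>)
    also have "emeasure \<nu> A * emeasure V B1 + emeasure \<nu> A * emeasure V B2 = emeasure \<nu> A * emeasure V B"
      using plus_emeasure[OF m2 B(2)] B(1) by (simp add: distrib_left[symmetric])
    finally show ?case .
  qed
  from this[OF B] I(3) show "emeasure \<nu> A * emeasure V B = emeasure M (A \<times> B)" by simp
qed

end

locale warped_measure = riemannian_measure K V
  for K :: "('i, 'k::{second_countable_topology, t2_space}, 'e::euclidean_space) riem" and V +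
  fixes f :: "real \<Rightarrow> real" and n :: nat and M \<sigma> :: "(real \<times> 'k) measure"
  assumes f_cont: "continuous_on {0..1} f" and f_pos: "\<And>x. x \<in> {0..1} \<Longrightarrow> f x > 0"
    and n: "n = Suc (DIM('e))"
    and M: "riemannian_volume (warped_product f K) M"
    and \<sigma>: "riemannian_volume (warped_boundary f K) \<sigma>"
begin

text \<open>The factors on the unit interval of the volumes of the product and of its boundary. They are carried by
\<open>[0,1]\<close> and \<open>{0, 1}\<close> as spaces, to match the volumes, which are measures on the points of the manifolds only.\<close>

definition radial_measure :: "real measure" where
  "radial_measure = density (restrict_space lborel {0..1}) (\<lambda>x. ennreal (vol_weight n f x))"

definition end_measure :: "real measure" where
  "end_measure = density (count_space {0, 1}) (\<lambda>x. ennreal (sqrt (f x ^ DIM('e))))"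

lemma sets_radial: "sets radial_measure = sets (restrict_space borel {0..1})"
  unfolding radial_measure_def by (simp add: sets_restrict_space)

lemma space_radial: "space radial_measure = {0..1}"
  unfolding radial_measure_def by (simp add: space_restrict_space)

lemma sets_end: "sets end_measure = sets (restrict_space borel {0, 1})"
proof -
  have "A \<in> sets (restrict_space borel {0, 1})" if "A \<subseteq> {0, 1::real}" for A
  proof -
    have "finite A" using that finite_subset by blast
    then show ?thesis using that by (simp add: sets_restrict_space_iff borel_closed finite_imp_closed)
  qed
  moreover have "A \<subseteq> {0, 1}" if "A \<in> sets (restrict_space borel {0, 1::real})" for A
    using sets.sets_into_space[OF that] by (simp add: space_restrict_space)
  ultimately show ?thesis unfolding end_measure_def by auto
qed

lemma vol_weight_cont: "continuous_on {0..1} (vol_weight n f)"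
  unfolding vol_weight_def by (intro continuous_intros f_cont)

lemma vol_weight_pos: "x \<in> {0..1} \<Longrightarrow> vol_weight n f x > 0"
  unfolding vol_weight_def using f_pos by simp

lemma vol_weight_measurable: "(\<lambda>x. vol_weight n f x) \<in> borel_measurable (restrict_space lborel {0..1})"
  using borel_measurable_continuous_on_restrict[OF vol_weight_cont]
  by (simp cong: measurable_cong_sets)

lemma emeasure_radial:
  assumes "A \<in> sets radial_measure"
  shows "emeasure radial_measure A = (\<integral>\<^sup>+x. ennreal (vol_weight n f x) * indicator A x \<partial>lborel)"
proof -
  have A: "A \<in> sets (restrict_space lborel {0..1})" using assms unfolding sets_radial by (simp add: sets_restrict_space)
  have A2: "A \<subseteq> {0..1}" using sets.sets_into_space[OF assms] unfolding space_radial .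
  have "emeasure radial_measure A = (\<integral>\<^sup>+x. ennreal (vol_weight n f x) * indicator A x \<partial>restrict_space lborel {0..1})"
    unfolding radial_measure_def by (rule emeasure_density) (use A vol_weight_measurable in auto)
  also have "\<dots> = (\<integral>\<^sup>+x. ennreal (vol_weight n f x) * indicator A x * indicator {0..1} x \<partial>lborel)"
    by (rule nn_integral_restrict_space) simp
  also have "\<dots> = (\<integral>\<^sup>+x. ennreal (vol_weight n f x) * indicator A x \<partial>lborel)"
    by (rule nn_integral_cong) (use A2 in \<open>auto simp: indicator_def\<close>)
  finally show ?thesis .
qed

lemma finite_radial: "finite_measure radial_measure"
proof
  obtain C where C: "C > 0" "\<And>x. x \<in> {0..1} \<Longrightarrow> \<bar>vol_weight n f x\<bar> \<le> C"
    by (rule cont_bounded01[OF vol_weight_cont]) blast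
  have "emeasure radial_measure {0..1} = (\<integral>\<^sup>+x. ennreal (vol_weight n f x) * indicator {0..1} x \<partial>lborel)"
    by (rule emeasure_radial) (metis sets.top space_radial)
  also have "\<dots> \<le> (\<integral>\<^sup>+x. ennreal C * indicator {0..1::real} x \<partial>lborel)"
    by (rule nn_integral_mono) (use C(2) in \<open>force simp: indicator_def abs_le_iff intro!: ennreal_leI\<close>)
  also have "\<dots> = ennreal C * emeasure lborel {0..1::real}" by (rule nn_integral_cmult_indicator) simp
  also have "\<dots> < \<infinity>" by simp
  finally show "emeasure radial_measure (space radial_measure) \<noteq> \<infinity>" unfolding space_radial by simp
qed

lemma emeasure_end: "A \<subseteq> {0, 1} \<Longrightarrow> emeasure end_measure A = (\<Sum>x\<in>A. ennreal (sqrt (f x ^ DIM('e))))"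
  unfolding end_measure_def
  by (subst emeasure_density)
     (auto simp: nn_integral_count_space_finite indicator_def sum.If_cases Int_absorb1 intro!: sum.cong)

lemma finite_end: "finite_measure end_measure"
proof
  have "emeasure end_measure {0, 1} \<noteq> \<infinity>" by (subst emeasure_end) auto
  moreover have "space end_measure = {0, 1}" unfolding end_measure_def by simp
  ultimately show "emeasure end_measure (space end_measure) \<noteq> \<infinity>" by simp
qed

lemma points_W: "points (warped_product f K) = {0..1} \<times> UNIV"
proof -
  have "points (warped_product f K) = {0..1} \<times> points K"
    unfolding points_def warped_product_def by auto
  then show ?thesis unfolding points_K .
qed

lemma points_bdry: "points (warped_boundary f K) = {0, 1} \<times> UNIV"
proof -
  have "points (warped_boundary f K) = {0, 1} \<times> points K"
    unfolding points_def warped_boundary_def by auto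
  then show ?thesis unfolding points_K .
qed

lemma metric_zero: "i \<in> index K \<Longrightarrow> z \<in> coord_range K i \<Longrightarrow> metric K i z 0 w = 0"
  using bilinear_lzero[OF metric_bilinear] .

lemma gram_det_warped:
  assumes "i \<in> index K" "z \<in> coord_range K i"
  shows "gram_det (metric (warped_product f K) i (x, z)) = f x ^ n * gram_det (metric K i z)"
proof -
  have "metric (warped_product f K) i (x, z) = (\<lambda>v w. f x * (\<lambda>(a, v) (b, w). a * b + metric K i z v w) v w)"
    unfolding warped_product_def by (auto simp: fun_eq_iff)
  then have "gram_det (metric (warped_product f K) i (x, z)) = gram_det (\<lambda>v w. f x * (\<lambda>(a, v) (b, w). a * b + metric K i z v w) v w)"
    by (rule arg_cong)
  also have "\<dots> = f x ^ DIM(real \<times> 'e) * gram_det (\<lambda>(a, v) (b, w). a * b + metric K i z v w)"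
    by (rule gram_det_scale)
  also have "gram_det (\<lambda>(a, v) (b, w). a * b + metric K i z v w) = gram_det (metric K i z)"
    by (rule gram_det_product) (rule metric_zero[OF assms])
  finally show ?thesis by (simp add: n)
qed

lemma M_product: "radial_measure \<Otimes>\<^sub>M V = M"
proof (rule product_measure_eq[OF finite_radial sets_radial])
  show sM: "sets M = sets (restrict_space borel ({0..1} \<times> UNIV))"
    using M unfolding riemannian_volume_def points_W by blast
  fix i A B assume i: "i \<in> index K" and A: "A \<in> sets radial_measure" and B: "B \<in> sets borel" "B \<subseteq> chart_dom K i"
  let ?W = "warped_product f K"
  have A2: "A \<subseteq> {0..1}" using sets.sets_into_space[OF A] unfolding space_radial .
  have A3: "A \<in> sets borel" using A unfolding sets_radial by (subst (asm) sets_restrict_space_iff) auto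
  have AB: "A \<times> B \<in> sets M" unfolding sM sets_restrict_pair[symmetric]
    using A B unfolding sets_radial by (intro pair_measureI) auto
  have sub: "A \<times> B \<subseteq> chart_dom ?W i" using A2 B(2) unfolding warped_product_def by auto
  have im: "coord ?W i ` (A \<times> B) = A \<times> coord K i ` B"
    unfolding warped_product_def by (auto simp: image_iff)
  define g1 where "g1 x = ennreal (vol_weight n f x) * indicator A x" for x
  define g2 where "g2 z = ennreal (sqrt (gram_det (metric K i z))) * indicator (coord K i ` B) z" for z
  have "(\<lambda>x. indicator A x *\<^sub>R vol_weight n f x) \<in> borel_measurable borel"
    by (intro borel_measurable_continuous_on_indicator A3 continuous_on_subset[OF vol_weight_cont A2])
  then have "(\<lambda>x. ennreal (indicator A x *\<^sub>R vol_weight n f x)) \<in> borel_measurable borel" by measurable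
  moreover have "ennreal (indicator A x *\<^sub>R vol_weight n f x) = g1 x" for x
    unfolding g1_def by (auto simp: indicator_def)
  ultimately have g1[measurable]: "g1 \<in> borel_measurable lborel" by simp
  have g2[measurable]: "g2 \<in> borel_measurable lborel"
    unfolding g2_def using density_borel[OF i B] by simp
  have iW: "i \<in> index ?W" using i unfolding warped_product_def by simp
  have "emeasure M (A \<times> B) = (\<integral>\<^sup>+z. ennreal (sqrt (gram_det (metric ?W i z))) * indicator (coord ?W i ` (A \<times> B)) z \<partial>lborel)"
    using M iW AB sub unfolding riemannian_volume_def by blast
  also have "\<dots> = (\<integral>\<^sup>+z. ennreal (sqrt (gram_det (metric ?W i z))) * indicator (A \<times> coord K i ` B) z \<partial>lborel)"
    unfolding im ..
  also have "\<dots> = (\<integral>\<^sup>+z. g1 (fst z) * g2 (snd z) \<partial>lborel)"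
  proof (rule nn_integral_cong)
    fix z :: "real \<times> 'e"
    obtain x y where z: "z = (x, y)" by (cases z)
    show "ennreal (sqrt (gram_det (metric ?W i z))) * indicator (A \<times> coord K i ` B) z = g1 (fst z) * g2 (snd z)"
    proof (cases "x \<in> A \<and> y \<in> coord K i ` B")
      case True
      then have y: "y \<in> coord_range K i" using B(2) unfolding coord_range_def by blast
      have "vol_weight n f x \<ge> 0" using vol_weight_pos A2 True by (intro less_imp_le) auto
      then show ?thesis using True unfolding z g1_def g2_def
        by (simp add: gram_det_warped[OF i y] real_sqrt_mult vol_weight_def ennreal_mult')
    qed (auto simp: z g1_def g2_def)
  qed
  also have "\<dots> = (\<integral>\<^sup>+x. \<integral>\<^sup>+y. g1 x * g2 y \<partial>lborel \<partial>lborel)"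
    unfolding lborel_prod[symmetric] by (subst lborel.nn_integral_fst[symmetric]) auto
  also have "\<dots> = (\<integral>\<^sup>+x. g1 x \<partial>lborel) * (\<integral>\<^sup>+y. g2 y \<partial>lborel)"
    by (simp add: nn_integral_cmult nn_integral_multc)
  also have "(\<integral>\<^sup>+x. g1 x \<partial>lborel) = emeasure radial_measure A" unfolding g1_def emeasure_radial[OF A] ..
  also have "(\<integral>\<^sup>+y. g2 y \<partial>lborel) = emeasure V B" unfolding g2_def emeasure_V[OF i B] ..
  finally show "emeasure M (A \<times> B) = emeasure radial_measure A * emeasure V B" .
qed

lemma bdry_product: "end_measure \<Otimes>\<^sub>M V = \<sigma>"
proof (rule product_measure_eq[OF finite_end sets_end])
  show s\<sigma>: "sets \<sigma> = sets (restrict_space borel ({0, 1} \<times> UNIV))"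
    using \<sigma> unfolding riemannian_volume_def points_bdry by blast
  fix i A B assume i: "i \<in> index K" and A: "A \<in> sets end_measure" and B: "B \<in> sets borel" "B \<subseteq> chart_dom K i"
  let ?W = "warped_boundary f K"
  have A2: "A \<subseteq> {0, 1}" using A unfolding end_measure_def by simp
  have S: "{j} \<times> B \<in> sets \<sigma>" if "j \<in> A" for j
  proof -
    have "{j} \<in> sets (restrict_space borel {0, 1})"
      unfolding sets_end[symmetric] end_measure_def using that A2 by auto
    then show ?thesis unfolding s\<sigma> sets_restrict_pair[symmetric] using B by (intro pair_measureI)
  qed
  have j: "emeasure \<sigma> ({j} \<times> B) = ennreal (sqrt (f j ^ DIM('e))) * emeasure V B" if j: "j \<in> A" for j
  proof -
    have j01: "j \<in> {0, 1}" using j A2 by blast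
    have ji: "(j, i) \<in> index ?W" using j01 i unfolding warped_boundary_def by auto
    have sub: "{j} \<times> B \<subseteq> chart_dom ?W (j, i)" using B(2) unfolding warped_boundary_def by auto
    have im: "coord ?W (j, i) ` ({j} \<times> B) = coord K i ` B"
      unfolding warped_boundary_def by (auto simp: image_iff)
    have g: "gram_det (metric ?W (j, i) z) = f j ^ DIM('e) * gram_det (metric K i z)" for z
    proof -
      have "metric ?W (j, i) z = (\<lambda>v w. f j * metric K i z v w)"
        unfolding warped_boundary_def warped_product_def by (auto simp: fun_eq_iff)
      then show ?thesis by (simp add: gram_det_scale)
    qed
    have fj: "f j > 0" using j01 f_pos by auto
    have "emeasure \<sigma> ({j} \<times> B) = (\<integral>\<^sup>+z. ennreal (sqrt (gram_det (metric ?W (j, i) z))) * indicator (coord ?W (j, i) ` ({j} \<times> B)) z \<partial>lborel)"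
      using \<sigma> ji S[OF j] sub unfolding riemannian_volume_def by blast
    also have "\<dots> = (\<integral>\<^sup>+z. ennreal (sqrt (f j ^ DIM('e))) * (ennreal (sqrt (gram_det (metric K i z))) * indicator (coord K i ` B) z) \<partial>lborel)"
    proof -
      have "ennreal (sqrt (f j ^ DIM('e) * G)) = ennreal (sqrt (f j ^ DIM('e))) * ennreal (sqrt G)" for G
        unfolding real_sqrt_mult by (rule ennreal_mult') (use fj in simp)
      then show ?thesis unfolding im g by (simp only: mult.assoc)
    qed
    also have "\<dots> = ennreal (sqrt (f j ^ DIM('e))) * emeasure V B"
      unfolding emeasure_V[OF i B] by (rule nn_integral_cmult) (use density_borel[OF i B] in simp)
    finally show ?thesis .
  qed
  have fin: "finite A" using A2 finite_subset by blast
  have "emeasure \<sigma> (A \<times> B) = emeasure \<sigma> (\<Union>j\<in>A. {j} \<times> B)" by (rule arg_cong[where f = "emeasure \<sigma>"]) auto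
  also have "\<dots> = (\<Sum>j\<in>A. emeasure \<sigma> ({j} \<times> B))"
    by (rule sum_emeasure[symmetric]) (use S fin in \<open>auto simp: disjoint_family_on_def\<close>)
  also have "\<dots> = (\<Sum>j\<in>A. ennreal (sqrt (f j ^ DIM('e))) * emeasure V B)" by (rule sum.cong) (auto simp: j)
  also have "\<dots> = emeasure end_measure A * emeasure V B" unfolding emeasure_end[OF A2] by (simp add: sum_distrib_right)
  finally show "emeasure \<sigma> (A \<times> B) = emeasure end_measure A * emeasure V B" .
qed

end

section \<open>Differential calculus on products with the unit interval\<close>

text \<open>A condition under which derivatives within a set are unique. It holds for open sets and, with one-sided
increments, for their products with \<open>[0,1]\<close>.\<close>

definition unique_derivatives :: "'a::euclidean_space set \<Rightarrow> bool" where
  "unique_derivatives S \<longleftrightarrow> (\<forall>z\<in>S. \<forall>b\<in>Basis. \<forall>e>0. \<exists>d. 0 < \<bar>d\<bar> \<and> \<bar>d\<bar> < e \<and> z + d *\<^sub>R b \<in> S)"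

lemma unique_derivatives_open: assumes "open U" shows "unique_derivatives U"
  unfolding unique_derivatives_def
proof (intro ballI allI impI)
  fix z b :: 'a and e :: real assume z: "z \<in> U" and b: "b \<in> Basis" and e: "e > 0"
  obtain r where r: "r > 0" "ball z r \<subseteq> U" using assms z open_contains_ball by blast
  have "z + (min e r / 2) *\<^sub>R b \<in> ball z r" using r(1) e b by (simp add: dist_norm)
  then show "\<exists>d. 0 < \<bar>d\<bar> \<and> \<bar>d\<bar> < e \<and> z + d *\<^sub>R b \<in> U"
    using r e by (intro exI[of _ "min e r / 2"]) auto
qed

lemma unique_derivatives_strip: assumes "open U" shows "unique_derivatives ({0..1::real} \<times> (U :: 'e::euclidean_space set))"
  unfolding unique_derivatives_def
proof (intro ballI allI impI)
  fix q b :: "real \<times> 'e" and e :: real assume q: "q \<in> {0..1} \<times> U" and b: "b \<in> Basis" and e: "e > 0"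
  obtain x z where xz: "q = (x, z)" "x \<in> {0..1}" "z \<in> U" using q by blast
  show "\<exists>d. 0 < \<bar>d\<bar> \<and> \<bar>d\<bar> < e \<and> q + d *\<^sub>R b \<in> {0..1} \<times> U"
  proof (cases "b = (1, 0)")
    case True
    then show ?thesis
      using xz e by (intro exI[of _ "if x \<le> 1 / 2 then min e 1 / 4 else - (min e 1 / 4)"]) auto
  next
    case False
    then obtain c where c: "b = (0, c)" "c \<in> Basis" using b by (auto simp: Basis_prod_def)
    obtain d where "0 < \<bar>d\<bar>" "\<bar>d\<bar> < e" "z + d *\<^sub>R c \<in> U"
      using unique_derivatives_open[OF assms] xz c e unfolding unique_derivatives_def by blast
    then show ?thesis using c xz by auto
  qed
qed

lemma frechet_derivative_within_eq:
  assumes "unique_derivatives S" "z \<in> S" "(f has_derivative F) (at z within S)"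
  shows "frechet_derivative f (at z within S) = F"
proof (rule frechet_derivative_unique_within[OF _ assms(3)])
  show "(f has_derivative frechet_derivative f (at z within S)) (at z within S)"
    using assms(3) frechet_derivative_works unfolding differentiable_def by blast
qed (use assms in \<open>auto simp: unique_derivatives_def\<close>)

lemma Ck_on_has_derivative:
  assumes "Ck_on (Suc k) S f" "z \<in> S"
  shows "(f has_derivative frechet_derivative f (at z within S)) (at z within S)"
  using assms by (simp add: differentiable_on_def frechet_derivative_works)

lemma Ck_on_add:
  assumes "unique_derivatives S" "Ck_on k S f" "Ck_on k S g"
  shows "Ck_on k S (\<lambda>z. f z + g z)"
  using assms(2,3)
proof (induction k arbitrary: f g)
  case 0
  then show ?case by (simp add: continuous_on_add)
next
  case (Suc k)
  have d: "((\<lambda>z. f z + g z) has_derivative (\<lambda>v. frechet_derivative f (at z within S) v + frechet_derivative g (at z within S) v)) (at z within S)"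
    if "z \<in> S" for z
    by (rule has_derivative_add[OF Ck_on_has_derivative[OF Suc.prems(1) that] Ck_on_has_derivative[OF Suc.prems(2) that]])
  have "Ck_on k S (\<lambda>z. frechet_derivative (\<lambda>z. f z + g z) (at z within S) v)" for v
  proof -
    have "Ck_on k S (\<lambda>z. frechet_derivative f (at z within S) v + frechet_derivative g (at z within S) v)"
      using Suc.prems by (intro Suc.IH) auto
    then show ?thesis
      by (rule Ck_on_cong[THEN iffD1, rotated]) (simp add: frechet_derivative_within_eq[OF assms(1) _ d])
  qed
  then show ?case using d unfolding Ck_on.simps differentiable_on_def differentiable_def by blast
qed

lemma Ck_on_linear:
  assumes "bounded_linear L" "unique_derivatives S" "Ck_on k S f"
  shows "Ck_on k S (\<lambda>z. L (f z))"
  using assms(3)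
proof (induction k arbitrary: f)
  case 0
  then show ?case using bounded_linear.continuous_on[OF assms(1)] by simp
next
  case (Suc k)
  have d: "((\<lambda>z. L (f z)) has_derivative (\<lambda>v. L (frechet_derivative f (at z within S) v))) (at z within S)"
    if "z \<in> S" for z
    by (rule bounded_linear.has_derivative[OF assms(1) Ck_on_has_derivative[OF Suc.prems that]])
  have "Ck_on k S (\<lambda>z. frechet_derivative (\<lambda>z. L (f z)) (at z within S) v)" for v
  proof -
    have "Ck_on k S (\<lambda>z. L (frechet_derivative f (at z within S) v))"
      using Suc.prems by (intro Suc.IH) auto
    then show ?thesis
      by (rule Ck_on_cong[THEN iffD1, rotated]) (simp add: frechet_derivative_within_eq[OF assms(2) _ d])
  qed
  then show ?case using d unfolding Ck_on.simps differentiable_on_def differentiable_def by blast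
qed

text \<open>The derivative of such a product is a sum of two products of the same kind, so induction on \<open>k\<close> applies.\<close>

lemma Ck_on_poly_tensor:
  fixes U :: "'e::euclidean_space set" and g :: "'e \<Rightarrow> 'b::real_normed_vector"
  assumes U: "open U" and g: "Ck_on k U g"
  shows "Ck_on k ({0..1} \<times> U) (\<lambda>(x, z). poly P x *\<^sub>R g z)"
  using g
proof (induction k arbitrary: g P)
  case 0
  have "continuous_on ({0..1} \<times> U) (\<lambda>q. g (snd q))"
    by (rule continuous_on_compose2[of U g]) (use 0 in \<open>auto intro!: continuous_intros\<close>)
  then show ?case by (auto simp: case_prod_beta' intro!: continuous_intros)
next
  case (Suc k)
  note u = unique_derivatives_strip[OF U]
  let ?D = "\<lambda>x z (a, v). poly (smult a (pderiv P)) x *\<^sub>R g z + poly P x *\<^sub>R frechet_derivative g (at z within U) v"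
  have d: "((\<lambda>(x, z). poly P x *\<^sub>R g z) has_derivative ?D x z) (at (x, z) within {0..1} \<times> U)"
    if xz: "x \<in> {0..1}" "z \<in> U" for x z
  proof -
    have g1: "(g has_derivative frechet_derivative g (at z within U)) (at z within U)"
      by (rule Ck_on_has_derivative[OF Suc.prems xz(2)])
    have im: "snd ` ({0..1::real} \<times> U) = U" by force
    have "((\<lambda>q. g (snd q)) has_derivative (\<lambda>v. frechet_derivative g (at z within U) (snd v))) (at (x, z) within {0..1} \<times> U)"
      by (rule has_derivative_in_compose[where f = snd and g = g, of snd]) (use g1 im in \<open>auto intro!: derivative_eq_intros\<close>)
    moreover have "((\<lambda>q. poly P (fst q)) has_derivative (\<lambda>v. poly (pderiv P) x * fst v)) (at (x, z) within {0..1} \<times> U)"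
    proof -
      have "(poly P has_derivative (*) (poly (pderiv P) x)) (at (fst (x, z)))"
        using poly_DERIV[of P x] by (simp add: has_field_derivative_def)
      from has_derivative_compose[OF bounded_linear_imp_has_derivative[OF bounded_linear_fst] this]
      show ?thesis .
    qed
    ultimately show ?thesis
      by (auto simp: case_prod_beta' intro!: derivative_eq_intros)
  qed
  have "Ck_on k ({0..1} \<times> U) (\<lambda>q. frechet_derivative (\<lambda>(x, z). poly P x *\<^sub>R g z) (at q within {0..1} \<times> U) v)" for v
  proof -
    obtain a w where v: "v = (a, w)" by (cases v)
    have "Ck_on k ({0..1} \<times> U) (\<lambda>q. (\<lambda>(x, z). poly (smult a (pderiv P)) x *\<^sub>R g z) q + (\<lambda>(x, z). poly P x *\<^sub>R frechet_derivative g (at z within U) w) q)"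
      using Suc.prems Ck_on_decrease[OF Suc.prems] by (intro Ck_on_add u Suc.IH) auto
    then show ?thesis
      by (rule Ck_on_cong[THEN iffD1, rotated]) (use v frechet_derivative_within_eq[OF u _ d] in auto)
  qed
  moreover have "(\<lambda>(x, z). poly P x *\<^sub>R g z) differentiable_on {0..1} \<times> U"
    using d unfolding differentiable_on_def differentiable_def by blast
  ultimately show ?case by simp
qed

lemma has_derivative_slice:
  assumes "(r has_derivative F) (at (x, z) within {0..1} \<times> U)" "x \<in> {0..1::real}"
  shows "((\<lambda>y. r (x, y)) has_derivative (\<lambda>w. F (0, w))) (at z within U)"
proof -
  have "((\<lambda>y. (x, y)) has_derivative (\<lambda>w. (0, w))) (at z within U)"
    by (auto intro!: derivative_eq_intros)
  moreover have "(r has_derivative F) (at (x, z) within (\<lambda>y. (x, y)) ` U)"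
    by (rule has_derivative_subset[OF assms(1)]) (use assms(2) in auto)
  ultimately show ?thesis by (rule has_derivative_in_compose)
qed

lemma has_vector_derivative_slice:
  assumes "(r has_derivative F) (at (x, z) within {0..1} \<times> U)" "z \<in> U"
  shows "((\<lambda>t. r (t, z)) has_vector_derivative F (1, 0)) (at x within {0..1::real})"
proof -
  have "((\<lambda>t. (t, z)) has_derivative (\<lambda>h. (h, 0))) (at x within {0..1})"
    by (auto intro!: derivative_eq_intros)
  moreover have "(r has_derivative F) (at (x, z) within (\<lambda>t. (t, z)) ` {0..1})"
    by (rule has_derivative_subset[OF assms(1)]) (use assms(2) in auto)
  ultimately have "((\<lambda>t. r (t, z)) has_derivative (\<lambda>h. F (h, 0))) (at x within {0..1})"
    by (rule has_derivative_in_compose)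
  moreover have "(\<lambda>h. F (h, 0)) = (\<lambda>h. h *\<^sub>R F (1, 0))"
  proof
    fix h
    have "F (h *\<^sub>R (1, 0)) = h *\<^sub>R F (1, 0)" by (rule linear_cmul[OF has_derivative_linear[OF assms(1)]])
    then show "F (h, 0) = h *\<^sub>R F (1, 0)" by (simp only: scaleR_Pair real_scaleR_def mult_1_right scaleR_zero_right)
  qed
  ultimately show ?thesis unfolding has_vector_derivative_def by (simp only:)
qed

lemma Ck_on_slice:
  assumes U: "open U" and x: "x \<in> {0..1::real}" and r: "Ck_on k ({0..1} \<times> U) r"
  shows "Ck_on k U (\<lambda>z. r (x, z))"
  using r
proof (induction k arbitrary: r)
  case 0
  have "continuous_on U (\<lambda>z. r (x, z))"
    by (rule continuous_on_compose2[of "{0..1} \<times> U" r]) (use 0 x in \<open>auto intro!: continuous_intros\<close>)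
  then show ?case by simp
next
  case (Suc k)
  have d: "((\<lambda>y. r (x, y)) has_derivative (\<lambda>w. frechet_derivative r (at (x, z) within {0..1} \<times> U) (0, w))) (at z within U)"
    if "z \<in> U" for z
    by (intro has_derivative_slice Ck_on_has_derivative[OF Suc.prems] x) (use x that in auto)
  have "Ck_on k U (\<lambda>z. frechet_derivative (\<lambda>z. r (x, z)) (at z within U) v)" for v
  proof -
    have "Ck_on k U (\<lambda>z. frechet_derivative r (at (x, z) within {0..1} \<times> U) (0, v))"
      using Suc.prems by (intro Suc.IH[of "\<lambda>q. frechet_derivative r (at q within {0..1} \<times> U) (0, v)"]) auto
    then show ?thesis
      by (rule Ck_on_cong[THEN iffD1, rotated]) (simp add: frechet_derivative_within_eq[OF unique_derivatives_open[OF U] _ d])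
  qed
  then show ?case using d unfolding Ck_on.simps differentiable_on_def differentiable_def by blast
qed

section \<open>Riesz vectors depending on a parameter\<close>

definition inner_form :: "('e::euclidean_space \<Rightarrow> 'e \<Rightarrow> real) \<Rightarrow> bool" where
  "inner_form g \<longleftrightarrow> bilinear g \<and> (\<forall>v w. g v w = g w v) \<and> (\<forall>v. v \<noteq> 0 \<longrightarrow> g v v > 0)"

lemma inner_form_eqI:
  assumes g: "inner_form g" and eq: "\<And>w. g v w = g v' w"
  shows "v = v'"
proof -
  have "g (v - v') (v - v') = g v (v - v') - g v' (v - v')"
    using g unfolding inner_form_def by (blast intro: bilinear_lsub)
  then have "g (v - v') (v - v') = 0" unfolding eq by simp
  then show ?thesis using g unfolding inner_form_def by (metis eq_iff_diff_eq_0 less_irrefl)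
qed

lemma inner_form_riesz:
  assumes g: "inner_form g" and L: "linear L"
  shows "\<exists>!v. \<forall>w. g v w = L w"
proof -
  have bil: "bilinear g" using g unfolding inner_form_def by blast
  define T where "T v = (\<Sum>b\<in>Basis. g v b *\<^sub>R b)" for v
  have lin: "linear T" unfolding T_def
    by (rule linearI) (simp_all add: bilinear_ladd[OF bil] bilinear_lmul[OF bil] scaleR_left_distrib sum.distrib scaleR_sum_right)
  have ext: "g v w = (\<Sum>b\<in>Basis. (w \<bullet> b) * g v b)" for v w
  proof -
    have "g v w = g v (\<Sum>b\<in>Basis. (w \<bullet> b) *\<^sub>R b)" by (simp add: euclidean_representation)
    also have "\<dots> = (\<Sum>b\<in>Basis. (w \<bullet> b) * g v b)"
    proof -
      have l: "linear (g v)" using bil unfolding bilinear_def by blast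
      show ?thesis by (simp add: linear_sum[OF l] linear_cmul[OF l])
    qed
    finally show ?thesis .
  qed
  have Tb: "T v \<bullet> b = g v b" if "b \<in> Basis" for v b unfolding T_def by (simp add: that inner_sum_left_Basis)
  have "inj T"
  proof (rule injI)
    fix v v' assume "T v = T v'"
    then have eq: "g v b = g v' b" if "b \<in> Basis" for b using Tb[OF that] by metis
    show "v = v'"
    proof (rule inner_form_eqI[OF g])
      fix w show "g v w = g v' w" unfolding ext[of v w] ext[of v' w] by (rule sum.cong) (auto simp: eq)
    qed
  qed
  then have "surj T" using lin linear_injective_imp_surjective by blast
  then obtain v where v: "T v = (\<Sum>b\<in>Basis. L b *\<^sub>R b)" by (metis surjD)
  have "g v w = L w" for w
  proof -
    have "g v b = L b" if "b \<in> Basis" for b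
      using Tb[OF that, of v] v that by (simp add: inner_sum_left_Basis)
    then have "g v w = (\<Sum>b\<in>Basis. (w \<bullet> b) * L b)" unfolding ext[of v w] by (intro sum.cong) auto
    also have "\<dots> = L (\<Sum>b\<in>Basis. (w \<bullet> b) *\<^sub>R b)"
      by (simp add: linear_sum[OF L] linear_cmul[OF L])
    finally show ?thesis by (simp add: euclidean_representation)
  qed
  then show ?thesis by (intro ex1I[of _ v] inner_form_eqI[OF g]) auto
qed

lemma bilinear_bound_Basis:
  fixes v w :: "'e::euclidean_space"
  assumes "bilinear h"
  shows "\<bar>h v w\<bar> \<le> (\<Sum>b\<in>Basis. \<Sum>c\<in>Basis. \<bar>h b c\<bar>) * norm v * norm w"
proof -
  have "h v w = h (\<Sum>b\<in>Basis. (v \<bullet> b) *\<^sub>R b) (\<Sum>c\<in>Basis. (w \<bullet> c) *\<^sub>R c)"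
    by (simp add: euclidean_representation)
  also have "\<dots> = (\<Sum>(b, c)\<in>Basis \<times> Basis. (v \<bullet> b) * (w \<bullet> c) * h b c)"
    by (simp add: bilinear_sum[OF assms] bilinear_lmul[OF assms] bilinear_rmul[OF assms] case_prod_beta' mult_ac)
  also have "\<bar>\<dots>\<bar> \<le> (\<Sum>(b, c)\<in>Basis \<times> Basis. norm v * norm w * \<bar>h b c\<bar>)"
    by (rule order_trans[OF sum_abs], rule sum_mono)
       (auto simp: abs_mult intro!: mult_mono Basis_le_norm)
  also have "\<dots> = (\<Sum>b\<in>Basis. \<Sum>c\<in>Basis. \<bar>h b c\<bar>) * norm v * norm w"
    by (simp add: sum.cartesian_product[symmetric] sum_distrib_left sum_distrib_right mult_ac)
  finally show ?thesis .
qed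

text \<open>The unit sphere is compact.\<close>

lemma inner_form_coercive:
  assumes g: "inner_form (g :: 'e::euclidean_space \<Rightarrow> 'e \<Rightarrow> real)"
  obtains c where "c > 0" "\<And>w. g w w \<ge> c * (norm w)\<^sup>2"
proof -
  have bil: "bilinear g" using g unfolding inner_form_def by blast
  let ?S = "sphere (0 :: 'e) 1"
  have "continuous_on ?S (\<lambda>w. g w w)"
    using bilinear_continuous_on_compose[OF continuous_on_id continuous_on_id bil] by simp
  moreover obtain b where b: "b \<in> (Basis :: 'e set)" using nonempty_Basis by blast
  ultimately obtain w0 where w0: "w0 \<in> ?S" "\<And>w. w \<in> ?S \<Longrightarrow> g w0 w0 \<le> g w w"
    using continuous_attains_inf[OF compact_sphere, of 0 1 "\<lambda>w. g w w"] by fastforce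
  have "w0 \<noteq> 0" using w0(1) by auto
  then have pos: "g w0 w0 > 0" using g unfolding inner_form_def by blast
  have "g w0 w0 * (norm w)\<^sup>2 \<le> g w w" for w
  proof (cases "w = 0")
    case True
    then show ?thesis using bilinear_lzero[OF bil] by simp
  next
    case False
    then have "g w0 w0 \<le> g (w /\<^sub>R norm w) (w /\<^sub>R norm w)" by (intro w0(2)) simp
    also have "\<dots> = g w w / (norm w)\<^sup>2"
      by (simp add: bilinear_lmul[OF bil] bilinear_rmul[OF bil] power2_eq_square field_simps)
    finally show ?thesis using False by (simp add: field_simps)
  qed
  then show ?thesis using that pos by blast
qed

text \<open>With \<open>w = v q - v q0\<close>, coercivity at \<open>q0\<close> bounds \<open>(norm w)\<^sup>2\<close> by \<open>g q w w\<close>, which equals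
\<open>L q w - g q (v q0) w\<close>. This functional tends to the one at \<open>q0\<close>, which is zero.\<close>

lemma riesz_continuous:
  fixes g :: "'a::metric_space \<Rightarrow> 'e::euclidean_space \<Rightarrow> 'e \<Rightarrow> real"
  assumes g: "\<And>q. q \<in> S \<Longrightarrow> inner_form (g q)" and L: "\<And>q. q \<in> S \<Longrightarrow> linear (L q)"
    and gc: "\<And>v w. continuous_on S (\<lambda>q. g q v w)" and Lc: "\<And>w. continuous_on S (\<lambda>q. L q w)"
    and v: "\<And>q w. q \<in> S \<Longrightarrow> g q (v q) w = L q w"
  shows "continuous_on S v"
  unfolding continuous_on_def
proof
  fix q0 assume q0: "q0 \<in> S"
  obtain c where c: "c > 0" "\<And>w. g q0 w w \<ge> c * (norm w)\<^sup>2" by (rule inner_form_coercive[OF g[OF q0]]) blast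
  define \<eta> where "\<eta> q = (\<Sum>b\<in>Basis. \<Sum>b'\<in>Basis. \<bar>g q b b' - g q0 b b'\<bar>)" for q
  define \<theta> where "\<theta> q = (\<Sum>b\<in>Basis. \<bar>L q b - L q0 b\<bar>)" for q
  have lim0: "(\<eta> \<longlongrightarrow> (\<Sum>b\<in>(Basis::'e set). \<Sum>b'\<in>(Basis::'e set). \<bar>g q0 b b' - g q0 b b'\<bar>)) (at q0 within S)"
    unfolding \<eta>_def by (intro tendsto_intros) (use gc q0 in \<open>auto simp: continuous_on_def\<close>)
  then have lim: "(\<eta> \<longlongrightarrow> 0) (at q0 within S)" by simp
  have "(\<theta> \<longlongrightarrow> (\<Sum>b\<in>(Basis::'e set). \<bar>L q0 b - L q0 b\<bar>)) (at q0 within S)"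
    unfolding \<theta>_def by (intro tendsto_intros) (use Lc q0 in \<open>auto simp: continuous_on_def\<close>)
  then have lim2: "(\<theta> \<longlongrightarrow> 0) (at q0 within S)" by simp
  have ev: "eventually (\<lambda>q. norm (v q - v q0) \<le> 2 / c * (\<theta> q + \<eta> q * norm (v q0))) (at q0 within S)"
  proof -
    have "eventually (\<lambda>q. \<eta> q < c / 2) (at q0 within S)" using order_tendstoD(2)[OF lim, of "c/2"] c by simp
    moreover have "eventually (\<lambda>q. q \<in> S) (at q0 within S)" by (simp add: eventually_at_filter)
    ultimately show ?thesis
    proof eventually_elim
      case (elim q)
      note bq = g[OF elim(2), unfolded inner_form_def] and b0 = g[OF q0, unfolded inner_form_def]
      have bil: "bilinear (\<lambda>v w. g q v w - g q0 v w)"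
        using bq b0 unfolding bilinear_def by (auto intro!: linear_compose_sub)
      define w where "w = v q - v q0"
      have Lw: "\<bar>L q w - L q0 w\<bar> \<le> \<theta> q * norm w"
      proof -
        have lin: "linear (\<lambda>w. L q w - L q0 w)" using L[OF elim(2)] L[OF q0] by (rule linear_compose_sub)
        have "L q w - L q0 w = (\<lambda>w. L q w - L q0 w) (\<Sum>b\<in>Basis. (w \<bullet> b) *\<^sub>R b)" by (simp add: euclidean_representation)
        also have "\<dots> = (\<Sum>b\<in>Basis. (w \<bullet> b) * (L q b - L q0 b))"
          by (simp only: linear_sum[OF lin] linear_cmul[OF lin] real_scaleR_def)
        also have "\<bar>\<dots>\<bar> \<le> (\<Sum>b\<in>Basis. norm w * \<bar>L q b - L q0 b\<bar>)"
          by (rule order_trans[OF sum_abs], rule sum_mono) (auto simp: abs_mult intro!: mult_right_mono Basis_le_norm)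
        also have "\<dots> = \<theta> q * norm w" unfolding \<theta>_def by (simp add: sum_distrib_left mult.commute)
        finally show ?thesis .
      qed
      have "g q w w = g q (v q) w - g q (v q0) w" unfolding w_def using bq by (simp add: bilinear_lsub)
      also have "\<dots> = (L q w - L q0 w) - (g q (v q0) w - g q0 (v q0) w)" using v[OF elim(2)] v[OF q0] by simp
      also have "\<dots> \<le> \<theta> q * norm w + \<eta> q * norm (v q0) * norm w"
        using Lw bilinear_bound_Basis[OF bil, of "v q0" w] unfolding \<eta>_def by linarith
      finally have up: "g q w w \<le> \<theta> q * norm w + \<eta> q * norm (v q0) * norm w" .
      have "g q w w \<ge> g q0 w w - \<eta> q * norm w * norm w"
        using bilinear_bound_Basis[OF bil, of w w] unfolding \<eta>_def by linarith
      moreover have "\<eta> q * norm w * norm w \<le> c / 2 * norm w * norm w"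
        using elim(1) by (intro mult_right_mono) auto
      ultimately have lo: "g q w w \<ge> c / 2 * norm w * norm w" using c(2)[of w] by (simp add: power2_eq_square)
      have "c / 2 * norm w * norm w \<le> (\<theta> q + \<eta> q * norm (v q0)) * norm w"
        using up lo by (simp add: algebra_simps)
      moreover have "\<theta> q + \<eta> q * norm (v q0) \<ge> 0" unfolding \<theta>_def \<eta>_def by (intro add_nonneg_nonneg mult_nonneg_nonneg sum_nonneg) auto
      ultimately have "c / 2 * norm w \<le> \<theta> q + \<eta> q * norm (v q0)" 
        by (cases "norm w = 0") (auto simp: mult_le_cancel_right)
      then show ?case using c(1) unfolding w_def by (simp add: field_simps)
    qed
  qed
  have "((\<lambda>q. 2 / c * (\<theta> q + \<eta> q * norm (v q0))) \<longlongrightarrow> 2 / c * (0 + 0 * norm (v q0))) (at q0 within S)"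
    by (intro tendsto_intros lim lim2)
  then have "((\<lambda>q. v q - v q0) \<longlongrightarrow> 0) (at q0 within S)"
    by (intro Lim_null_comparison[OF ev]) simp
  then show "(v \<longlongrightarrow> v q0) (at q0 within S)" by (simp add: LIM_zero_iff)
qed

section \<open>Gradients on the closed manifold\<close>

context closed_manifold
begin

definition differentiable_fun :: "('k \<Rightarrow> real) \<Rightarrow> bool" where
  "differentiable_fun g \<longleftrightarrow> (\<forall>i\<in>index K. \<forall>z\<in>coord_range K i. (g \<circ> param K i) differentiable (at z))"

lemma coord_diff_has_derivative:
  assumes "differentiable_fun g" "i \<in> index K" "z \<in> coord_range K i"
  shows "((g \<circ> param K i) has_derivative coord_diff K i g z) (at z)"
  using assms at_within_open[OF assms(3) range_open[OF assms(2)]]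
  unfolding differentiable_fun_def coord_diff_def by (simp add: frechet_derivative_works)

lemma coord_diff_eq:
  assumes "i \<in> index K" "z \<in> coord_range K i" "((g \<circ> param K i) has_derivative F) (at z)"
  shows "coord_diff K i g z = F"
  using at_within_open[OF assms(2) range_open[OF assms(1)]] frechet_derivative_at[OF assms(3)]
  unfolding coord_diff_def by simp

lemma inner_form_metric: "i \<in> index K \<Longrightarrow> z \<in> coord_range K i \<Longrightarrow> inner_form (metric K i z)"
  unfolding inner_form_def using metric_bilinear metric_sym metric_pos by blast

lemma coord_grad:
  assumes "differentiable_fun g" "i \<in> index K" "z \<in> coord_range K i"
  shows "metric K i z (coord_grad K i g z) w = coord_diff K i g z w"
proof -
  have "linear (coord_diff K i g z)"
    using coord_diff_has_derivative[OF assms] by (rule has_derivative_linear)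
  from theI'[OF inner_form_riesz[OF inner_form_metric[OF assms(2,3)] this]]
  show ?thesis unfolding coord_grad_def by blast
qed

lemma coord_grad_eqI:
  assumes "differentiable_fun g" "i \<in> index K" "z \<in> coord_range K i"
    and "\<And>w. metric K i z v w = coord_diff K i g z w"
  shows "coord_grad K i g z = v"
  by (rule inner_form_eqI[OF inner_form_metric[OF assms(2,3)]]) (simp add: coord_grad[OF assms(1-3)] assms(4))

lemma overlap_open:
  assumes "i \<in> index K" "j \<in> index K"
  shows "open (coord K i ` (chart_dom K i \<inter> chart_dom K j))"
proof -
  have "coord K i ` (chart_dom K i \<inter> chart_dom K j) = coord_range K i \<inter> param K i -` chart_dom K j"
    using assms by (auto simp: param_coord coord_in coord_range_def)
  then show ?thesis
    using continuous_open_preimage[OF param_cont[OF assms(1)] range_open[OF assms(1)] chart_open[OF assms(2)]] by simp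
qed

lemma transition_has_derivative:
  assumes "i \<in> index K" "j \<in> index K" "p \<in> chart_dom K i" "p \<in> chart_dom K j"
  shows "(transition K i j has_derivative frechet_derivative (transition K i j) (at (coord K i p))) (at (coord K i p))"
proof -
  let ?O = "coord K i ` (chart_dom K i \<inter> chart_dom K j)"
  have z: "coord K i p \<in> ?O" using assms by blast
  have "(transition K i j) differentiable (at (coord K i p) within ?O)"
    using smooth_on_imp_Ck[OF transition_smooth[OF assms(1,2)], of 1] z
    unfolding One_nat_def Ck_on.simps differentiable_on_def by blast
  then show ?thesis
    unfolding at_within_open[OF z overlap_open[OF assms(1,2)]] frechet_derivative_works .
qed

lemma transition_coord:
  assumes "i \<in> index K" "p \<in> chart_dom K i"
  shows "transition K i j (coord K i p) = coord K j p"
  using assms unfolding transition_def by (simp add: param_coord)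

text \<open>The transition in the opposite direction is an inverse.\<close>

lemma transition_surj:
  assumes "i \<in> index K" "j \<in> index K" "p \<in> chart_dom K i" "p \<in> chart_dom K j"
  shows "surj (frechet_derivative (transition K i j) (at (coord K i p)))"
proof -
  let ?A = "frechet_derivative (transition K i j) (at (coord K i p))"
  let ?B = "frechet_derivative (transition K j i) (at (coord K j p))"
  let ?O = "coord K j ` (chart_dom K j \<inter> chart_dom K i)"
  have B: "(transition K j i has_derivative ?B) (at (coord K j p))"
    by (rule transition_has_derivative) (use assms in auto)
  have A: "(transition K i j has_derivative ?A) (at (transition K j i (coord K j p)))"
    unfolding transition_coord[OF assms(2,4)] by (rule transition_has_derivative) (use assms in auto)
  have "((\<lambda>z. transition K i j (transition K j i z)) has_derivative (\<lambda>v. ?A (?B v))) (at (coord K j p))"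
    by (rule has_derivative_compose[OF B A])
  moreover have "((\<lambda>z. transition K i j (transition K j i z)) has_derivative (\<lambda>v. v)) (at (coord K j p))"
  proof (rule has_derivative_transform_within_open[OF has_derivative_ident, of ?O])
    show "open ?O" by (rule overlap_open) (use assms in auto)
    show "coord K j p \<in> ?O" using assms by blast
    show "z = transition K i j (transition K j i z)" if "z \<in> ?O" for z
      using that assms by (auto simp: transition_coord)
  qed
  ultimately have "(\<lambda>v. ?A (?B v)) = (\<lambda>v. v)" by (rule has_derivative_unique)
  then have "?A (?B v) = v" for v by (rule fun_cong)
  then show ?thesis by (metis surjI)
qed

lemma coord_diff_transition:
  assumes g: "differentiable_fun g" and ij: "i \<in> index K" "j \<in> index K" and p: "p \<in> chart_dom K i" "p \<in> chart_dom K j"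
  shows "coord_diff K i g (coord K i p) v = coord_diff K j g (coord K j p) (frechet_derivative (transition K i j) (at (coord K i p)) v)"
proof -
  let ?A = "frechet_derivative (transition K i j) (at (coord K i p))"
  let ?O = "coord K i ` (chart_dom K i \<inter> chart_dom K j)"
  have D: "((g \<circ> param K j) has_derivative coord_diff K j g (coord K j p)) (at (transition K i j (coord K i p)))"
    unfolding transition_coord[OF ij(1) p(1)] by (rule coord_diff_has_derivative[OF g ij(2) coord_in[OF ij(2) p(2)]])
  have "((\<lambda>z. (g \<circ> param K j) (transition K i j z)) has_derivative (\<lambda>v. coord_diff K j g (coord K j p) (?A v))) (at (coord K i p))"
    by (rule has_derivative_compose[OF transition_has_derivative[OF ij p] D])
  then have "((g \<circ> param K i) has_derivative (\<lambda>v. coord_diff K j g (coord K j p) (?A v))) (at (coord K i p))"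
  proof (rule has_derivative_transform_within_open[of _ _ _ _ ?O])
    show "open ?O" by (rule overlap_open) (use ij in auto)
    show "coord K i p \<in> ?O" using p by blast
    show "(g \<circ> param K j) (transition K i j z) = (g \<circ> param K i) z" if "z \<in> ?O" for z
      using that ij by (auto simp: transition_coord param_coord)
  qed
  then show ?thesis using coord_diff_eq[OF ij(1) coord_in[OF ij(1) p(1)]] by metis
qed

text \<open>The differential and the metric both transform with the derivative of the transition map, so the image
of the gradient under this derivative represents the differential on its range.\<close>

lemma coord_grad_transition:
  assumes g: "differentiable_fun g" and ij: "i \<in> index K" "j \<in> index K" and p: "p \<in> chart_dom K i" "p \<in> chart_dom K j"
  shows "coord_grad K j g (coord K j p) = frechet_derivative (transition K i j) (at (coord K i p)) (coord_grad K i g (coord K i p))"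
proof (rule coord_grad_eqI[OF g ij(2) coord_in[OF ij(2) p(2)]])
  fix w
  let ?A = "frechet_derivative (transition K i j) (at (coord K i p))"
  obtain w' where w': "w = ?A w'" using transition_surj[OF ij p] by (metis surjD)
  have z: "coord K i p \<in> coord K i ` (chart_dom K i \<inter> chart_dom K j)" using p by blast
  have "metric K j (coord K j p) (?A (coord_grad K i g (coord K i p))) (?A w') = metric K i (coord K i p) (coord_grad K i g (coord K i p)) w'"
    using metric_transition[OF ij z] transition_coord[OF ij(1) p(1)] by metis
  also have "\<dots> = coord_diff K i g (coord K i p) w'" by (rule coord_grad[OF g ij(1) coord_in[OF ij(1) p(1)]])
  also have "\<dots> = coord_diff K j g (coord K j p) (?A w')" by (rule coord_diff_transition[OF g ij p])
  finally show "metric K j (coord K j p) (?A (coord_grad K i g (coord K i p))) w = coord_diff K j g (coord K j p) w" unfolding w' .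
qed

text \<open>The definition evaluates the product in an unspecified chart at \<open>p\<close>; by the transformation law any chart
gives the same value. This makes the product continuous, in particular measurable.\<close>

lemma real_grad_inner_chart:
  assumes g: "differentiable_fun g" and h: "differentiable_fun h" and i: "i \<in> index K" "p \<in> chart_dom K i"
  shows "real_grad_inner K g h p = metric K i (coord K i p) (coord_grad K i g (coord K i p)) (coord_grad K i h (coord K i p))"
proof -
  define j where "j = (SOME i. i \<in> index K \<and> p \<in> chart_dom K i)"
  have j: "j \<in> index K \<and> p \<in> chart_dom K j" unfolding j_def by (rule someI[of _ i]) (use i in auto)
  have z: "coord K i p \<in> coord K i ` (chart_dom K i \<inter> chart_dom K j)" using i j by blast
  show ?thesis
    unfolding real_grad_inner_def j_def[symmetric] Let_def
    using metric_transition[OF i(1) conjunct1[OF j] z] transition_coord[OF i]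
      coord_grad_transition[OF g i(1) _ i(2)] coord_grad_transition[OF h i(1) _ i(2)] j by metis
qed

lemma differentiable_fun_linear:
  assumes "differentiable_fun g" "differentiable_fun h"
  shows "differentiable_fun (\<lambda>p. a * g p + b * h p)"
  using assms unfolding differentiable_fun_def o_def
  by (auto intro!: derivative_intros)

lemma coord_grad_linear:
  assumes g: "differentiable_fun g" and h: "differentiable_fun h" and i: "i \<in> index K" "z \<in> coord_range K i"
  shows "coord_grad K i (\<lambda>p. a * g p + b * h p) z = a *\<^sub>R coord_grad K i g z + b *\<^sub>R coord_grad K i h z"
proof (rule coord_grad_eqI[OF differentiable_fun_linear[OF g h] i])
  fix w
  have "(((\<lambda>p. a * g p + b * h p) \<circ> param K i) has_derivative (\<lambda>v. a * coord_diff K i g z v + b * coord_diff K i h z v)) (at z)"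
    unfolding o_def using coord_diff_has_derivative[OF g i] coord_diff_has_derivative[OF h i] unfolding o_def
    by (intro derivative_intros)
  then have "coord_diff K i (\<lambda>p. a * g p + b * h p) z w = a * coord_diff K i g z w + b * coord_diff K i h z w"
    using coord_diff_eq[OF i] by metis
  then show "metric K i z (a *\<^sub>R coord_grad K i g z + b *\<^sub>R coord_grad K i h z) w = coord_diff K i (\<lambda>p. a * g p + b * h p) z w"
    using metric_bilinear[OF i] by (simp add: bilinear_ladd bilinear_lmul coord_grad[OF g i] coord_grad[OF h i])
qed

lemma real_grad_inner_linear_right:
  assumes g: "differentiable_fun g" and h: "differentiable_fun h" and u: "differentiable_fun u"
  shows "real_grad_inner K u (\<lambda>p. a * g p + b * h p) p = a * real_grad_inner K u g p + b * real_grad_inner K u h p"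
proof -
  obtain i where i: "i \<in> index K" "p \<in> chart_dom K i" by (rule exists_chart)
  note z = coord_in[OF i]
  show ?thesis
    unfolding real_grad_inner_chart[OF u differentiable_fun_linear[OF g h] i] real_grad_inner_chart[OF u g i] real_grad_inner_chart[OF u h i]
      coord_grad_linear[OF g h i(1) z]
    using metric_bilinear[OF i(1) z] by (simp add: bilinear_radd bilinear_rmul)
qed

lemma real_grad_inner_sym:
  assumes g: "differentiable_fun g" and h: "differentiable_fun h"
  shows "real_grad_inner K g h p = real_grad_inner K h g p"
proof -
  obtain i where i: "i \<in> index K" "p \<in> chart_dom K i" by (rule exists_chart)
  show ?thesis
    unfolding real_grad_inner_chart[OF g h i] real_grad_inner_chart[OF h g i]
    by (rule metric_sym[OF i(1) coord_in[OF i]])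
qed

lemma real_grad_inner_nonneg:
  assumes g: "differentiable_fun g"
  shows "0 \<le> real_grad_inner K g g p"
proof -
  obtain i where i: "i \<in> index K" "p \<in> chart_dom K i" by (rule exists_chart)
  show ?thesis
    unfolding real_grad_inner_chart[OF g g i]
    using metric_pos[OF i(1) coord_in[OF i]] bilinear_lzero[OF metric_bilinear[OF i(1) coord_in[OF i]]]
    by (cases "coord_grad K i g (coord K i p) = 0") (auto intro: less_imp_le)
qed

lemma real_grad_inner_bound:
  assumes g: "differentiable_fun g" and h: "differentiable_fun h" and t: "t > 0"
  shows "2 * \<bar>real_grad_inner K g h p\<bar> \<le> t * real_grad_inner K g g p + real_grad_inner K h h p / t"
proof -
  define s where "s = sqrt t"
  have s: "s > 0" "s * s = t" unfolding s_def using t by auto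
  have *: "0 \<le> t * real_grad_inner K g g p + real_grad_inner K h h p / t + 2 * e * real_grad_inner K g h p" if e: "e * e = 1" for e
  proof -
    let ?w = "\<lambda>p. s * g p + (e / s) * h p"
    have dw: "differentiable_fun ?w" by (rule differentiable_fun_linear[OF g h])
    have "0 \<le> real_grad_inner K ?w ?w p" by (rule real_grad_inner_nonneg[OF dw])
    also have "\<dots> = s * real_grad_inner K g ?w p + (e / s) * real_grad_inner K h ?w p"
      by (simp only: real_grad_inner_linear_right[OF g h dw] real_grad_inner_sym[OF dw g] real_grad_inner_sym[OF dw h])
    also have "\<dots> = (s * s) * real_grad_inner K g g p + 2 * e * real_grad_inner K g h p + (e * e) / (s * s) * real_grad_inner K h h p"
      unfolding real_grad_inner_linear_right[OF g h g, of s "e / s" p] real_grad_inner_linear_right[OF g h h, of s "e / s" p]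
        real_grad_inner_sym[OF h g]
      using s(1) by (simp add: field_simps)
    finally show ?thesis unfolding e s(2) by simp
  qed
  show ?thesis using *[of 1] *[of "-1"] by (simp add: abs_if)
qed

definition cdifferentiable_fun :: "('k \<Rightarrow> complex) \<Rightarrow> bool" where
  "cdifferentiable_fun u \<longleftrightarrow> differentiable_fun (Re \<circ> u) \<and> differentiable_fun (Im \<circ> u)"

definition grad_sq :: "('k \<Rightarrow> complex) \<Rightarrow> 'k \<Rightarrow> real" where
  "grad_sq u p = Re (grad_inner K u u p)"

lemma grad_sq_nonneg: "cdifferentiable_fun u \<Longrightarrow> 0 \<le> grad_sq u p"
  unfolding grad_sq_def grad_inner_def cdifferentiable_fun_def by (simp add: real_grad_inner_nonneg)

lemma grad_inner_cnj: "cdifferentiable_fun u \<Longrightarrow> cdifferentiable_fun h \<Longrightarrow> grad_inner K h u p = cnj (grad_inner K u h p)"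
  unfolding grad_inner_def cdifferentiable_fun_def
  by (simp add: complex_eq_iff real_grad_inner_sym[of "Re \<circ> h"] real_grad_inner_sym[of "Im \<circ> h"])

lemma grad_inner_bound:
  assumes "cdifferentiable_fun u" "cdifferentiable_fun h" and t: "t > 0"
  shows "cmod (grad_inner K u h p) \<le> t * grad_sq u p + grad_sq h p / t"
proof -
  note d = assms(1,2)[unfolded cdifferentiable_fun_def]
  note b = real_grad_inner_bound[OF _ _ t]
  have "cmod (grad_inner K u h p) \<le> \<bar>Re (grad_inner K u h p)\<bar> + \<bar>Im (grad_inner K u h p)\<bar>" by (rule cmod_le)
  also have "\<dots> \<le> t * grad_sq u p + grad_sq h p / t"
    using b[of "Re \<circ> u" "Re \<circ> h" p] b[of "Re \<circ> u" "Im \<circ> h" p] b[of "Im \<circ> u" "Re \<circ> h" p] b[of "Im \<circ> u" "Im \<circ> h" p] d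
    unfolding grad_sq_def grad_inner_def by (simp add: distrib_left add_divide_distrib)
  finally show ?thesis .
qed

lemma cdifferentiable_fun_linear:
  assumes "cdifferentiable_fun u" "cdifferentiable_fun h"
  shows "cdifferentiable_fun (\<lambda>p. of_real a * u p + of_real b * h p)"
  using assms differentiable_fun_linear[of "Re \<circ> u" "Re \<circ> h" a b] differentiable_fun_linear[of "Im \<circ> u" "Im \<circ> h" a b]
  unfolding cdifferentiable_fun_def by (simp add: o_def)

lemma grad_inner_linear_right:
  assumes "cdifferentiable_fun u" "cdifferentiable_fun g" "cdifferentiable_fun h"
  shows "grad_inner K u (\<lambda>p. of_real a * g p + of_real b * h p) p = of_real a * grad_inner K u g p + of_real b * grad_inner K u h p"
  using assms real_grad_inner_linear_right[of "Re \<circ> g" "Re \<circ> h" _ a b] real_grad_inner_linear_right[of "Im \<circ> g" "Im \<circ> h" _ a b]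
  unfolding cdifferentiable_fun_def grad_inner_def by (simp add: o_def complex_eq_iff algebra_simps)

section \<open>Functions on the product of the unit interval and the manifold\<close>

text \<open>Continuous differentiability up to the boundary, read in the charts of \<open>K\<close>. Its main members are the smooth
functions on the product and their differences.\<close>

definition C1_strip :: "(real \<times> 'k \<Rightarrow> 'b::real_normed_vector) \<Rightarrow> bool" where
  "C1_strip u \<longleftrightarrow> (\<forall>i\<in>index K. Ck_on 1 ({0..1} \<times> coord_range K i) (\<lambda>(x, z). u (x, param K i z)))"

definition dx :: "(real \<times> 'k \<Rightarrow> 'b::real_normed_vector) \<Rightarrow> real \<times> 'k \<Rightarrow> 'b" where
  "dx u q = vector_derivative (\<lambda>t. u (t, snd q)) (at (fst q) within {0..1})"

text \<open>The differential in a chart: the direction \<open>(1, 0)\<close> gives \<open>dx u\<close>, the directions \<open>(0, w)\<close> give the differential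
along \<open>K\<close>.\<close>

definition strip_diff :: "(real \<times> 'k \<Rightarrow> 'b::real_normed_vector) \<Rightarrow> 'i \<Rightarrow> real \<times> 'e \<Rightarrow> real \<times> 'e \<Rightarrow> 'b" where
  "strip_diff u i q = frechet_derivative (\<lambda>(x, z). u (x, param K i z)) (at q within {0..1} \<times> coord_range K i)"

lemma C1_strip_has_derivative:
  assumes "C1_strip u" "i \<in> index K" "q \<in> {0..1} \<times> coord_range K i"
  shows "((\<lambda>(x, z). u (x, param K i z)) has_derivative strip_diff u i q) (at q within {0..1} \<times> coord_range K i)"
  unfolding strip_diff_def
  by (rule Ck_on_has_derivative[OF _ assms(3), of 0]) (use assms in \<open>simp add: C1_strip_def\<close>)

lemma strip_diff_cont:
  assumes "C1_strip u" "i \<in> index K"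
  shows "continuous_on ({0..1} \<times> coord_range K i) (\<lambda>q. strip_diff u i q v)"
  using assms unfolding C1_strip_def strip_diff_def One_nat_def Ck_on.simps by blast

lemma C1_strip_dx:
  assumes u: "C1_strip u" and i: "i \<in> index K" and x: "x \<in> {0..1}" and z: "z \<in> coord_range K i"
  shows "((\<lambda>t. u (t, param K i z)) has_vector_derivative strip_diff u i (x, z) (1, 0)) (at x within {0..1})"
proof -
  have xz: "(x, z) \<in> {0..1} \<times> coord_range K i" using x z by blast
  show ?thesis using has_vector_derivative_slice[OF C1_strip_has_derivative[OF u i xz] z] by simp
qed

lemma vector_derivative_01:
  "x \<in> {0..1::real} \<Longrightarrow> (g has_vector_derivative y) (at x within {0..1}) \<Longrightarrow> vector_derivative g (at x within {0..1}) = y"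
proof -
  assume x: "x \<in> {0..1}" and g: "(g has_vector_derivative y) (at x within {0..1})"
  \<comment> \<open>uniqueness of the derivative for arbitrary values needs a nontrivial filter\<close>
  have "x islimpt {0..1}" by (rule connected_imp_perfect) (use x in auto)
  then have "at x within {0..1} \<noteq> bot" by (simp add: trivial_limit_within)
  moreover have "(g has_vector_derivative vector_derivative g (at x within {0..1})) (at x within {0..1})"
    using differentiableI_vector[OF g] vector_derivative_works by blast
  ultimately show ?thesis using g by (rule vector_derivative_unique_within)
qed

lemma dx_chart:
  assumes u: "C1_strip u" and i: "i \<in> index K" and x: "x \<in> {0..1}" and z: "z \<in> coord_range K i"
  shows "dx u (x, param K i z) = strip_diff u i (x, z) (1, 0)"
  unfolding dx_def using vector_derivative_01[OF x C1_strip_dx[OF assms]] by simp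

lemma dx_has_vector_derivative:
  assumes u: "C1_strip u" and x: "x \<in> {0..1}"
  shows "((\<lambda>t. u (t, p)) has_vector_derivative dx u (x, p)) (at x within {0..1})"
proof -
  obtain i where i: "i \<in> index K" "p \<in> chart_dom K i" by (rule exists_chart)
  show ?thesis using C1_strip_dx[OF u i(1) x coord_in[OF i]] dx_chart[OF u i(1) x coord_in[OF i]]
    by (simp add: param_coord[OF i])
qed

lemma C1_strip_slice:
  fixes u :: "real \<times> 'k \<Rightarrow> real"
  assumes u: "C1_strip u" and i: "i \<in> index K" and x: "x \<in> {0..1}" and z: "z \<in> coord_range K i"
  shows "(((\<lambda>p. u (x, p)) \<circ> param K i) has_derivative (\<lambda>w. strip_diff u i (x, z) (0, w))) (at z)"
proof -
  have xz: "(x, z) \<in> {0..1} \<times> coord_range K i" using x z by blast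
  show ?thesis using has_derivative_slice[OF C1_strip_has_derivative[OF u i xz] x]
    at_within_open[OF z range_open[OF i]] by (simp add: o_def)
qed

lemma C1_strip_differentiable_fun: "C1_strip u \<Longrightarrow> x \<in> {0..1} \<Longrightarrow> differentiable_fun (\<lambda>p. u (x, p))"
  unfolding differentiable_fun_def differentiable_def using C1_strip_slice by blast

lemma C1_strip_linear:
  assumes L: "bounded_linear L" and u: "C1_strip u"
  shows "C1_strip (\<lambda>q. L (u q))"
  unfolding C1_strip_def
proof
  fix i assume i: "i \<in> index K"
  have "Ck_on 1 ({0..1} \<times> coord_range K i) (\<lambda>q. L ((\<lambda>(x, z). u (x, param K i z)) q))"
    by (rule Ck_on_linear[OF L unique_derivatives_strip[OF range_open[OF i]]]) (use u i in \<open>simp only: C1_strip_def\<close>)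
  then show "Ck_on 1 ({0..1} \<times> coord_range K i) (\<lambda>(x, z). L (u (x, param K i z)))"
    by (simp only: case_prod_beta')
qed

lemma C1_strip_add:
  assumes u: "C1_strip u" and v: "C1_strip v"
  shows "C1_strip (\<lambda>q. u q + v q)"
  unfolding C1_strip_def
proof
  fix i assume i: "i \<in> index K"
  have "Ck_on 1 ({0..1} \<times> coord_range K i) (\<lambda>q. (\<lambda>(x, z). u (x, param K i z)) q + (\<lambda>(x, z). v (x, param K i z)) q)"
    by (rule Ck_on_add[OF unique_derivatives_strip[OF range_open[OF i]]]) (use u v i in \<open>simp_all only: C1_strip_def\<close>)
  then show "Ck_on 1 ({0..1} \<times> coord_range K i) (\<lambda>(x, z). u (x, param K i z) + v (x, param K i z))"
    by (simp only: case_prod_beta')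
qed

lemma C1_strip_diff: "C1_strip u \<Longrightarrow> C1_strip v \<Longrightarrow> C1_strip (\<lambda>q. u q - v q)"
  using C1_strip_add[of u "\<lambda>q. - v q"] C1_strip_linear[OF bounded_linear_minus[OF bounded_linear_ident], of v] by simp

text \<open>The sets \<open>[0,1] \<times> chart_dom K i\<close> are relatively open.\<close>

lemma continuous_on_strip:
  assumes "\<And>i. i \<in> index K \<Longrightarrow> continuous_on ({0..1} \<times> coord_range K i) (\<lambda>(x, z). \<Phi> (x, param K i z))"
  shows "continuous_on ({0..1::real} \<times> UNIV) \<Phi>"
  unfolding continuous_on_eq_continuous_within
proof
  fix q :: "real \<times> 'k" assume q: "q \<in> {0..1} \<times> UNIV"
  obtain x p where xp: "q = (x, p)" "x \<in> {0..1}" using q by auto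
  obtain i where i: "i \<in> index K" "p \<in> chart_dom K i" by (rule exists_chart)
  have "continuous_on ({0..1} \<times> chart_dom K i) (\<lambda>q. (\<lambda>(x, z). \<Phi> (x, param K i z)) (fst q, coord K i (snd q)))"
    by (rule continuous_on_compose2[OF assms[OF i(1)]])
      (auto intro!: continuous_intros continuous_on_compose2[OF coord_cont[OF i(1)]] coord_in[OF i(1)])
  then have "continuous_on ({0..1} \<times> chart_dom K i) \<Phi>"
    by (rule continuous_on_eq) (auto simp: param_coord[OF i(1)])
  then have "continuous (at q within {0..1} \<times> chart_dom K i) \<Phi>"
    using xp i unfolding continuous_on_eq_continuous_within by blast
  moreover have "at q within {0..1} \<times> chart_dom K i = at q within {0..1} \<times> UNIV"
    by (rule at_within_nhd[of _ "UNIV \<times> chart_dom K i"]) (use xp i chart_open[OF i(1)] in \<open>auto intro: open_Times\<close>)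
  ultimately show "continuous (at q within {0..1} \<times> UNIV) \<Phi>" by simp
qed

lemma C1_strip_cont: "C1_strip u \<Longrightarrow> continuous_on ({0..1} \<times> UNIV) u"
  by (rule continuous_on_strip) (auto simp only: C1_strip_def intro: Ck_on_imp_continuous)

lemma dx_cont: assumes u: "C1_strip u" shows "continuous_on ({0..1} \<times> UNIV) (dx u)"
proof (rule continuous_on_strip)
  fix i assume i: "i \<in> index K"
  have "continuous_on ({0..1} \<times> coord_range K i) (\<lambda>q. strip_diff u i q (1, 0))" by (rule strip_diff_cont[OF u i])
  then show "continuous_on ({0..1} \<times> coord_range K i) (\<lambda>(x, z). dx u (x, param K i z))"
    by (rule continuous_on_eq) (auto simp: dx_chart[OF u i])
qed

lemma real_grad_inner_cont:
  fixes u h :: "real \<times> 'k \<Rightarrow> real"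
  assumes u: "C1_strip u" and h: "C1_strip h"
  shows "continuous_on ({0..1} \<times> UNIV) (\<lambda>(x, p). real_grad_inner K (\<lambda>p. u (x, p)) (\<lambda>p. h (x, p)) p)"
proof (rule continuous_on_strip)
  fix i assume i: "i \<in> index K"
  let ?S = "{0..1::real} \<times> coord_range K i"
  let ?v = "\<lambda>(x::real, z). coord_grad K i (\<lambda>p. u (x, p)) z"
  have D: "coord_diff K i (\<lambda>p. g (x, p)) z = (\<lambda>w. strip_diff g i (x, z) (0, w))" if "C1_strip g" "(x, z) \<in> ?S" for g x z
    by (rule coord_diff_eq[OF i]) (use that C1_strip_slice[OF that(1) i] in auto)
  have "continuous_on ?S ?v"
  proof (rule riesz_continuous[where g = "\<lambda>(x, z). metric K i z" and L = "\<lambda>q w. strip_diff u i q (0, w)"])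
    fix q assume q: "q \<in> ?S"
    obtain x z where xz: "q = (x, z)" "x \<in> {0..1}" "z \<in> coord_range K i" using q by auto
    show "inner_form (case q of (x, z) \<Rightarrow> metric K i z)" using inner_form_metric[OF i] xz by simp
    have "linear (strip_diff u i q)" using C1_strip_has_derivative[OF u i q] by (rule has_derivative_linear)
    moreover have "linear (\<lambda>w. (0::real, w))" for w :: 'e by (rule linearI) auto
    ultimately show "linear (\<lambda>w. strip_diff u i q (0, w))" using linear_compose[of "\<lambda>w. (0, w)" "strip_diff u i q"] by (simp add: o_def)
    show "(case q of (x, z) \<Rightarrow> metric K i z) (?v q) w = strip_diff u i q (0, w)" for w
      using coord_grad[OF C1_strip_differentiable_fun[OF u xz(2)] i xz(3)] D[OF u, of x z] xz by simp
  next
    fix v w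
    have "continuous_on ?S (\<lambda>q. metric K i (snd q) v w)"
      by (rule continuous_on_compose2[OF metric_cont[OF i, of v w]]) (auto intro!: continuous_intros)
    then show "continuous_on ?S (\<lambda>q. (case q of (x, z) \<Rightarrow> metric K i z) v w)" by (simp add: case_prod_beta')
  qed (rule strip_diff_cont[OF u i])
  then have "continuous_on ?S (\<lambda>q. \<Sum>b\<in>Basis. (?v q \<bullet> b) * strip_diff h i q (0, b))"
    by (intro continuous_intros strip_diff_cont[OF h i])
  then show "continuous_on ?S (\<lambda>(x, z). (\<lambda>(x, p). real_grad_inner K (\<lambda>p. u (x, p)) (\<lambda>p. h (x, p)) p) (x, param K i z))"
  proof (rule continuous_on_eq)
    fix q assume q: "q \<in> ?S"
    obtain x z where xz: "q = (x, z)" "x \<in> {0..1}" "z \<in> coord_range K i" using q by auto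
    note du = C1_strip_differentiable_fun[OF u xz(2)] and dh = C1_strip_differentiable_fun[OF h xz(2)]
    let ?gu = "coord_grad K i (\<lambda>p. u (x, p)) z" and ?gh = "coord_grad K i (\<lambda>p. h (x, p)) z"
    have lin: "linear (coord_diff K i (\<lambda>p. h (x, p)) z)"
      using coord_diff_has_derivative[OF dh i xz(3)] by (rule has_derivative_linear)
    have "real_grad_inner K (\<lambda>p. u (x, p)) (\<lambda>p. h (x, p)) (param K i z) = metric K i z ?gu ?gh"
      using real_grad_inner_chart[OF du dh i param_in[OF i xz(3)]] coord_param[OF i xz(3)] by simp
    also have "\<dots> = coord_diff K i (\<lambda>p. h (x, p)) z ?gu"
      using metric_sym[OF i xz(3)] coord_grad[OF dh i xz(3)] by metis
    also have "\<dots> = coord_diff K i (\<lambda>p. h (x, p)) z (\<Sum>b\<in>Basis. (?gu \<bullet> b) *\<^sub>R b)" by (simp only: euclidean_representation)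
    also have "\<dots> = (\<Sum>b\<in>Basis. (?gu \<bullet> b) * coord_diff K i (\<lambda>p. h (x, p)) z b)"
      by (simp only: linear_sum[OF lin] linear_cmul[OF lin] real_scaleR_def)
    finally show "(\<Sum>b\<in>Basis. (?v q \<bullet> b) * strip_diff h i q (0, b)) = (\<lambda>(x, z). (\<lambda>(x, p). real_grad_inner K (\<lambda>p. u (x, p)) (\<lambda>p. h (x, p)) p) (x, param K i z)) q"
      using D[OF h, of x z] xz by simp
  qed
qed

end

section \<open>The gradient of the warped metric\<close>

context warped_measure
begin

abbreviation W :: "('i, real \<times> 'k, real \<times> 'e) riem" where "W \<equiv> warped_product f K"

lemma W_simps: "index W = index K" "chart_dom W i = {0..1} \<times> chart_dom K i" "coord W i (x, p) = (x, coord K i p)"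
  "metric W i (x, z) (a, v) (b, w) = f x * (a * b + metric K i z v w)"
  unfolding warped_product_def by auto

lemma coord_range_W: "coord_range W i = {0..1} \<times> coord_range K i"
  unfolding coord_range_def W_simps by (auto simp: W_simps image_iff)

lemma param_W:
  assumes "i \<in> index K" "x \<in> {0..1}" "z \<in> coord_range K i"
  shows "param W i (x, z) = (x, param K i z)"
  unfolding param_def
proof (rule inv_into_f_eq)
  show "inj_on (coord W i) (chart_dom W i)"
    unfolding inj_on_def by (auto simp: W_simps) (metis param_coord[OF assms(1)])
  show "(x, inv_into (chart_dom K i) (coord K i) z) \<in> chart_dom W i"
    using assms param_in[OF assms(1,3)] by (simp add: W_simps param_def)
  show "coord W i (x, inv_into (chart_dom K i) (coord K i) z) = (x, z)"
    using coord_param[OF assms(1,3)] by (simp add: W_simps param_def)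
qed

lemma smooth_fun_W_iff:
  "smooth_fun W s \<longleftrightarrow> (\<forall>i\<in>index K. smooth_on ({0..1} \<times> coord_range K i) (\<lambda>(x, z). s (x, param K i z)))"
proof -
  have "Ck_on k ({0..1} \<times> coord_range K i) (s \<circ> param W i) \<longleftrightarrow> Ck_on k ({0..1} \<times> coord_range K i) (\<lambda>(x, z). s (x, param K i z))"
    if "i \<in> index K" for i k
    by (rule Ck_on_cong) (auto simp: param_W[OF that])
  then show ?thesis unfolding smooth_fun_def smooth_on_def coord_range_W W_simps by blast
qed

lemma smooth_fun_C1_strip: "smooth_fun W s \<Longrightarrow> C1_strip s"
  unfolding smooth_fun_W_iff C1_strip_def by (blast intro: smooth_on_imp_Ck)

lemma smooth_fun_slice:
  assumes s: "smooth_fun W s" and x: "x \<in> {0..1}"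
  shows "smooth_fun K (\<lambda>p. s (x, p))"
  unfolding smooth_fun_def smooth_on_def
proof (intro ballI allI)
  fix i k assume i: "i \<in> index K"
  have "Ck_on k ({0..1} \<times> coord_range K i) (\<lambda>(x, z). s (x, param K i z))"
    using s i unfolding smooth_fun_W_iff smooth_on_def by blast
  from Ck_on_slice[OF range_open[OF i] x this] show "Ck_on k (coord_range K i) ((\<lambda>p. s (x, p)) \<circ> param K i)"
    by (simp add: o_def)
qed

definition tensor :: "real poly \<Rightarrow> ('k \<Rightarrow> complex) \<Rightarrow> real \<times> 'k \<Rightarrow> complex" where
  "tensor P y = (\<lambda>(x, p). poly P x *\<^sub>R y p)"

lemma tensor_smooth:
  assumes "smooth_fun K y" shows "smooth_fun W (tensor P y)"
  unfolding smooth_fun_W_iff smooth_on_def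
proof (intro ballI allI)
  fix i k assume i: "i \<in> index K"
  have "Ck_on k (coord_range K i) (y \<circ> param K i)"
    using assms i unfolding smooth_fun_def smooth_on_def by blast
  from Ck_on_poly_tensor[OF range_open[OF i] this, of P]
  show "Ck_on k ({0..1} \<times> coord_range K i) (\<lambda>(x, z). tensor P y (x, param K i z))"
    by (simp add: tensor_def)
qed

lemma tensor_dx: "x \<in> {0..1} \<Longrightarrow> dx (tensor P y) (x, p) = poly (pderiv P) x *\<^sub>R y p"
  unfolding dx_def tensor_def
  by (auto intro!: vector_derivative_01 has_vector_derivative_scaleR[where g' = 0, simplified]
     has_real_derivative_iff_has_vector_derivative[THEN iffD1] poly_DERIV DERIV_subset[OF poly_DERIV])

lemma C1_strip_Re_Im:
  fixes u :: "real \<times> 'k \<Rightarrow> complex"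
  assumes "C1_strip u"
  shows "C1_strip (\<lambda>q. Re (u q))" "C1_strip (\<lambda>q. Im (u q))"
  using C1_strip_linear[OF bounded_linear_Re assms] C1_strip_linear[OF bounded_linear_Im assms] by auto

lemma dx_Re_Im:
  fixes u :: "real \<times> 'k \<Rightarrow> complex"
  assumes u: "C1_strip u" and x: "x \<in> {0..1}"
  shows "dx (\<lambda>q. Re (u q)) (x, p) = Re (dx u (x, p))" "dx (\<lambda>q. Im (u q)) (x, p) = Im (dx u (x, p))"
proof -
  note d = dx_has_vector_derivative[OF u x, of p]
  have "((\<lambda>t. Re (u (t, p))) has_vector_derivative Re (dx u (x, p))) (at x within {0..1})"
    by (rule bounded_linear.has_vector_derivative[OF bounded_linear_Re d])
  then show "dx (\<lambda>q. Re (u q)) (x, p) = Re (dx u (x, p))"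
    unfolding dx_def[of "\<lambda>q. Re (u q)"] using vector_derivative_01[OF x] by simp
  have "((\<lambda>t. Im (u (t, p))) has_vector_derivative Im (dx u (x, p))) (at x within {0..1})"
    by (rule bounded_linear.has_vector_derivative[OF bounded_linear_Im d])
  then show "dx (\<lambda>q. Im (u q)) (x, p) = Im (dx u (x, p))"
    unfolding dx_def[of "\<lambda>q. Im (u q)"] using vector_derivative_01[OF x] by simp
qed

lemma C1_strip_cdifferentiable_fun:
  fixes u :: "real \<times> 'k \<Rightarrow> complex"
  assumes "C1_strip u" "x \<in> {0..1}"
  shows "cdifferentiable_fun (\<lambda>p. u (x, p))"
  using C1_strip_differentiable_fun[OF C1_strip_Re_Im(1)[OF assms(1)] assms(2)] C1_strip_differentiable_fun[OF C1_strip_Re_Im(2)[OF assms(1)] assms(2)]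
  unfolding cdifferentiable_fun_def o_def by simp

lemma smooth_fun_K_lift: "smooth_fun K y \<Longrightarrow> C1_strip (\<lambda>(x, p). y p)"
  using smooth_fun_C1_strip[OF tensor_smooth[of y "[:1:]"]] by (simp add: tensor_def)

text \<open>A function on \<open>K\<close> is a function on the product that is constant in the first variable.\<close>

lemma smooth_fun_cdifferentiable: "smooth_fun K y \<Longrightarrow> cdifferentiable_fun y"
  using C1_strip_cdifferentiable_fun[OF smooth_fun_K_lift, of y 0] by simp

lemma coord_diff_W:
  fixes u :: "real \<times> 'k \<Rightarrow> real"
  assumes u: "C1_strip u" and i: "i \<in> index K" and x: "x \<in> {0..1}" and z: "z \<in> coord_range K i"
  shows "coord_diff W i u (x, z) (b, w) = b * dx u (x, param K i z) + coord_diff K i (\<lambda>p. u (x, p)) z w"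
proof -
  have xz: "(x, z) \<in> {0..1} \<times> coord_range K i" using x z by blast
  have "coord_diff W i u (x, z) = frechet_derivative (u \<circ> param W i) (at (x, z) within {0..1} \<times> coord_range K i)"
    unfolding coord_diff_def coord_range_W ..
  also have "\<dots> = strip_diff u i (x, z)"
    unfolding strip_diff_def by (rule frechet_derivative_cong[OF _ xz]) (auto simp: param_W[OF i])
  finally have eq: "coord_diff W i u (x, z) = strip_diff u i (x, z)" .
  have lin: "linear (strip_diff u i (x, z))" using C1_strip_has_derivative[OF u i xz] by (rule has_derivative_linear)
  have "strip_diff u i (x, z) (b, w) = strip_diff u i (x, z) (b *\<^sub>R (1, 0) + (0, w))" by simp
  also have "\<dots> = b * strip_diff u i (x, z) (1, 0) + strip_diff u i (x, z) (0, w)"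
    by (simp only: linear_add[OF lin] linear_cmul[OF lin] real_scaleR_def)
  finally show ?thesis unfolding eq dx_chart[OF u i x z] coord_diff_eq[OF i z C1_strip_slice[OF u i x z]] .
qed

text \<open>The factors of the product are orthogonal and the metric is multiplied by \<open>f x\<close>.\<close>

lemma coord_grad_W:
  fixes u :: "real \<times> 'k \<Rightarrow> real"
  assumes u: "C1_strip u" and i: "i \<in> index K" and x: "x \<in> {0..1}" and z: "z \<in> coord_range K i"
  shows "coord_grad W i u (x, z) = (dx u (x, param K i z) / f x, (1 / f x) *\<^sub>R coord_grad K i (\<lambda>p. u (x, p)) z)"
  unfolding coord_grad_def[of W]
proof (rule the_equality)
  note bil = metric_bilinear[OF i z] and d = C1_strip_differentiable_fun[OF u x] and fx = f_pos[OF x]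
  let ?g = "coord_grad K i (\<lambda>p. u (x, p)) z"
  show "\<forall>w. metric W i (x, z) (dx u (x, param K i z) / f x, (1 / f x) *\<^sub>R ?g) w = coord_diff W i u (x, z) w"
  proof
    fix bw :: "real \<times> 'e"
    obtain b w where bw: "bw = (b, w)" by (cases bw)
    show "metric W i (x, z) (dx u (x, param K i z) / f x, (1 / f x) *\<^sub>R ?g) bw = coord_diff W i u (x, z) bw"
      unfolding bw W_simps coord_diff_W[OF assms] bilinear_lmul[OF bil] coord_grad[OF d i z]
      using fx by (simp add: field_simps)
  qed
  fix av assume *: "\<forall>w. metric W i (x, z) av w = coord_diff W i u (x, z) w"
  obtain a v where av: "av = (a, v)" by (cases av)
  have eq: "f x * (a * b + metric K i z v w) = b * dx u (x, param K i z) + coord_diff K i (\<lambda>p. u (x, p)) z w" for b w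
    using *[rule_format, of "(b, w)"] unfolding av W_simps coord_diff_W[OF assms] .
  have "coord_diff K i (\<lambda>p. u (x, p)) z 0 = 0"
    using linear_0[OF has_derivative_linear[OF coord_diff_has_derivative[OF d i z]]] .
  then have "f x * a = dx u (x, param K i z)" using eq[of 1 0] bilinear_rzero[OF bil] by simp
  moreover have "?g = f x *\<^sub>R v"
    by (rule coord_grad_eqI[OF d i z]) (use eq[of 0] in \<open>simp add: bilinear_lmul[OF bil]\<close>)
  ultimately show "av = (dx u (x, param K i z) / f x, (1 / f x) *\<^sub>R ?g)"
    unfolding av using fx by (auto simp: field_simps)
qed

lemma real_grad_inner_W:
  fixes u h :: "real \<times> 'k \<Rightarrow> real"
  assumes u: "C1_strip u" and h: "C1_strip h" and x: "x \<in> {0..1}"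
  shows "real_grad_inner W u h (x, p) = (dx u (x, p) * dx h (x, p) + real_grad_inner K (\<lambda>p. u (x, p)) (\<lambda>p. h (x, p)) p) / f x"
proof -
  define i where "i = (SOME i. i \<in> index K \<and> p \<in> chart_dom K i)"
  obtain j where "j \<in> index K" "p \<in> chart_dom K j" by (rule exists_chart)
  then have i: "i \<in> index K" "p \<in> chart_dom K i" unfolding i_def by (metis (mono_tags, lifting) someI)+
  have iW: "(SOME i. i \<in> index W \<and> (x, p) \<in> chart_dom W i) = i" unfolding i_def W_simps using x by simp
  note z = coord_in[OF i]
  note bil = metric_bilinear[OF i(1) z]
  note d = C1_strip_differentiable_fun[OF u x] C1_strip_differentiable_fun[OF h x]
  have "real_grad_inner W u h (x, p) = metric W i (x, coord K i p) (coord_grad W i u (x, coord K i p)) (coord_grad W i h (x, coord K i p))"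
    unfolding real_grad_inner_def iW Let_def W_simps(3) ..
  also have "\<dots> = f x * (dx u (x, p) / f x * (dx h (x, p) / f x) + 1 / f x * (1 / f x * real_grad_inner K (\<lambda>p. u (x, p)) (\<lambda>p. h (x, p)) p))"
    unfolding coord_grad_W[OF u i(1) x z] coord_grad_W[OF h i(1) x z] W_simps param_coord[OF i] real_grad_inner_chart[OF d i]
    by (simp add: bilinear_lmul[OF bil] bilinear_rmul[OF bil])
  also have "\<dots> = (dx u (x, p) * dx h (x, p) + real_grad_inner K (\<lambda>p. u (x, p)) (\<lambda>p. h (x, p)) p) / f x"
    using f_pos[OF x] by (simp add: field_simps)
  finally show ?thesis .
qed

lemma grad_inner_W:
  assumes u: "C1_strip u" and h: "C1_strip h" and x: "x \<in> {0..1}"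
  shows "grad_inner W u h (x, p) = (dx u (x, p) * cnj (dx h (x, p)) + grad_inner K (\<lambda>p. u (x, p)) (\<lambda>p. h (x, p)) p) / of_real (f x)"
  unfolding grad_inner_def o_def
  by (simp add: complex_eq_iff real_grad_inner_W[OF C1_strip_Re_Im(1)[OF u] C1_strip_Re_Im(1)[OF h] x]
     real_grad_inner_W[OF C1_strip_Re_Im(1)[OF u] C1_strip_Re_Im(2)[OF h] x]
     real_grad_inner_W[OF C1_strip_Re_Im(2)[OF u] C1_strip_Re_Im(1)[OF h] x]
     real_grad_inner_W[OF C1_strip_Re_Im(2)[OF u] C1_strip_Re_Im(2)[OF h] x]
     dx_Re_Im[OF u x] dx_Re_Im[OF h x] algebra_simps add_divide_distrib diff_divide_distrib)

lemma grad_inner_K_cont: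
  assumes u: "C1_strip u" and h: "C1_strip h"
  shows "continuous_on ({0..1} \<times> UNIV) (\<lambda>q. grad_inner K (\<lambda>p. u (fst q, p)) (\<lambda>p. h (fst q, p)) (snd q))"
proof -
  note c = real_grad_inner_cont[OF C1_strip_Re_Im(1)[OF u] C1_strip_Re_Im(1)[OF h]]
     real_grad_inner_cont[OF C1_strip_Re_Im(1)[OF u] C1_strip_Re_Im(2)[OF h]]
     real_grad_inner_cont[OF C1_strip_Re_Im(2)[OF u] C1_strip_Re_Im(1)[OF h]]
     real_grad_inner_cont[OF C1_strip_Re_Im(2)[OF u] C1_strip_Re_Im(2)[OF h]]
  show ?thesis unfolding grad_inner_def o_def Complex_eq
    by (intro continuous_intros) (use c in \<open>simp_all add: case_prod_beta'\<close>)
qed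

lemma grad_inner_tensor:
  assumes u: "C1_strip u" and y: "cdifferentiable_fun y" and x: "x \<in> {0..1}"
  shows "grad_inner K (\<lambda>p. u (x, p)) (\<lambda>p. tensor P y (x, p)) p = of_real (poly P x) * grad_inner K (\<lambda>p. u (x, p)) y p"
  using grad_inner_linear_right[OF C1_strip_cdifferentiable_fun[OF u x] y y, of "poly P x" 0 p]
  by (simp add: tensor_def scaleR_conv_of_real)

section \<open>Integration on the product and on its boundary\<close>

sublocale radial: finite_measure radial_measure by (rule finite_radial)
sublocale ends: finite_measure end_measure by (rule finite_end)
sublocale V: finite_measure V by (rule finite_V)
sublocale RV: pair_sigma_finite radial_measure V ..
sublocale EV: pair_sigma_finite end_measure V ..

lemma space_M: "space M = {0..1} \<times> UNIV"
  unfolding M_product[symmetric] by (simp add: space_pair_measure space_radial space_V)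

lemma finite_M: "finite_measure M"
proof -
  interpret P: finite_measure "radial_measure \<Otimes>\<^sub>M V" by (rule finite_measure_pair_measure) unfold_locales
  show ?thesis using P.finite_measure_axioms unfolding M_product .
qed

lemma finite_\<sigma>: "finite_measure \<sigma>"
proof -
  interpret P: finite_measure "end_measure \<Otimes>\<^sub>M V" by (rule finite_measure_pair_measure) unfold_locales
  show ?thesis using P.finite_measure_axioms unfolding bdry_product .
qed

lemma sets_M: "sets M = sets (restrict_space borel ({0..1} \<times> UNIV))"
  using M unfolding riemannian_volume_def points_W by blast

lemma sets_\<sigma>: "sets \<sigma> = sets (restrict_space borel ({0, 1} \<times> UNIV))"
  using \<sigma> unfolding riemannian_volume_def points_bdry by blast

lemma cont_measurable_M:
  fixes F :: "real \<times> 'k \<Rightarrow> 'b::topological_space"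
  assumes "continuous_on ({0..1} \<times> UNIV) F" shows "F \<in> borel_measurable M"
  using borel_measurable_continuous_on_restrict[OF assms] sets_M by (simp cong: measurable_cong_sets)

lemma cont_measurable_\<sigma>:
  fixes F :: "real \<times> 'k \<Rightarrow> 'b::topological_space"
  assumes "continuous_on ({0..1} \<times> UNIV) F" shows "F \<in> borel_measurable \<sigma>"
proof -
  have "continuous_on ({0, 1} \<times> UNIV) F" by (rule continuous_on_subset[OF assms]) auto
  then show ?thesis using borel_measurable_continuous_on_restrict sets_\<sigma> by (simp cong: measurable_cong_sets)
qed

lemma cont_bounded_strip:
  fixes F :: "real \<times> 'k \<Rightarrow> 'b::real_normed_vector"
  assumes "continuous_on ({0..1} \<times> UNIV) F"
  obtains C where "C > 0" "\<And>x p. x \<in> {0..1} \<Longrightarrow> norm (F (x, p)) \<le> C"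
proof -
  have "bounded (F ` ({0..1} \<times> UNIV))"
    by (intro compact_imp_bounded compact_continuous_image assms compact_Times compact_K compact_Icc)
  then obtain C where "\<forall>y\<in>F ` ({0..1} \<times> UNIV). norm y \<le> C" unfolding bounded_iff by blast
  then have "norm (F (x, p)) \<le> C" if "x \<in> {0..1}" for x p using that by blast
  then have "norm (F (x, p)) \<le> \<bar>C\<bar> + 1" if "x \<in> {0..1}" for x p using that by (meson abs_ge_self add_increasing2 order_trans zero_le_one)
  then show ?thesis by (intro that[of "\<bar>C\<bar> + 1"]) auto
qed

lemma cont_integrable_M:
  fixes F :: "real \<times> 'k \<Rightarrow> 'b::{banach, second_countable_topology}"
  assumes "continuous_on ({0..1} \<times> UNIV) F" shows "integrable M F"
proof -
  obtain C where C: "C > 0" "\<And>x p. x \<in> {0..1} \<Longrightarrow> norm (F (x, p)) \<le> C" by (rule cont_bounded_strip[OF assms]) blast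
  interpret finite_measure M by (rule finite_M)
  show ?thesis
    by (rule integrable_const_bound[where B = C]) (use C cont_measurable_M[OF assms] in \<open>auto simp: space_M\<close>)
qed

lemma cont_measurable_V:
  fixes F :: "real \<times> 'k \<Rightarrow> 'b::topological_space"
  assumes "continuous_on ({0..1} \<times> UNIV) F" "x \<in> {0..1}" shows "(\<lambda>p. F (x, p)) \<in> borel_measurable V"
proof -
  have "continuous_on UNIV (\<lambda>p. F (x, p))"
    by (rule continuous_on_compose2[OF assms(1)]) (use assms(2) in \<open>auto intro!: continuous_intros\<close>)
  then have "(\<lambda>p. F (x, p)) \<in> borel_measurable borel" by (rule borel_measurable_continuous_onI)
  then show ?thesis using sets_V by (simp cong: measurable_cong_sets)
qed

lemma cont_integrable_V:
  fixes F :: "real \<times> 'k \<Rightarrow> 'b::{banach, second_countable_topology}"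
  assumes F: "continuous_on ({0..1} \<times> UNIV) F" and x: "x \<in> {0..1}" shows "integrable V (\<lambda>p. F (x, p))"
proof -
  obtain C where C: "C > 0" "\<And>x p. x \<in> {0..1} \<Longrightarrow> norm (F (x, p)) \<le> C" by (rule cont_bounded_strip[OF F]) blast
  show ?thesis
    by (rule V.integrable_const_bound[where B = C]) (use C x cont_measurable_V[OF F x] in auto)
qed

lemma integral_M:
  fixes F :: "real \<times> 'k \<Rightarrow> 'b::{banach, second_countable_topology}"
  assumes "continuous_on ({0..1} \<times> UNIV) F"
  shows "(LINT q|M. F q) = (LINT x|radial_measure. LINT p|V. F (x, p))"
    and "integrable radial_measure (\<lambda>x. LINT p|V. F (x, p))"
  using RV.integral_fst[of "\<lambda>x p. F (x, p)"] RV.integrable_fst[of "\<lambda>x p. F (x, p)"] cont_integrable_M[OF assms]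
  unfolding M_product by (auto simp: case_prod_beta')

lemma integral_radial:
  fixes G :: "real \<Rightarrow> 'b::euclidean_space"
  assumes G: "continuous_on {0..1} G"
  shows "(LINT x|radial_measure. G x) = integral {0..1} (\<lambda>x. vol_weight n f x *\<^sub>R G x)"
proof -
  have c: "continuous_on {0..1} (\<lambda>x. vol_weight n f x *\<^sub>R G x)" by (intro continuous_intros vol_weight_cont G)
  have "(LINT x|radial_measure. G x) = (LINT x|restrict_space lborel {0..1}. vol_weight n f x *\<^sub>R G x)"
    unfolding radial_measure_def
  proof (rule integral_density)
    show "G \<in> borel_measurable (restrict_space lborel {0..1})"
      using borel_measurable_continuous_on_restrict[OF G] by (simp cong: measurable_cong_sets)
    show "AE x in restrict_space lborel {0..1}. 0 \<le> vol_weight n f x"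
      by (rule AE_I2) (auto simp: space_restrict_space intro!: less_imp_le vol_weight_pos)
  qed (rule vol_weight_measurable)
  also have "\<dots> = (LINT x:{0..1}|lborel. vol_weight n f x *\<^sub>R G x)"
    unfolding set_lebesgue_integral_def by (rule integral_restrict_space) simp
  also have "\<dots> = integral {0..1} (\<lambda>x. vol_weight n f x *\<^sub>R G x)"
    by (rule set_borel_integral_eq_integral(2)) (rule borel_integrable_compact[OF compact_Icc c, folded set_integrable_def])
  finally show ?thesis .
qed

lemma integral_end:
  fixes G :: "real \<Rightarrow> 'b::{banach, second_countable_topology}"
  shows "(LINT x|end_measure. G x) = sqrt (f 0 ^ DIM('e)) *\<^sub>R G 0 + sqrt (f 1 ^ DIM('e)) *\<^sub>R G 1"
proof -
  have "(LINT x|end_measure. G x) = (LINT x|count_space {0, 1}. sqrt (f x ^ DIM('e)) *\<^sub>R G x)"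
    unfolding end_measure_def
    by (rule integral_density) (use f_pos in \<open>auto intro!: AE_I2 less_imp_le\<close>)
  also have "\<dots> = (\<Sum>x\<in>{0, 1}. sqrt (f x ^ DIM('e)) *\<^sub>R G x)"
    by (rule lebesgue_integral_count_space_finite) simp
  finally show ?thesis by simp
qed

lemma integral_\<sigma>:
  fixes F :: "real \<times> 'k \<Rightarrow> 'b::{banach, second_countable_topology}"
  assumes "integrable \<sigma> F"
  shows "(LINT q|\<sigma>. F q) = sqrt (f 0 ^ DIM('e)) *\<^sub>R (LINT p|V. F (0, p)) + sqrt (f 1 ^ DIM('e)) *\<^sub>R (LINT p|V. F (1, p))"
  using EV.integral_fst[of "\<lambda>x p. F (x, p)"] assms unfolding bdry_product integral_end
  by (simp add: case_prod_beta')

end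

section \<open>Interchange of limits\<close>

text \<open>Moore--Osgood, with Cauchy's criterion in \<open>l\<close> uniform in large \<open>k\<close>.\<close>

lemma tendsto_interchange:
  fixes A :: "nat \<Rightarrow> nat \<Rightarrow> complex"
  assumes A: "\<And>l. (\<lambda>k. A k l) \<longlonglongrightarrow> B l" and Ai: "\<And>k. (\<lambda>l. A k l) \<longlonglongrightarrow> Ai k"
    and unif: "\<And>e. e > 0 \<Longrightarrow> \<exists>N. \<forall>k\<ge>N. \<forall>l\<ge>N. \<forall>l'\<ge>N. cmod (A k l - A k l') \<le> e"
    and B: "B \<longlonglongrightarrow> b"
  shows "Ai \<longlonglongrightarrow> b"
proof (rule LIMSEQ_I)
  fix e :: real assume "e > 0"
  then have e: "e / 4 > 0" by simp
  obtain N where N: "\<And>k l l'. k \<ge> N \<Longrightarrow> l \<ge> N \<Longrightarrow> l' \<ge> N \<Longrightarrow> cmod (A k l - A k l') \<le> e / 4"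
    using unif[OF e] by blast
  obtain N1 where N1: "\<And>l. l \<ge> N1 \<Longrightarrow> cmod (B l - b) < e / 4" using LIMSEQ_D[OF B e] by blast
  define l where "l = max N N1"
  obtain N2 where N2: "\<And>k. k \<ge> N2 \<Longrightarrow> cmod (A k l - B l) < e / 4" using LIMSEQ_D[OF A e] by blast
  have close: "cmod (A k l - Ai k) \<le> e / 4" if "k \<ge> N" for k
  proof (rule Lim_bounded)
    show "(\<lambda>l'. cmod (A k l - A k l')) \<longlonglongrightarrow> cmod (A k l - Ai k)" by (intro tendsto_intros Ai)
    show "\<forall>l'\<ge>N. cmod (A k l - A k l') \<le> e / 4" using N that unfolding l_def by simp
  qed
  show "\<exists>no. \<forall>k\<ge>no. cmod (Ai k - b) < e"
  proof (intro exI allI impI)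
    fix k assume k: "k \<ge> max N N2"
    have "cmod (Ai k - b) = cmod ((Ai k - A k l) + (A k l - B l) + (B l - b))" by simp
    also have "\<dots> \<le> cmod (Ai k - A k l) + cmod (A k l - B l) + cmod (B l - b)"
      by (intro order_trans[OF norm_triangle_ineq] add_mono norm_triangle_ineq order_refl)
    also have "\<dots> < e" using close[of k] N2[of k] N1[of l] k \<open>e > 0\<close> unfolding l_def by (simp add: norm_minus_commute)
    finally show "cmod (Ai k - b) < e" .
  qed
qed

lemma cmod_mult_bound: assumes "t > 0" shows "cmod (u * cnj v) \<le> t * (cmod u)\<^sup>2 + (cmod v)\<^sup>2 / t"
  using weighted_amgm[OF assms, of "cmod u" "cmod v"] by (simp add: norm_mult)

lemma cmod_sq_le_double: "(cmod u)\<^sup>2 \<le> 2 * (cmod (u - v))\<^sup>2 + 2 * (cmod v)\<^sup>2"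
proof -
  have "(cmod u)\<^sup>2 \<le> (cmod (u - v) + cmod v)\<^sup>2"
    using norm_triangle_ineq[of "u - v" v] by (intro power_mono) auto
  also have "\<dots> \<le> 2 * (cmod (u - v))\<^sup>2 + 2 * (cmod v)\<^sup>2"
    using sum_squares_bound[of "cmod (u - v)" "cmod v"] by (simp add: power2_sum)
  finally show ?thesis .
qed

section \<open>Square-integrable functions\<close>

lemma L2_D: "u \<in> L2 \<mu> \<Longrightarrow> u \<in> borel_measurable \<mu>" "u \<in> L2 \<mu> \<Longrightarrow> integrable \<mu> (\<lambda>p. (cmod (u p))\<^sup>2)"
  unfolding L2_def by auto

lemma L2_prod_integrable:
  assumes "u \<in> L2 \<mu>" "v \<in> L2 \<mu>" shows "integrable \<mu> (\<lambda>p. u p * cnj (v p))"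
proof (rule Bochner_Integration.integrable_bound)
  show "integrable \<mu> (\<lambda>p. (cmod (u p))\<^sup>2 + (cmod (v p))\<^sup>2)" using assms by (intro Bochner_Integration.integrable_add L2_D)
  have "cnj \<in> borel_measurable borel" by (intro borel_measurable_continuous_onI continuous_intros)
  from measurable_compose[OF L2_D(1)[OF assms(2)] this]
  show "(\<lambda>p. u p * cnj (v p)) \<in> borel_measurable \<mu>" by (rule borel_measurable_times[OF L2_D(1)[OF assms(1)]])
  show "AE p in \<mu>. norm (u p * cnj (v p)) \<le> norm ((cmod (u p))\<^sup>2 + (cmod (v p))\<^sup>2)"
    using cmod_mult_bound[of 1] by (intro AE_I2) simp
qed

lemma L2_diff: assumes "u \<in> L2 \<mu>" "v \<in> L2 \<mu>" shows "(\<lambda>p. u p - v p) \<in> L2 \<mu>"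
proof -
  have m: "(\<lambda>p. u p - v p) \<in> borel_measurable \<mu>" using L2_D(1)[OF assms(1)] L2_D(1)[OF assms(2)] by measurable
  have "integrable \<mu> (\<lambda>p. (cmod (u p - v p))\<^sup>2)"
  proof (rule Bochner_Integration.integrable_bound)
    show "integrable \<mu> (\<lambda>p. 2 * (cmod (u p))\<^sup>2 + 2 * (cmod (v p))\<^sup>2)"
      using assms by (intro Bochner_Integration.integrable_add integrable_mult_right L2_D)
    show "(\<lambda>p. (cmod (u p - v p))\<^sup>2) \<in> borel_measurable \<mu>" using m by measurable
    show "AE p in \<mu>. norm ((cmod (u p - v p))\<^sup>2) \<le> norm (2 * (cmod (u p))\<^sup>2 + 2 * (cmod (v p))\<^sup>2)"
    proof (rule AE_I2)
      fix p show "norm ((cmod (u p - v p))\<^sup>2) \<le> norm (2 * (cmod (u p))\<^sup>2 + 2 * (cmod (v p))\<^sup>2)"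
        using cmod_sq_le_double[of "u p - v p" "- v p"] by simp
    qed
  qed
  then show ?thesis using m unfolding L2_def by blast
qed

lemma L2_scale: assumes "u \<in> L2 \<mu>" shows "(\<lambda>p. c * u p) \<in> L2 \<mu>"
  using assms unfolding L2_def by (auto simp: norm_mult power_mult_distrib)

lemma L2_prod_bound:
  assumes "u \<in> L2 \<mu>" "v \<in> L2 \<mu>" "t > 0"
  shows "cmod (LINT p|\<mu>. u p * cnj (v p)) \<le> t * (LINT p|\<mu>. (cmod (u p))\<^sup>2) + (LINT p|\<mu>. (cmod (v p))\<^sup>2) / t"
proof -
  have i: "integrable \<mu> (\<lambda>p. t * (cmod (u p))\<^sup>2 + (cmod (v p))\<^sup>2 / t)"
    using assms by (intro Bochner_Integration.integrable_add integrable_mult_right integrable_divide L2_D)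
  have "cmod (LINT p|\<mu>. u p * cnj (v p)) \<le> (LINT p|\<mu>. t * (cmod (u p))\<^sup>2 + (cmod (v p))\<^sup>2 / t)"
    by (rule order_trans[OF integral_norm_bound], rule integral_mono)
       (use L2_prod_integrable[OF assms(1,2)] i cmod_mult_bound[OF assms(3)] in auto)
  also have "\<dots> = t * (LINT p|\<mu>. (cmod (u p))\<^sup>2) + (LINT p|\<mu>. (cmod (v p))\<^sup>2) / t"
    using L2_D(2)[OF assms(1)] L2_D(2)[OF assms(2)] by simp
  finally show ?thesis .
qed

text \<open>Bessel's inequality for a single unit vector: expand the norm of \<open>v - c * Y\<close>, where \<open>c\<close> is the coefficient.\<close>

lemma Bessel:
  assumes Y: "Y \<in> L2 \<mu>" "L2_inner \<mu> Y Y = 1" and v: "v \<in> L2 \<mu>"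
  shows "(cmod (LINT p|\<mu>. v p * cnj (Y p)))\<^sup>2 \<le> (LINT p|\<mu>. (cmod (v p))\<^sup>2)"
proof -
  define c where "c = (LINT p|\<mu>. v p * cnj (Y p))"
  have cY: "(\<lambda>p. c * Y p) \<in> L2 \<mu>" by (rule L2_scale[OF Y(1)])
  note i = L2_prod_integrable[OF v v] L2_prod_integrable[OF v Y(1)] L2_prod_integrable[OF Y(1) v] L2_prod_integrable[OF Y(1) Y(1)]
  have "(LINT p|\<mu>. (v p - c * Y p) * cnj (v p - c * Y p)) = 
     (LINT p|\<mu>. (v p * cnj (v p) - cnj c * (v p * cnj (Y p))) - (c * (Y p * cnj (v p)) - c * cnj c * (Y p * cnj (Y p))))"
    by (rule Bochner_Integration.integral_cong) (auto simp: algebra_simps)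
  also have "\<dots> = (LINT p|\<mu>. v p * cnj (v p)) - cnj c * (LINT p|\<mu>. v p * cnj (Y p)) - (c * (LINT p|\<mu>. Y p * cnj (v p)) - c * cnj c * (LINT p|\<mu>. Y p * cnj (Y p)))"
    using i by simp
  also have "(LINT p|\<mu>. Y p * cnj (v p)) = cnj c"
    unfolding c_def Bochner_Integration.integral_cnj[symmetric] by (rule Bochner_Integration.integral_cong) auto
  also have "(LINT p|\<mu>. Y p * cnj (Y p)) = 1" using Y(2) unfolding L2_inner_def .
  finally have eq: "(LINT p|\<mu>. (v p - c * Y p) * cnj (v p - c * Y p)) = (LINT p|\<mu>. v p * cnj (v p)) - c * cnj c"
    unfolding c_def[symmetric] by simp
  have sq: "(LINT p|\<mu>. w p * cnj (w p)) = of_real (LINT p|\<mu>. (cmod (w p))\<^sup>2)" for w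
    unfolding integral_complex_of_real[symmetric] by (rule Bochner_Integration.integral_cong) (auto simp: complex_norm_square[symmetric])
  have "of_real (LINT p|\<mu>. (cmod (v p - c * Y p))\<^sup>2) = complex_of_real ((LINT p|\<mu>. (cmod (v p))\<^sup>2) - (cmod c)\<^sup>2)"
    unfolding of_real_diff complex_norm_square[of c] using eq unfolding sq .
  then have "(LINT p|\<mu>. (cmod (v p - c * Y p))\<^sup>2) = (LINT p|\<mu>. (cmod (v p))\<^sup>2) - (cmod c)\<^sup>2" 
    by (simp only: of_real_eq_iff)
  moreover have "0 \<le> (LINT p|\<mu>. (cmod (v p - c * Y p))\<^sup>2)" by (rule Bochner_Integration.integral_nonneg) simp
  ultimately show ?thesis unfolding c_def by simp
qed

lemma L2_tendsto_inner:
  assumes v: "v \<in> L2 \<mu>" and y: "\<And>l. y l \<in> L2 \<mu>" and Y: "Y \<in> L2 \<mu>" and lim: "L2_tendsto \<mu> y Y"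
  shows "(\<lambda>l. LINT p|\<mu>. v p * cnj (y l p)) \<longlonglongrightarrow> (LINT p|\<mu>. v p * cnj (Y p))"
proof (rule LIMSEQ_I)
  fix e :: real assume e: "e > 0"
  define C where "C = (LINT p|\<mu>. (cmod (v p))\<^sup>2) + 1"
  have C: "C > 0" unfolding C_def by (intro add_nonneg_pos Bochner_Integration.integral_nonneg) auto
  define t where "t = e / (4 * C)"
  have t: "t > 0" unfolding t_def using e C by simp
  have "e * t / 4 > 0" using e t by simp
  from LIMSEQ_D[OF lim[unfolded L2_tendsto_def] this] obtain N where
    N: "\<And>l. l \<ge> N \<Longrightarrow> norm ((LINT p|\<mu>. (cmod (y l p - Y p))\<^sup>2) - 0) < e * t / 4" by blast
  show "\<exists>no. \<forall>l\<ge>no. norm ((LINT p|\<mu>. v p * cnj (y l p)) - (LINT p|\<mu>. v p * cnj (Y p))) < e"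
  proof (intro exI allI impI)
    fix l assume l: "l \<ge> N"
    have "(LINT p|\<mu>. v p * cnj (y l p)) - (LINT p|\<mu>. v p * cnj (Y p)) = (LINT p|\<mu>. v p * cnj (y l p - Y p))"
      using L2_prod_integrable[OF v y[of l]] L2_prod_integrable[OF v Y] by (simp add: algebra_simps)
    also have "cmod \<dots> \<le> t * (LINT p|\<mu>. (cmod (v p))\<^sup>2) + (LINT p|\<mu>. (cmod (y l p - Y p))\<^sup>2) / t"
      by (rule L2_prod_bound[OF v L2_diff[OF y Y] t])
    also have "\<dots> \<le> t * C + (e * t / 4) / t"
      using t N[OF l] unfolding C_def by (intro add_mono mult_left_mono divide_right_mono) auto
    also have "\<dots> < e" unfolding t_def using e C by (simp add: field_simps)
    finally show "norm ((LINT p|\<mu>. v p * cnj (y l p)) - (LINT p|\<mu>. v p * cnj (Y p))) < e" .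
  qed
qed

context warped_measure
begin

lemma cont_L2_V: "continuous_on ({0..1} \<times> UNIV) (F :: real \<times> 'k \<Rightarrow> complex) \<Longrightarrow> x \<in> {0..1} \<Longrightarrow> (\<lambda>p. F (x, p)) \<in> L2 V"
  unfolding L2_def using cont_measurable_V[of F x] cont_integrable_V[of "\<lambda>q. (cmod (F q))\<^sup>2" x]
  by (simp add: continuous_on_power continuous_on_norm)

lemma L2_V_integrable: assumes Y: "Y \<in> L2 V" shows "integrable V Y" "integrable V (\<lambda>p. cmod (Y p))"
proof -
  have "(\<lambda>p. 1) \<in> L2 V" unfolding L2_def by simp
  from L2_prod_integrable[OF Y this] show "integrable V Y" by simp
  then show "integrable V (\<lambda>p. cmod (Y p))" by (rule integrable_norm)
qed

section \<open>Energies and the form of the Helmholtz equation\<close>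

definition energy_M :: "(real \<times> 'k \<Rightarrow> complex) \<Rightarrow> real" where
  "energy_M u = (LINT q|M. (cmod (u q))\<^sup>2 + Re (grad_inner W u u q))"

text \<open>The integrands of the energy and of the form, written with the radial derivative and the gradient along \<open>K\<close>.
They agree with those of the definitions on \<open>[0,1] \<times> K\<close> and are continuous there.\<close>

definition density_M :: "(real \<times> 'k \<Rightarrow> complex) \<Rightarrow> real \<times> 'k \<Rightarrow> real" where
  "density_M u q = (cmod (u q))\<^sup>2 + ((cmod (dx u q))\<^sup>2 + grad_sq (\<lambda>p. u (fst q, p)) (snd q)) / f (fst q)"

definition form_density :: "real \<Rightarrow> (real \<times> 'k \<Rightarrow> complex) \<Rightarrow> (real \<times> 'k \<Rightarrow> complex) \<Rightarrow> real \<times> 'k \<Rightarrow> complex" where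
  "form_density \<omega> u h q = (dx u q * cnj (dx h q) + grad_inner K (\<lambda>p. u (fst q, p)) (\<lambda>p. h (fst q, p)) (snd q)) / of_real (f (fst q)) - of_real \<omega> * u q * cnj (h q)"

lemma f_fst_cont: "continuous_on ({0..1} \<times> UNIV) (\<lambda>q :: real \<times> 'k. f (fst q))"
  by (rule continuous_on_compose2[OF f_cont]) (auto intro!: continuous_intros)

lemma form_density_cont:
  assumes u: "C1_strip u" and h: "C1_strip h"
  shows "continuous_on ({0..1} \<times> UNIV) (form_density \<omega> u h)"
  unfolding form_density_def[abs_def]
  by (intro continuous_intros C1_strip_cont[OF u] C1_strip_cont[OF h] dx_cont[OF u] dx_cont[OF h] grad_inner_K_cont[OF u h] f_fst_cont)
     (use f_pos in force)

lemma density_cont: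
  assumes u: "C1_strip u"
  shows "continuous_on ({0..1} \<times> UNIV) (density_M u)"
  unfolding density_M_def[abs_def] grad_sq_def
  by (intro continuous_intros C1_strip_cont[OF u] dx_cont[OF u] grad_inner_K_cont[OF u u] f_fst_cont) (use f_pos in force)

lemma energy_M_eq: assumes u: "C1_strip u" shows "energy_M u = (LINT q|M. density_M u q)"
  unfolding energy_M_def
proof (rule Bochner_Integration.integral_cong[OF refl])
  fix q assume "q \<in> space M"
  then obtain x p where q: "q = (x, p)" "x \<in> {0..1}" unfolding space_M by auto
  have "Re ((dx u (x, p) * cnj (dx u (x, p)) + grad_inner K (\<lambda>p. u (x, p)) (\<lambda>p. u (x, p)) p) / of_real (f x)) = ((cmod (dx u (x, p)))\<^sup>2 + grad_sq (\<lambda>p. u (x, p)) p) / f x"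
    by (simp add: grad_sq_def complex_norm_square[symmetric] cmod_power2 power2_eq_square)
  then show "(cmod (u q))\<^sup>2 + Re (grad_inner W u u q) = density_M u q"
    unfolding q(1) grad_inner_W[OF u u q(2)] density_M_def by simp
qed

lemma density_nonneg: assumes u: "C1_strip u" and x: "x \<in> {0..1}" shows "0 \<le> density_M u (x, p)"
  unfolding density_M_def using grad_sq_nonneg[OF C1_strip_cdifferentiable_fun[OF u x]] f_pos[OF x]
  by (auto intro!: add_nonneg_nonneg divide_nonneg_pos)

lemma energy_M_nonneg: assumes u: "C1_strip u" shows "0 \<le> energy_M u"
  unfolding energy_M_eq[OF u]
  by (rule Bochner_Integration.integral_nonneg_AE, rule AE_I2) (auto simp: space_M intro: density_nonneg[OF u])

lemma H1_norm_W: "C1_strip u \<Longrightarrow> (H1_norm W M u)\<^sup>2 = energy_M u"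
  using energy_M_nonneg[of u] unfolding H1_norm_def energy_M_def by simp

lemma form_density_bound:
  assumes u: "C1_strip u" and h: "C1_strip h" and x: "x \<in> {0..1}" and t: "t > 0"
  shows "cmod (form_density \<omega> u h (x, p)) \<le> (1 + \<bar>\<omega>\<bar>) * (t * density_M u (x, p) + density_M h (x, p) / t)"
proof -
  note fx = f_pos[OF x]
  note d = C1_strip_cdifferentiable_fun[OF u x] C1_strip_cdifferentiable_fun[OF h x]
  let ?G = "grad_inner K (\<lambda>p. u (x, p)) (\<lambda>p. h (x, p)) p"
  have "cmod ((dx u (x, p) * cnj (dx h (x, p)) + ?G) / of_real (f x)) \<le> (cmod (dx u (x, p) * cnj (dx h (x, p))) + cmod ?G) / f x"
    using fx norm_triangle_ineq[of "dx u (x, p) * cnj (dx h (x, p))" ?G] by (simp add: norm_divide divide_right_mono)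
  also have "\<dots> \<le> ((t * (cmod (dx u (x, p)))\<^sup>2 + (cmod (dx h (x, p)))\<^sup>2 / t) + (t * grad_sq (\<lambda>p. u (x, p)) p + grad_sq (\<lambda>p. h (x, p)) p / t)) / f x"
    using fx by (intro divide_right_mono add_mono cmod_mult_bound[OF t] grad_inner_bound[OF d t]) auto
  also have "\<dots> = t * (density_M u (x, p) - (cmod (u (x, p)))\<^sup>2) + (density_M h (x, p) - (cmod (h (x, p)))\<^sup>2) / t"
    unfolding density_M_def using fx t by (simp add: field_simps)
  also have "\<dots> \<le> t * density_M u (x, p) + density_M h (x, p) / t"
    using t by (intro add_mono mult_left_mono divide_right_mono) auto
  finally have 1: "cmod ((dx u (x, p) * cnj (dx h (x, p)) + ?G) / of_real (f x)) \<le> t * density_M u (x, p) + density_M h (x, p) / t" .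
  have le: "(cmod (v (x, p)))\<^sup>2 \<le> density_M v (x, p)" if "C1_strip v" for v
    unfolding density_M_def using grad_sq_nonneg[OF C1_strip_cdifferentiable_fun[OF that x]] fx by simp
  have "cmod (u (x, p) * cnj (h (x, p))) \<le> t * (cmod (u (x, p)))\<^sup>2 + (cmod (h (x, p)))\<^sup>2 / t" by (rule cmod_mult_bound[OF t])
  also have "\<dots> \<le> t * density_M u (x, p) + density_M h (x, p) / t"
    using t le[OF u] le[OF h] by (intro add_mono mult_left_mono divide_right_mono) auto
  finally have 2: "cmod (of_real \<omega> * u (x, p) * cnj (h (x, p))) \<le> \<bar>\<omega>\<bar> * (t * density_M u (x, p) + density_M h (x, p) / t)"
    unfolding mult.assoc norm_mult[of "of_real \<omega>"] by (simp add: mult_left_mono)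
  show ?thesis unfolding form_density_def fst_conv snd_conv
    by (rule order_trans[OF norm_triangle_ineq4]) (use 1 2 in \<open>simp add: algebra_simps add_divide_distrib\<close>)
qed

definition form_M :: "real \<Rightarrow> (real \<times> 'k \<Rightarrow> complex) \<Rightarrow> (real \<times> 'k \<Rightarrow> complex) \<Rightarrow> complex" where
  "form_M \<omega> u h = (LINT q|M. grad_inner W u h q - of_real \<omega> * u q * cnj (h q))"

lemma form_M_eq:
  assumes u: "C1_strip u" and h: "C1_strip h"
  shows "form_M \<omega> u h = (LINT q|M. form_density \<omega> u h q)"
  unfolding form_M_def
  by (rule Bochner_Integration.integral_cong[OF refl]) (auto simp: space_M form_density_def grad_inner_W[OF u h])

lemma form_M_bound:
  assumes u: "C1_strip u" and h: "C1_strip h" and t: "t > 0"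
  shows "cmod (form_M \<omega> u h) \<le> (1 + \<bar>\<omega>\<bar>) * (t * energy_M u + energy_M h / t)"
proof -
  have i: "integrable M (density_M u)" "integrable M (density_M h)" by (intro cont_integrable_M density_cont u h)+
  have "cmod (form_M \<omega> u h) \<le> (LINT q|M. (1 + \<bar>\<omega>\<bar>) * (t * density_M u q + density_M h q / t))"
    unfolding form_M_eq[OF u h]
  proof (rule order_trans[OF integral_norm_bound], rule integral_mono)
    show "integrable M (\<lambda>q. cmod (form_density \<omega> u h q))"
      by (intro integrable_norm cont_integrable_M form_density_cont u h)
    show "integrable M (\<lambda>q. (1 + \<bar>\<omega>\<bar>) * (t * density_M u q + density_M h q / t))" using i by simp
    show "cmod (form_density \<omega> u h q) \<le> (1 + \<bar>\<omega>\<bar>) * (t * density_M u q + density_M h q / t)" if "q \<in> space M" for q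
      using that form_density_bound[OF u h _ t] unfolding space_M by auto
  qed
  also have "\<dots> = (1 + \<bar>\<omega>\<bar>) * (t * energy_M u + energy_M h / t)"
    unfolding energy_M_eq[OF u] energy_M_eq[OF h] using i by simp
  finally show ?thesis .
qed

lemma dx_diff:
  assumes u: "C1_strip u" and h: "C1_strip h" and x: "x \<in> {0..1}"
  shows "dx (\<lambda>q. u q - h q) (x, p) = dx u (x, p) - dx h (x, p)"
  unfolding dx_def[of "\<lambda>q. u q - h q"] fst_conv snd_conv
  by (rule vector_derivative_01[OF x]) (intro has_vector_derivative_diff dx_has_vector_derivative u h x)

lemma form_M_diff_right:
  assumes u: "C1_strip u" and g: "C1_strip g" and h: "C1_strip h"
  shows "form_M \<omega> u (\<lambda>q. g q - h q) = form_M \<omega> u g - form_M \<omega> u h"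
proof -
  note gh = C1_strip_diff[OF g h]
  have "form_density \<omega> u (\<lambda>q. g q - h q) (x, p) = form_density \<omega> u g (x, p) - form_density \<omega> u h (x, p)" if x: "x \<in> {0..1}" for x p
  proof -
    note d = C1_strip_cdifferentiable_fun[OF u x] C1_strip_cdifferentiable_fun[OF g x] C1_strip_cdifferentiable_fun[OF h x]
    have G: "grad_inner K (\<lambda>p. u (x, p)) (\<lambda>p. g (x, p) - h (x, p)) p = grad_inner K (\<lambda>p. u (x, p)) (\<lambda>p. g (x, p)) p - grad_inner K (\<lambda>p. u (x, p)) (\<lambda>p. h (x, p)) p"
      using grad_inner_linear_right[OF d, of 1 "-1" p] by simp
    show ?thesis unfolding form_density_def fst_conv snd_conv dx_diff[OF g h x] G using f_pos[OF x] by (simp add: field_simps)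
  qed
  then have "(LINT q|M. form_density \<omega> u (\<lambda>q. g q - h q) q) = (LINT q|M. form_density \<omega> u g q - form_density \<omega> u h q)"
    by (intro Bochner_Integration.integral_cong) (auto simp: space_M)
  also have "\<dots> = form_M \<omega> u g - form_M \<omega> u h"
    unfolding form_M_eq[OF u g] form_M_eq[OF u h]
    by (intro Bochner_Integration.integral_diff cont_integrable_M form_density_cont u g h)
  finally show ?thesis unfolding form_M_eq[OF u gh] .
qed

definition energy_K :: "('k \<Rightarrow> complex) \<Rightarrow> real" where
  "energy_K y = (LINT p|V. (cmod (y p))\<^sup>2 + grad_sq y p)"

lemma energy_K_density_cont:
  assumes y: "C1_strip (\<lambda>(x, p). y p)"
  shows "continuous_on ({0..1} \<times> UNIV) (\<lambda>(x::real, p). (cmod (y p))\<^sup>2 + grad_sq y p)"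
proof -
  have "continuous_on ({0..1::real} \<times> UNIV) (\<lambda>q. (cmod ((\<lambda>(x, p). y p) q))\<^sup>2 + Re (grad_inner K (\<lambda>p. (\<lambda>(x, p). y p) (fst q, p)) (\<lambda>p. (\<lambda>(x, p). y p) (fst q, p)) (snd q)))"
    by (intro continuous_intros C1_strip_cont[OF y] grad_inner_K_cont[OF y y])
  then show ?thesis unfolding grad_sq_def by (simp add: case_prod_beta')
qed

lemma lift_cdifferentiable: "C1_strip (\<lambda>(x, p). y p) \<Longrightarrow> cdifferentiable_fun (y :: 'k \<Rightarrow> complex)"
  using C1_strip_cdifferentiable_fun[of "\<lambda>(x, p). y p" 0] by simp

lemma energy_K_nonneg: assumes y: "C1_strip (\<lambda>(x, p). y p)" shows "0 \<le> energy_K y"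
  unfolding energy_K_def
  by (intro Bochner_Integration.integral_nonneg add_nonneg_nonneg grad_sq_nonneg[OF lift_cdifferentiable[OF y]]) auto

lemma H1_norm_K: "C1_strip (\<lambda>(x, p). y p) \<Longrightarrow> (H1_norm K V y)\<^sup>2 = energy_K y"
  using energy_K_nonneg[of y] unfolding H1_norm_def energy_K_def grad_sq_def by simp

lemma density_tensor_le:
  obtains B where "B > 0" "\<And>y x p. C1_strip (tensor P y) \<Longrightarrow> C1_strip (\<lambda>(x, p). y p) \<Longrightarrow> x \<in> {0..1} \<Longrightarrow>
    density_M (tensor P y) (x, p) \<le> B * ((cmod (y p))\<^sup>2 + grad_sq y p)"
proof -
  have "continuous_on {0..1} (\<lambda>x. (poly P x)\<^sup>2 + ((poly (pderiv P) x)\<^sup>2 + (poly P x)\<^sup>2) / f x)"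
    by (intro continuous_intros f_cont) (use f_pos in force)
  then obtain B where B: "B > 0" "\<And>x. x \<in> {0..1} \<Longrightarrow> \<bar>(poly P x)\<^sup>2 + ((poly (pderiv P) x)\<^sup>2 + (poly P x)\<^sup>2) / f x\<bar> \<le> B"
    by (rule cont_bounded01) blast
  have "density_M (tensor P y) (x, p) \<le> B * ((cmod (y p))\<^sup>2 + grad_sq y p)"
    if T: "C1_strip (tensor P y)" and y: "C1_strip (\<lambda>(x, p). y p)" and x: "x \<in> {0..1}" for y x p
  proof -
    note dy = lift_cdifferentiable[OF y]
    note gy = grad_sq_nonneg[OF dy, of p] and fx = f_pos[OF x]
    have g: "grad_sq (\<lambda>p. tensor P y (x, p)) p = (poly P x)\<^sup>2 * grad_sq y p"
    proof -
      have "grad_inner K (\<lambda>p. tensor P y (x, p)) (\<lambda>p. tensor P y (x, p)) p = of_real (poly P x) * grad_inner K (\<lambda>p. tensor P y (x, p)) y p"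
        by (rule grad_inner_tensor[OF T dy x])
      also have "grad_inner K (\<lambda>p. tensor P y (x, p)) y p = cnj (grad_inner K y (\<lambda>p. tensor P y (x, p)) p)"
        by (rule grad_inner_cnj[OF dy C1_strip_cdifferentiable_fun[OF T x]])
      also have "grad_inner K y (\<lambda>p. tensor P y (x, p)) p = of_real (poly P x) * grad_inner K y y p"
        using grad_inner_tensor[OF y dy x, of P p] by simp
      finally show ?thesis unfolding grad_sq_def by (simp add: power2_eq_square mult_ac)
    qed
    define Q where "Q = (poly P x)\<^sup>2 + ((poly (pderiv P) x)\<^sup>2 + (poly P x)\<^sup>2) / f x"
    have "density_M (tensor P y) (x, p) = ((poly P x)\<^sup>2 + (poly (pderiv P) x)\<^sup>2 / f x) * (cmod (y p))\<^sup>2 + ((poly P x)\<^sup>2 / f x) * grad_sq y p"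
      unfolding density_M_def fst_conv snd_conv tensor_dx[OF x] g
      using fx by (simp add: tensor_def power_mult_distrib field_simps)
    also have "\<dots> \<le> Q * (cmod (y p))\<^sup>2 + Q * grad_sq y p"
      unfolding Q_def using gy fx by (intro add_mono mult_right_mono) (auto simp: add_divide_distrib)
    also have "\<dots> \<le> B * (cmod (y p))\<^sup>2 + B * grad_sq y p"
      using B(2)[OF x] gy unfolding Q_def by (intro add_mono mult_right_mono) auto
    finally show ?thesis by (simp add: distrib_left)
  qed
  then show ?thesis using that[of B] B(1) by blast
qed

lemma energy_tensor_le:
  obtains C where "C > 0" "\<And>y. C1_strip (tensor P y) \<Longrightarrow> C1_strip (\<lambda>(x, p). y p) \<Longrightarrow> energy_M (tensor P y) \<le> C * energy_K y"
proof -
  obtain B where B: "B > 0" "\<And>y x p. C1_strip (tensor P y) \<Longrightarrow> C1_strip (\<lambda>(x, p). y p) \<Longrightarrow> x \<in> {0..1} \<Longrightarrow>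
    density_M (tensor P y) (x, p) \<le> B * ((cmod (y p))\<^sup>2 + grad_sq y p)" by (rule density_tensor_le) blast
  define C where "C = B * (measure radial_measure {0..1} + 1)"
  have "energy_M (tensor P y) \<le> C * energy_K y" if T: "C1_strip (tensor P y)" and y: "C1_strip (\<lambda>(x, p). y p)" for y
  proof -
    let ?e = "\<lambda>(x::real, p). (cmod (y p))\<^sup>2 + grad_sq y p"
    note ec = energy_K_density_cont[OF y]
    have ie: "integrable M (\<lambda>q. B * ?e q)" by (intro integrable_mult_right cont_integrable_M ec)
    have "energy_M (tensor P y) \<le> (LINT q|M. B * ?e q)"
      unfolding energy_M_eq[OF T]
      by (rule integral_mono[OF cont_integrable_M[OF density_cont[OF T]] ie]) (use B(2)[OF T y] in \<open>auto simp: space_M\<close>)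
    also have "\<dots> = B * (LINT x|radial_measure. LINT p|V. ?e (x, p))"
      using integral_M(1)[OF ec] by simp
    also have "\<dots> = B * measure radial_measure {0..1} * energy_K y"
      unfolding energy_K_def by (simp add: space_radial)
    also have "\<dots> \<le> C * energy_K y"
      unfolding C_def using B(1) energy_K_nonneg[OF y] by (intro mult_right_mono mult_left_mono) auto
    finally show ?thesis .
  qed
  then show ?thesis using that[of C] B(1) unfolding C_def by (simp add: add_nonneg_pos)
qed

text \<open>A substitute for the triangle inequality of the \<open>H\<^sup>1\<close> norm; it serves to bound Cauchy sequences.\<close>

lemma grad_sq_add_le:
  assumes a: "cdifferentiable_fun a" and b: "cdifferentiable_fun b"
  shows "grad_sq (\<lambda>p. a p + b p) p \<le> 3 * grad_sq a p + 3 * grad_sq b p"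
proof -
  have ab: "cdifferentiable_fun (\<lambda>p. a p + b p)" using cdifferentiable_fun_linear[OF a b, of 1 1] by simp
  have r: "grad_inner K u (\<lambda>p. a p + b p) p = grad_inner K u a p + grad_inner K u b p" if "cdifferentiable_fun u" for u
    using grad_inner_linear_right[OF that a b, of 1 1 p] by simp
  have "grad_inner K (\<lambda>p. a p + b p) (\<lambda>p. a p + b p) p = cnj (grad_inner K a a p + grad_inner K a b p) + cnj (grad_inner K b a p + grad_inner K b b p)"
    unfolding r[OF ab] grad_inner_cnj[OF a ab] grad_inner_cnj[OF b ab] r[OF a] r[OF b] ..
  then have "grad_sq (\<lambda>p. a p + b p) p = grad_sq a p + grad_sq b p + Re (grad_inner K a b p) + Re (grad_inner K b a p)"
    unfolding grad_sq_def by simp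
  moreover have "Re (grad_inner K a b p) \<le> grad_sq a p + grad_sq b p" "Re (grad_inner K b a p) \<le> grad_sq b p + grad_sq a p"
    using order_trans[OF complex_Re_le_cmod grad_inner_bound[OF a b, of 1 p]] order_trans[OF complex_Re_le_cmod grad_inner_bound[OF b a, of 1 p]] by auto
  ultimately show ?thesis by linarith
qed

lemma energy_K_le:
  assumes a: "C1_strip (\<lambda>(x, p). a p)" and b: "C1_strip (\<lambda>(x, p). b p)"
  shows "energy_K a \<le> 3 * energy_K (\<lambda>p. a p - b p) + 3 * energy_K b"
proof -
  have d: "C1_strip (\<lambda>(x, p). a p - b p)" using C1_strip_diff[OF a b] by (simp add: case_prod_beta')
  have i: "integrable V (\<lambda>p. (cmod (y p))\<^sup>2 + grad_sq y p)" if "C1_strip (\<lambda>(x, p). y p)" for y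
    using cont_integrable_V[OF energy_K_density_cont[OF that], of 0] by simp
  have "energy_K a \<le> (LINT p|V. 3 * ((cmod (a p - b p))\<^sup>2 + grad_sq (\<lambda>p. a p - b p) p) + 3 * ((cmod (b p))\<^sup>2 + grad_sq b p))"
    unfolding energy_K_def
  proof (rule integral_mono[OF i[OF a]])
    show "integrable V (\<lambda>p. 3 * ((cmod (a p - b p))\<^sup>2 + grad_sq (\<lambda>p. a p - b p) p) + 3 * ((cmod (b p))\<^sup>2 + grad_sq b p))"
      by (intro Bochner_Integration.integrable_add integrable_mult_right i a b d)
    show "(cmod (a p))\<^sup>2 + grad_sq a p \<le> 3 * ((cmod (a p - b p))\<^sup>2 + grad_sq (\<lambda>p. a p - b p) p) + 3 * ((cmod (b p))\<^sup>2 + grad_sq b p)" for p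
      using cmod_sq_le_double[of "a p" "b p"] grad_sq_add_le[OF lift_cdifferentiable[OF d] lift_cdifferentiable[OF b], of p]
        zero_le_power2[of "cmod (a p - b p)"] zero_le_power2[of "cmod (b p)"] unfolding distrib_left diff_add_cancel by linarith
  qed
  also have "\<dots> = 3 * energy_K (\<lambda>p. a p - b p) + 3 * energy_K b"
    unfolding energy_K_def using i[OF b] i[OF d] by (simp del: distrib_left_numeral)
  finally show ?thesis .
qed

lemma energy_M_le:
  assumes a: "C1_strip a" and b: "C1_strip b"
  shows "energy_M a \<le> 3 * energy_M (\<lambda>q. a q - b q) + 3 * energy_M b"
proof -
  note d = C1_strip_diff[OF a b]
  note i = cont_integrable_M[OF density_cont]
  have "energy_M a \<le> (LINT q|M. 3 * density_M (\<lambda>q. a q - b q) q + 3 * density_M b q)"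
    unfolding energy_M_eq[OF a]
  proof (rule integral_mono[OF i[OF a]])
    show "integrable M (\<lambda>q. 3 * density_M (\<lambda>q. a q - b q) q + 3 * density_M b q)"
      by (intro Bochner_Integration.integrable_add integrable_mult_right i b d)
    fix q assume "q \<in> space M"
    then obtain x p where q: "q = (x, p)" "x \<in> {0..1}" unfolding space_M by auto
    note fx = f_pos[OF q(2)]
    have g: "grad_sq (\<lambda>p. a (x, p)) p \<le> 3 * grad_sq (\<lambda>p. a (x, p) - b (x, p)) p + 3 * grad_sq (\<lambda>p. b (x, p)) p"
      using grad_sq_add_le[OF C1_strip_cdifferentiable_fun[OF d q(2)] C1_strip_cdifferentiable_fun[OF b q(2)], of p] by simp
    have c: "(cmod z)\<^sup>2 \<le> 3 * (cmod (z - w))\<^sup>2 + 3 * (cmod w)\<^sup>2" for z w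
      using cmod_sq_le_double[of z w] zero_le_power2[of "cmod (z - w)"] zero_le_power2[of "cmod w"] by linarith
    have "((cmod (dx a (x, p)))\<^sup>2 + grad_sq (\<lambda>p. a (x, p)) p) / f x \<le> 
      (3 * ((cmod (dx a (x, p) - dx b (x, p)))\<^sup>2 + grad_sq (\<lambda>p. a (x, p) - b (x, p)) p) + 3 * ((cmod (dx b (x, p)))\<^sup>2 + grad_sq (\<lambda>p. b (x, p)) p)) / f x"
      using g c[of "dx a (x, p)" "dx b (x, p)"] fx by (intro divide_right_mono) auto
    then show "density_M a q \<le> 3 * density_M (\<lambda>q. a q - b q) q + 3 * density_M b q"
      unfolding q density_M_def fst_conv snd_conv dx_diff[OF a b q(2)]
      using c[of "a (x, p)" "b (x, p)"] by (simp add: add_divide_distrib)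
  qed
  also have "\<dots> = 3 * energy_M (\<lambda>q. a q - b q) + 3 * energy_M b"
    unfolding energy_M_eq[OF b] energy_M_eq[OF d] using i[OF b] i[OF d] by simp
  finally show ?thesis .
qed

end

section \<open>Mode coefficients\<close>

lemma eventually_bounded_all:
  fixes a :: "nat \<Rightarrow> real"
  assumes "\<And>k. k \<ge> N \<Longrightarrow> a k \<le> C"
  obtains C' where "\<And>k. a k \<le> C'"
proof (rule that)
  fix k
  show "a k \<le> max C (Max (a ` {..N}))"
  proof (cases "k \<ge> N")
    case False
    then have "a k \<le> Max (a ` {..N})" by (intro Max_ge) auto
    then show ?thesis by simp
  qed (use assms in \<open>simp add: le_max_iff_disj\<close>)
qed

text \<open>One mode: \<open>Y\<close> is a normalised eigenfunction on \<open>K\<close> for the eigenvalue \<open>\<mu>\<close>.\<close>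

locale cross_section_mode = warped_measure K V f n M \<sigma>
  for K :: "('i, 'k::{second_countable_topology, t2_space}, 'e::euclidean_space) riem" and V f n M \<sigma> +
  fixes Y :: "'k \<Rightarrow> complex" and \<mu> :: real
  assumes Y: "Y \<in> L2 V" and Y1: "L2_inner V Y Y = 1" and eigen: "laplace_eigenfunction K V \<mu> Y"
begin

definition mode_coeff :: "(real \<times> 'k \<Rightarrow> complex) \<Rightarrow> real \<Rightarrow> complex" where
  "mode_coeff u x = (LINT p|V. u (x, p) * cnj (Y p))"

lemma mode_coeff_integrable: "continuous_on ({0..1} \<times> UNIV) (u :: real \<times> 'k \<Rightarrow> complex) \<Longrightarrow> x \<in> {0..1} \<Longrightarrow> integrable V (\<lambda>p. u (x, p) * cnj (Y p))"
  using L2_prod_integrable[OF cont_L2_V[of u x] Y] by blast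

lemma mode_coeff_diff:
  assumes "continuous_on ({0..1} \<times> UNIV) u" "continuous_on ({0..1} \<times> UNIV) v" "x \<in> {0..1}"
  shows "mode_coeff (\<lambda>q. u q - v q) x = mode_coeff u x - mode_coeff v x"
  unfolding mode_coeff_def left_diff_distrib
  by (rule Bochner_Integration.integral_diff[OF mode_coeff_integrable[OF assms(1,3)] mode_coeff_integrable[OF assms(2,3)]])

lemma mode_coeff_sq_le:
  assumes "continuous_on ({0..1} \<times> UNIV) u" "x \<in> {0..1}"
  shows "(cmod (mode_coeff u x))\<^sup>2 \<le> (LINT p|V. (cmod (u (x, p)))\<^sup>2)"
  unfolding mode_coeff_def by (rule Bessel[OF Y Y1 cont_L2_V[OF assms]])

lemma mode_coeff_cont:
  assumes u: "continuous_on ({0..1} \<times> UNIV) u"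
  shows "continuous_on {0..1} (mode_coeff u)"
proof (rule continuous_on_sequentiallyI)
  fix X :: "nat \<Rightarrow> real" and x assume X: "\<forall>n. X n \<in> {0..1}" and x: "x \<in> {0..1}" and lim: "X \<longlonglongrightarrow> x"
  obtain C where C: "C > 0" "\<And>x p. x \<in> {0..1} \<Longrightarrow> norm (u (x, p)) \<le> C" by (rule cont_bounded_strip[OF u]) blast
  show "(\<lambda>n. mode_coeff u (X n)) \<longlonglongrightarrow> mode_coeff u x"
    unfolding mode_coeff_def
  proof (rule integral_dominated_convergence)
    show "(\<lambda>p. u (x, p) * cnj (Y p)) \<in> borel_measurable V" using mode_coeff_integrable[OF u x] by (rule borel_measurable_integrable)
    show "(\<lambda>p. u (X n, p) * cnj (Y p)) \<in> borel_measurable V" for n using mode_coeff_integrable[OF u] X by (blast intro: borel_measurable_integrable)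
    show "integrable V (\<lambda>p. C * cmod (Y p))" using L2_V_integrable(2)[OF Y] by simp
    show "AE p in V. (\<lambda>n. u (X n, p) * cnj (Y p)) \<longlonglongrightarrow> u (x, p) * cnj (Y p)"
    proof (rule AE_I2)
      fix p
      have "continuous_on {0..1} (\<lambda>t. u (t, p))"
        by (rule continuous_on_compose2[OF u]) (auto intro!: continuous_intros)
      then have "(\<lambda>n. u (X n, p)) \<longlonglongrightarrow> u (x, p)"
        using X by (intro continuous_on_tendsto_compose[OF _ lim x]) auto
      then show "(\<lambda>n. u (X n, p) * cnj (Y p)) \<longlonglongrightarrow> u (x, p) * cnj (Y p)" by (intro tendsto_intros)
    qed
    show "AE p in V. norm (u (X n, p) * cnj (Y p)) \<le> C * cmod (Y p)" for n
      using X C by (auto simp: norm_mult intro!: AE_I2 mult_right_mono)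
  qed
qed

lemma strip_Lipschitz:
  fixes u :: "real \<times> 'k \<Rightarrow> complex"
  assumes u: "C1_strip u" and C: "\<And>x p. x \<in> {0..1} \<Longrightarrow> norm (dx u (x, p)) \<le> C" and xt: "x \<in> {0..1}" "t \<in> {0..1}"
  shows "norm (u (t, p) - u (x, p)) \<le> C * norm (t - x)"
proof (rule differentiable_bound[of "{0..1}" "\<lambda>t. u (t, p)" "\<lambda>t h. h *\<^sub>R dx u (t, p)"])
  show "((\<lambda>t. u (t, p)) has_derivative (\<lambda>h. h *\<^sub>R dx u (t, p))) (at t within {0..1})" if "t \<in> {0..1}" for t
    using dx_has_vector_derivative[OF u that] unfolding has_vector_derivative_def .
  show "onorm (\<lambda>h. h *\<^sub>R dx u (t, p)) \<le> C" if "t \<in> {0..1}" for t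
    by (rule onorm_le) (use mult_left_mono[OF C[OF that, of p] abs_ge_zero] in \<open>simp add: mult.commute\<close>)
qed (use xt in auto)

text \<open>Differentiation under the integral sign: the difference quotients of \<open>u\<close> in the first variable are bounded, so
that dominated convergence applies with a multiple of \<open>\<bar>Y\<bar>\<close>.\<close>

lemma mode_coeff_has_vector_derivative:
  assumes u: "C1_strip u" and x: "x \<in> {0..1}"
  shows "(mode_coeff u has_vector_derivative mode_coeff (dx u) x) (at x within {0..1})"
  unfolding has_vector_derivative_def has_derivative_within
proof
  note uc = C1_strip_cont[OF u] and dc = dx_cont[OF u]
  show "bounded_linear (\<lambda>h. h *\<^sub>R mode_coeff (dx u) x)" by (rule bounded_linear_scaleR_left)
  obtain C where C: "C > 0" "\<And>x p. x \<in> {0..1} \<Longrightarrow> norm (dx u (x, p)) \<le> C" by (rule cont_bounded_strip[OF dc]) blast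
  show "((\<lambda>t. (1 / norm (t - x)) *\<^sub>R (mode_coeff u t - (mode_coeff u x + (t - x) *\<^sub>R mode_coeff (dx u) x))) \<longlongrightarrow> 0) (at x within {0..1})"
    unfolding tendsto_at_iff_sequentially o_def
  proof (intro allI impI)
    fix X :: "nat \<Rightarrow> real" assume X: "\<forall>i. X i \<in> {0..1} - {x}" and lim: "X \<longlonglongrightarrow> x"
    define g where "g i p = (1 / norm (X i - x)) *\<^sub>R (u (X i, p) - (u (x, p) + (X i - x) *\<^sub>R dx u (x, p)))" for i p
    have Xi: "X i \<in> {0..1}" for i using X by blast
    have eq: "(1 / norm (X i - x)) *\<^sub>R (mode_coeff u (X i) - (mode_coeff u x + (X i - x) *\<^sub>R mode_coeff (dx u) x)) = (LINT p|V. g i p * cnj (Y p))" for i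
    proof -
      have "(LINT p|V. g i p * cnj (Y p)) = (LINT p|V. (1 / norm (X i - x)) *\<^sub>R (u (X i, p) * cnj (Y p) - (u (x, p) * cnj (Y p) + (X i - x) *\<^sub>R (dx u (x, p) * cnj (Y p)))))"
        unfolding g_def by (rule Bochner_Integration.integral_cong) (auto simp: algebra_simps)
      also have "\<dots> = (1 / norm (X i - x)) *\<^sub>R (mode_coeff u (X i) - (mode_coeff u x + (X i - x) *\<^sub>R mode_coeff (dx u) x))"
        unfolding mode_coeff_def using mode_coeff_integrable[OF uc Xi[of i]] mode_coeff_integrable[OF uc x] mode_coeff_integrable[OF dc x] by simp
      finally show ?thesis ..
    qed
    have "(\<lambda>i. LINT p|V. g i p * cnj (Y p)) \<longlonglongrightarrow> (LINT p|V. 0)"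
    proof (rule integral_dominated_convergence)
      show "integrable V (\<lambda>p. 2 * C * cmod (Y p))" using L2_V_integrable(2)[OF Y] by simp
      show "(\<lambda>p. g i p * cnj (Y p)) \<in> borel_measurable V" for i
      proof -
        have "(\<lambda>p. (1 / norm (X i - x)) *\<^sub>R (u (X i, p) * cnj (Y p) - (u (x, p) * cnj (Y p) + (X i - x) *\<^sub>R (dx u (x, p) * cnj (Y p))))) \<in> borel_measurable V"
          using mode_coeff_integrable[OF uc Xi[of i]] mode_coeff_integrable[OF uc x] mode_coeff_integrable[OF dc x]
          by (intro borel_measurable_integrable integrable_scaleR_right Bochner_Integration.integrable_add Bochner_Integration.integrable_diff) auto
        then show ?thesis unfolding g_def by (simp add: algebra_simps)
      qed
      show "AE p in V. (\<lambda>i. g i p * cnj (Y p)) \<longlonglongrightarrow> 0"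
      proof (rule AE_I2)
        fix p
        have "((\<lambda>t. (1 / norm (t - x)) *\<^sub>R (u (t, p) - (u (x, p) + (t - x) *\<^sub>R dx u (x, p)))) \<longlongrightarrow> 0) (at x within {0..1})"
          using dx_has_vector_derivative[OF u x, of p] unfolding has_vector_derivative_def has_derivative_within by blast
        then have "(\<lambda>i. g i p) \<longlonglongrightarrow> 0"
          unfolding tendsto_at_iff_sequentially o_def g_def using X lim by blast
        then show "(\<lambda>i. g i p * cnj (Y p)) \<longlonglongrightarrow> 0" by (rule tendsto_mult_left_zero)
      qed
      show "AE p in V. norm (g i p * cnj (Y p)) \<le> 2 * C * cmod (Y p)" for i
      proof (rule AE_I2)
        fix p
        have nz: "norm (X i - x) > 0" using X[rule_format, of i] by auto
        have "norm (u (X i, p) - (u (x, p) + (X i - x) *\<^sub>R dx u (x, p))) \<le> norm (u (X i, p) - u (x, p)) + norm ((X i - x) *\<^sub>R dx u (x, p))"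
          using norm_triangle_ineq4[of "u (X i, p) - u (x, p)" "(X i - x) *\<^sub>R dx u (x, p)"] by (simp add: algebra_simps)
        also have "\<dots> \<le> C * norm (X i - x) + norm (X i - x) * C"
          using strip_Lipschitz[OF u C(2) x Xi[of i], of p] C(2)[OF x, of p] by (intro add_mono) (auto intro: mult_left_mono)
        finally have "(1 / norm (X i - x)) * norm (u (X i, p) - (u (x, p) + (X i - x) *\<^sub>R dx u (x, p))) \<le> (1 / norm (X i - x)) * (C * norm (X i - x) + norm (X i - x) * C)"
          by (rule mult_left_mono) simp
        also have "\<dots> = 2 * C" using nz by (simp add: field_simps)
        finally have "norm (g i p) \<le> 2 * C" unfolding g_def norm_scaleR by (simp only: abs_divide abs_one abs_norm_cancel)
        then show "norm (g i p * cnj (Y p)) \<le> 2 * C * cmod (Y p)" by (simp add: norm_mult mult_right_mono)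
      qed
    qed simp
    then show "(\<lambda>i. (1 / norm (X i - x)) *\<^sub>R (mode_coeff u (X i) - (mode_coeff u x + (X i - x) *\<^sub>R mode_coeff (dx u) x))) \<longlonglongrightarrow> 0"
      unfolding eq by simp
  qed
qed

text \<open>By Bessel's inequality on each slice. Thus Cauchy sequences in \<open>H\<^sup>1\<close> of the product have Cauchy coefficients.\<close>

lemma mode_coeff_energy_le:
  obtains C where "C > 0" "\<And>u. C1_strip u \<Longrightarrow> integral {0..1} (\<lambda>x. (cmod (mode_coeff (dx u) x))\<^sup>2 + (cmod (mode_coeff u x))\<^sup>2) \<le> C * energy_M u"
proof -
  obtain F where F: "F > 0" "\<And>x. x \<in> {0..1} \<Longrightarrow> \<bar>f x\<bar> \<le> F" by (rule cont_bounded01[OF f_cont]) blast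
  obtain x0 where x0: "x0 \<in> {0..1}" "\<And>x. x \<in> {0..1} \<Longrightarrow> vol_weight n f x0 \<le> vol_weight n f x"
    using continuous_attains_inf[OF _ _ vol_weight_cont] by auto
  define r where "r = vol_weight n f x0"
  have r: "r > 0" unfolding r_def by (rule vol_weight_pos[OF x0(1)])
  define m where "m = max 1 F"
  have "integral {0..1} (\<lambda>x. (cmod (mode_coeff (dx u) x))\<^sup>2 + (cmod (mode_coeff u x))\<^sup>2) \<le> m / r * energy_M u" if u: "C1_strip u" for u
  proof -
    note c = mode_coeff_cont[OF C1_strip_cont[OF u]] mode_coeff_cont[OF dx_cont[OF u]]
    let ?G = "\<lambda>x. (cmod (mode_coeff (dx u) x))\<^sup>2 + (cmod (mode_coeff u x))\<^sup>2"
    have Gc: "continuous_on {0..1} ?G" by (intro continuous_intros c)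
    let ?D = "\<lambda>q. (cmod (dx u q))\<^sup>2 + (cmod (u q))\<^sup>2"
    have Dc: "continuous_on ({0..1} \<times> UNIV) ?D" by (intro continuous_intros C1_strip_cont[OF u] dx_cont[OF u])
    have "r * integral {0..1} ?G = integral {0..1} (\<lambda>x. r * ?G x)" by (rule integral_mult_right[symmetric])
    also have "\<dots> \<le> integral {0..1} (\<lambda>x. vol_weight n f x *\<^sub>R ?G x)"
      by (rule integral_mono01) (use x0(2) in \<open>auto simp: r_def intro!: continuous_intros c vol_weight_cont mult_right_mono\<close>)
    also have "\<dots> = (LINT x|radial_measure. ?G x)" by (rule integral_radial[OF Gc, symmetric])
    also have "\<dots> \<le> (LINT x|radial_measure. LINT p|V. ?D (x, p))"
    proof (rule integral_mono[OF _ integral_M(2)[OF Dc]])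
      obtain B where B: "B > 0" "\<And>x. x \<in> {0..1} \<Longrightarrow> \<bar>?G x\<bar> \<le> B" by (rule cont_bounded01[OF Gc]) blast
      have "?G \<in> borel_measurable radial_measure"
        using borel_measurable_continuous_on_restrict[OF Gc] sets_radial by (simp cong: measurable_cong_sets)
      then show "integrable radial_measure ?G"
        by (intro radial.integrable_const_bound[where B = B]) (use B(2) in \<open>auto simp: space_radial\<close>)
      fix x assume "x \<in> space radial_measure"
      then have x: "x \<in> {0..1}" unfolding space_radial .
      have "(LINT p|V. ?D (x, p)) = (LINT p|V. (cmod (dx u (x, p)))\<^sup>2) + (LINT p|V. (cmod (u (x, p)))\<^sup>2)"
        by (intro Bochner_Integration.integral_add L2_D(2) cont_L2_V C1_strip_cont[OF u] dx_cont[OF u] x)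
      then show "?G x \<le> (LINT p|V. ?D (x, p))"
        using mode_coeff_sq_le[OF C1_strip_cont[OF u] x] mode_coeff_sq_le[OF dx_cont[OF u] x] by linarith
    qed
    also have "\<dots> = (LINT q|M. ?D q)" by (rule integral_M(1)[OF Dc, symmetric])
    also have "\<dots> \<le> (LINT q|M. m * density_M u q)"
    proof (rule integral_mono[OF cont_integrable_M[OF Dc]])
      show "integrable M (\<lambda>q. m * density_M u q)" by (intro integrable_mult_right cont_integrable_M density_cont u)
      fix q assume "q \<in> space M"
      then obtain x p where q: "q = (x, p)" "x \<in> {0..1}" unfolding space_M by auto
      have fx: "0 < f x" "f x \<le> m" "1 \<le> m" using f_pos[OF q(2)] F(2)[OF q(2)] unfolding m_def by auto
      have "(cmod (dx u (x, p)))\<^sup>2 = f x * ((cmod (dx u (x, p)))\<^sup>2 / f x)" using fx by simp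
      also have "\<dots> \<le> m * (((cmod (dx u (x, p)))\<^sup>2 + grad_sq (\<lambda>p. u (x, p)) p) / f x)"
        using fx grad_sq_nonneg[OF C1_strip_cdifferentiable_fun[OF u q(2)], of p]
        by (intro mult_mono divide_right_mono) auto
      finally have "(cmod (dx u (x, p)))\<^sup>2 \<le> m * (((cmod (dx u (x, p)))\<^sup>2 + grad_sq (\<lambda>p. u (x, p)) p) / f x)" .
      moreover have "(cmod (u (x, p)))\<^sup>2 \<le> m * (cmod (u (x, p)))\<^sup>2" using fx mult_right_mono[of 1 m "(cmod (u (x, p)))\<^sup>2"] by simp
      ultimately show "?D q \<le> m * density_M u q" unfolding q density_M_def fst_conv snd_conv distrib_left by linarith
    qed
    also have "\<dots> = m * energy_M u" unfolding energy_M_eq[OF u] by simp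
    finally show ?thesis using r by (simp add: field_simps)
  qed
  moreover have "m / r > 0" using r F unfolding m_def by simp
  ultimately show ?thesis using that by blast
qed

section \<open>The radial form of the eigenvalue equation\<close>

text \<open>The weak eigenvalue equation with the arguments exchanged: a fixed smooth function is paired with the
smooth functions that approximate \<open>Y\<close>.\<close>

lemma eigen_sequence:
  obtains y where "\<And>l. smooth_fun K (y l)" "\<And>e. e > 0 \<Longrightarrow> \<exists>N. \<forall>k\<ge>N. \<forall>l\<ge>N. energy_K (\<lambda>p. y k p - y l p) < e"
    "L2_tendsto V y Y" "\<And>\<phi>. smooth_fun K \<phi> \<Longrightarrow> (\<lambda>l. LINT p|V. grad_inner K \<phi> (y l) p) \<longlonglongrightarrow> of_real \<mu> * (LINT p|V. \<phi> p * cnj (Y p))"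
proof -
  obtain y where y: "H1_element K V y Y" "laplacian_eq K V {} y (\<lambda>p. - complex_of_real \<mu> * Y p)"
    using eigen unfolding laplace_eigenfunction_def helmholtz_solution_def by blast
  have s: "smooth_fun K (y l)" for l using y(1) unfolding H1_element_def by blast
  have d: "C1_strip (\<lambda>(x, p). y k p - y l p)" for k l
    using C1_strip_diff[OF smooth_fun_K_lift[OF s[of k]] smooth_fun_K_lift[OF s[of l]]] by (simp add: case_prod_beta')
  show ?thesis
  proof (rule that[OF s])
    show "L2_tendsto V y Y" using y(1) unfolding H1_element_def by blast
    fix e :: real assume e: "e > 0"
    then have "sqrt e > 0" by simp
    then obtain N where N: "\<forall>k\<ge>N. \<forall>l\<ge>N. H1_norm K V (\<lambda>p. y k p - y l p) < sqrt e"
      using y(1) unfolding H1_element_def by blast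
    have "energy_K (\<lambda>p. y k p - y l p) < e" if "k \<ge> N" "l \<ge> N" for k l
    proof -
      have "H1_norm K V (\<lambda>p. y k p - y l p) \<ge> 0"
        using energy_K_nonneg[OF d[of k l]] unfolding H1_norm_def energy_K_def grad_sq_def by simp
      then have "(H1_norm K V (\<lambda>p. y k p - y l p))\<^sup>2 < (sqrt e)\<^sup>2" using N that by (intro power_strict_mono) auto
      then show ?thesis using H1_norm_K[OF d[of k l]] e by simp
    qed
    then show "\<exists>N. \<forall>k\<ge>N. \<forall>l\<ge>N. energy_K (\<lambda>p. y k p - y l p) < e" by blast
  next
    fix \<phi> assume \<phi>: "smooth_fun K \<phi>"
    then have "test_fun K {} \<phi>" unfolding test_fun_def by blast
    then have "(\<lambda>l. LINT p|V. grad_inner K (y l) \<phi> p) \<longlonglongrightarrow> - (LINT p|V. - complex_of_real \<mu> * Y p * cnj (\<phi> p))"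
      using y(2) unfolding laplacian_eq_def by blast
    then have "(\<lambda>l. cnj (LINT p|V. grad_inner K (y l) \<phi> p)) \<longlonglongrightarrow> cnj (- (LINT p|V. - complex_of_real \<mu> * Y p * cnj (\<phi> p)))"
      by (intro tendsto_intros)
    moreover have "cnj (LINT p|V. grad_inner K (y l) \<phi> p) = (LINT p|V. grad_inner K \<phi> (y l) p)" for l
      unfolding Bochner_Integration.integral_cnj[symmetric]
      by (rule Bochner_Integration.integral_cong) (auto simp: grad_inner_cnj[OF smooth_fun_cdifferentiable[OF s] smooth_fun_cdifferentiable[OF \<phi>]])
    moreover have "cnj (- (LINT p|V. - complex_of_real \<mu> * Y p * cnj (\<phi> p))) = of_real \<mu> * (LINT p|V. \<phi> p * cnj (Y p))"
    proof -
      have "- (LINT p|V. - complex_of_real \<mu> * Y p * cnj (\<phi> p)) = of_real \<mu> * (LINT p|V. Y p * cnj (\<phi> p))"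
        by (simp add: mult.assoc)
      moreover have "cnj (LINT p|V. Y p * cnj (\<phi> p)) = (LINT p|V. \<phi> p * cnj (Y p))"
        unfolding Bochner_Integration.integral_cnj[symmetric] by (rule Bochner_Integration.integral_cong) auto
      ultimately show ?thesis by simp
    qed
    ultimately show "(\<lambda>l. LINT p|V. grad_inner K \<phi> (y l) p) \<longlonglongrightarrow> of_real \<mu> * (LINT p|V. \<phi> p * cnj (Y p))" by simp
  qed
qed

text \<open>The form at \<open>u\<close> and \<open>P \<otimes> Y\<close>, after integration over \<open>K\<close>. The gradient along \<open>K\<close> has become the factor \<open>\<mu>\<close>.\<close>

definition radial_density :: "real \<Rightarrow> real poly \<Rightarrow> (real \<times> 'k \<Rightarrow> complex) \<Rightarrow> real \<Rightarrow> complex" where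
  "radial_density \<omega> P u x = of_real (poly (pderiv P) x / f x) * mode_coeff (dx u) x +
     of_real (\<mu> * poly P x / f x - \<omega> * poly P x) * mode_coeff u x"

lemma form_tensor_slice:
  assumes u: "C1_strip u" and y: "smooth_fun K y" and x: "x \<in> {0..1}"
  shows "(LINT p|V. form_density \<omega> u (tensor P y) (x, p)) =
    of_real (poly (pderiv P) x / f x) * (LINT p|V. dx u (x, p) * cnj (y p)) +
    of_real (poly P x / f x) * (LINT p|V. grad_inner K (\<lambda>p. u (x, p)) y p) - of_real (\<omega> * poly P x) * (LINT p|V. u (x, p) * cnj (y p))"
proof -
  have yL: "y \<in> L2 V" using cont_L2_V[OF C1_strip_cont[OF smooth_fun_K_lift[OF y]], of 0] by simp
  have i: "integrable V (\<lambda>p. dx u (x, p) * cnj (y p))" "integrable V (\<lambda>p. u (x, p) * cnj (y p))"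
    by (intro L2_prod_integrable cont_L2_V dx_cont[OF u] C1_strip_cont[OF u] x yL)+
  have ig: "integrable V (\<lambda>p. grad_inner K (\<lambda>p. u (x, p)) y p)"
    using cont_integrable_V[OF grad_inner_K_cont[OF u smooth_fun_K_lift[OF y]] x] by simp
  have "(LINT p|V. form_density \<omega> u (tensor P y) (x, p)) = (LINT p|V. of_real (poly (pderiv P) x / f x) * (dx u (x, p) * cnj (y p)) +
    of_real (poly P x / f x) * grad_inner K (\<lambda>p. u (x, p)) y p - of_real (\<omega> * poly P x) * (u (x, p) * cnj (y p)))"
  proof (rule Bochner_Integration.integral_cong[OF refl])
    fix p
    show "form_density \<omega> u (tensor P y) (x, p) = of_real (poly (pderiv P) x / f x) * (dx u (x, p) * cnj (y p)) +
    of_real (poly P x / f x) * grad_inner K (\<lambda>p. u (x, p)) y p - of_real (\<omega> * poly P x) * (u (x, p) * cnj (y p))"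
      unfolding form_density_def fst_conv snd_conv tensor_dx[OF x] grad_inner_tensor[OF u smooth_fun_cdifferentiable[OF y] x]
      using f_pos[OF x] by (simp add: tensor_def scaleR_conv_of_real field_simps)
  qed
  also have "\<dots> = of_real (poly (pderiv P) x / f x) * (LINT p|V. dx u (x, p) * cnj (y p)) +
    of_real (poly P x / f x) * (LINT p|V. grad_inner K (\<lambda>p. u (x, p)) y p) - of_real (\<omega> * poly P x) * (LINT p|V. u (x, p) * cnj (y p))"
    using i ig by simp
  finally show ?thesis .
qed

text \<open>For each \<open>x\<close> the slice \<open>u(x, \<cdot>)\<close> is a smooth test function for the eigenvalue equation on \<open>K\<close>, so the integral
over the slice converges. The energies of the \<open>y l\<close> are bounded, which gives a constant bound in \<open>x\<close>.\<close>

lemma form_tensor_tendsto: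
  assumes s: "smooth_fun W u" and y: "\<And>l. smooth_fun K (y l)"
    and cauchy: "\<And>e. e > 0 \<Longrightarrow> \<exists>N. \<forall>k\<ge>N. \<forall>l\<ge>N. energy_K (\<lambda>p. y k p - y l p) < e"
    and lim: "L2_tendsto V y Y"
    and weak: "\<And>\<phi>. smooth_fun K \<phi> \<Longrightarrow> (\<lambda>l. LINT p|V. grad_inner K \<phi> (y l) p) \<longlonglongrightarrow> of_real \<mu> * (LINT p|V. \<phi> p * cnj (Y p))"
  shows "(\<lambda>l. form_M \<omega> u (tensor P (y l))) \<longlonglongrightarrow> (LINT x|radial_measure. radial_density \<omega> P u x)"
proof -
  note u = smooth_fun_C1_strip[OF s]
  have T: "C1_strip (tensor P (y l))" for l by (rule smooth_fun_C1_strip[OF tensor_smooth[OF y]])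
  note yl = smooth_fun_K_lift[OF y]
  have yL: "y l \<in> L2 V" for l using cont_L2_V[OF C1_strip_cont[OF yl[of l]], of 0] by simp
  have eq: "form_M \<omega> u (tensor P (y l)) = (LINT x|radial_measure. LINT p|V. form_density \<omega> u (tensor P (y l)) (x, p))" for l
    unfolding form_M_eq[OF u T] by (rule integral_M(1)[OF form_density_cont[OF u T]])
  obtain N where N: "\<forall>k\<ge>N. \<forall>l\<ge>N. energy_K (\<lambda>p. y k p - y l p) < 1" using cauchy[of 1] by auto
  have "energy_K (y k) \<le> 3 * 1 + 3 * energy_K (y N)" if "k \<ge> N" for k
    using energy_K_le[OF yl[of k] yl[of N]] N that by fastforce
  then obtain E where E: "\<And>k. energy_K (y k) \<le> E"
    using eventually_bounded_all[of N "\<lambda>k. energy_K (y k)"] by blast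
  obtain B where B: "B > 0" "\<And>y x p. C1_strip (tensor P y) \<Longrightarrow> C1_strip (\<lambda>(x, p). y p) \<Longrightarrow> x \<in> {0..1} \<Longrightarrow>
    density_M (tensor P y) (x, p) \<le> B * ((cmod (y p))\<^sup>2 + grad_sq y p)" by (rule density_tensor_le) blast
  obtain D where D: "D > 0" "\<And>x p. x \<in> {0..1} \<Longrightarrow> norm (density_M u (x, p)) \<le> D" by (rule cont_bounded_strip[OF density_cont[OF u]]) blast
  define C where "C = (1 + \<bar>\<omega>\<bar>) * (D * measure V UNIV + B * E)"
  show ?thesis unfolding eq
  proof (rule integral_dominated_convergence)
    show "(\<lambda>x. LINT p|V. form_density \<omega> u (tensor P (y l)) (x, p)) \<in> borel_measurable radial_measure" for l
      by (rule borel_measurable_integrable[OF integral_M(2)[OF form_density_cont[OF u T]]])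
    have "continuous_on {0..1} (radial_density \<omega> P u)"
      unfolding radial_density_def[abs_def]
      by (intro continuous_intros mode_coeff_cont dx_cont[OF u] C1_strip_cont[OF u] f_cont) (use f_pos in force)+
    then show "radial_density \<omega> P u \<in> borel_measurable radial_measure"
      using borel_measurable_continuous_on_restrict sets_radial by (simp cong: measurable_cong_sets)
    show "integrable radial_measure (\<lambda>x. C)" by simp
    show "AE x in radial_measure. (\<lambda>l. LINT p|V. form_density \<omega> u (tensor P (y l)) (x, p)) \<longlonglongrightarrow> radial_density \<omega> P u x"
    proof (rule AE_I2)
      fix x assume "x \<in> space radial_measure"
      then have x: "x \<in> {0..1}" unfolding space_radial .
      have "(\<lambda>l. of_real (poly (pderiv P) x / f x) * (LINT p|V. dx u (x, p) * cnj (y l p)) +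
        of_real (poly P x / f x) * (LINT p|V. grad_inner K (\<lambda>p. u (x, p)) (y l) p) - of_real (\<omega> * poly P x) * (LINT p|V. u (x, p) * cnj (y l p)))
        \<longlonglongrightarrow> of_real (poly (pderiv P) x / f x) * (LINT p|V. dx u (x, p) * cnj (Y p)) +
        of_real (poly P x / f x) * (of_real \<mu> * (LINT p|V. u (x, p) * cnj (Y p))) - of_real (\<omega> * poly P x) * (LINT p|V. u (x, p) * cnj (Y p))"
        by (intro tendsto_intros weak smooth_fun_slice[OF s x]
            L2_tendsto_inner[OF cont_L2_V[OF dx_cont[OF u] x] yL Y lim] L2_tendsto_inner[OF cont_L2_V[OF C1_strip_cont[OF u] x] yL Y lim])
      then show "(\<lambda>l. LINT p|V. form_density \<omega> u (tensor P (y l)) (x, p)) \<longlonglongrightarrow> radial_density \<omega> P u x"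
        unfolding form_tensor_slice[OF u y x] radial_density_def mode_coeff_def by (simp add: algebra_simps)
    qed
    show "AE x in radial_measure. norm (LINT p|V. form_density \<omega> u (tensor P (y l)) (x, p)) \<le> C" for l
    proof (rule AE_I2)
      fix x assume "x \<in> space radial_measure"
      then have x: "x \<in> {0..1}" unfolding space_radial .
      have ie: "integrable V (\<lambda>p. (cmod (y l p))\<^sup>2 + grad_sq (y l) p)"
        using cont_integrable_V[OF energy_K_density_cont[OF yl[of l]] x] by simp
      have "norm (LINT p|V. form_density \<omega> u (tensor P (y l)) (x, p)) \<le> (LINT p|V. (1 + \<bar>\<omega>\<bar>) * (D + B * ((cmod (y l p))\<^sup>2 + grad_sq (y l) p)))"
      proof (rule order_trans[OF integral_norm_bound], rule integral_mono)
        show "integrable V (\<lambda>p. norm (form_density \<omega> u (tensor P (y l)) (x, p)))"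
          by (intro integrable_norm cont_integrable_V[OF form_density_cont[OF u T] x])
        show "integrable V (\<lambda>p. (1 + \<bar>\<omega>\<bar>) * (D + B * ((cmod (y l p))\<^sup>2 + grad_sq (y l) p)))"
          by (intro integrable_mult_right Bochner_Integration.integrable_add ie) simp
        fix p
        have "norm (form_density \<omega> u (tensor P (y l)) (x, p)) \<le> (1 + \<bar>\<omega>\<bar>) * (1 * density_M u (x, p) + density_M (tensor P (y l)) (x, p) / 1)"
          by (rule form_density_bound[OF u T x]) simp
        also have "\<dots> \<le> (1 + \<bar>\<omega>\<bar>) * (D + B * ((cmod (y l p))\<^sup>2 + grad_sq (y l) p))"
          using D(2)[OF x, of p] B(2)[OF T yl x, of l p] by (intro mult_left_mono) auto
        finally show "norm (form_density \<omega> u (tensor P (y l)) (x, p)) \<le> (1 + \<bar>\<omega>\<bar>) * (D + B * ((cmod (y l p))\<^sup>2 + grad_sq (y l) p))" .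
      qed
      also have "\<dots> = (1 + \<bar>\<omega>\<bar>) * (D * measure V UNIV + B * energy_K (y l))"
      proof -
        have "(LINT p|V. D + B * ((cmod (y l p))\<^sup>2 + grad_sq (y l) p)) = (LINT p|V. D) + (LINT p|V. B * ((cmod (y l p))\<^sup>2 + grad_sq (y l) p))"
          by (intro Bochner_Integration.integral_add integrable_mult_right ie) simp
        also have "\<dots> = D * measure V UNIV + B * energy_K (y l)" unfolding energy_K_def integral_mult_right_zero by (simp add: space_V)
        finally show ?thesis by (simp only: integral_mult_right_zero)
      qed
      also have "\<dots> \<le> C" unfolding C_def using E[of l] B(1) by (intro mult_left_mono add_left_mono) auto
      finally show "norm (LINT p|V. form_density \<omega> u (tensor P (y l)) (x, p)) \<le> C" .
    qed
  qed
qed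

text \<open>The form is bounded on \<open>H\<^sup>1\<close>, and \<open>P \<otimes> y l\<close> is Cauchy there.\<close>

lemma form_tensor_uniform:
  fixes s :: "nat \<Rightarrow> real \<times> 'k \<Rightarrow> complex" and y :: "nat \<Rightarrow> 'k \<Rightarrow> complex"
  assumes s: "\<And>k. C1_strip (s k)" and E: "\<And>k. k \<ge> N0 \<Longrightarrow> energy_M (s k) \<le> E" and y: "\<And>l. smooth_fun K (y l)"
    and cauchy: "\<And>e. e > 0 \<Longrightarrow> \<exists>N. \<forall>k\<ge>N. \<forall>l\<ge>N. energy_K (\<lambda>p. y k p - y l p) < e" and e: "e > 0"
  shows "\<exists>N. \<forall>k\<ge>N. \<forall>l\<ge>N. \<forall>l'\<ge>N. cmod (form_M \<omega> (s k) (tensor P (y l)) - form_M \<omega> (s k) (tensor P (y l'))) \<le> e"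
proof -
  obtain C where C: "C > 0" "\<And>y. C1_strip (tensor P y) \<Longrightarrow> C1_strip (\<lambda>(x, p). y p) \<Longrightarrow> energy_M (tensor P y) \<le> C * energy_K y"
    by (rule energy_tensor_le) blast
  define w where "w = 1 + \<bar>\<omega>\<bar>"
  have w: "w > 0" unfolding w_def by simp
  define t where "t = e / (2 * w * (\<bar>E\<bar> + 1))"
  have t: "t > 0" unfolding t_def using e w by (simp add: add_nonneg_pos)
  have "e * t / (2 * w * C) > 0" using e t w C(1) by simp
  from cauchy[OF this] obtain N where N: "\<forall>k\<ge>N. \<forall>l\<ge>N. energy_K (\<lambda>p. y k p - y l p) < e * t / (2 * w * C)" by blast
  show ?thesis
  proof (intro exI allI impI)
    fix k l l' assume k: "k \<ge> max N0 N" and l: "l \<ge> max N0 N" "l' \<ge> max N0 N"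
    have T: "C1_strip (tensor P (y l))" for l by (rule smooth_fun_C1_strip[OF tensor_smooth[OF y]])
    have eq: "(\<lambda>q. tensor P (y l) q - tensor P (y l') q) = tensor P (\<lambda>p. y l p - y l' p)"
      unfolding tensor_def by (auto simp: fun_eq_iff scaleR_diff_right)
    have T': "C1_strip (tensor P (\<lambda>p. y l p - y l' p))" using C1_strip_diff[OF T[of l] T[of l']] unfolding eq .
    have d: "C1_strip (\<lambda>(x, p). y l p - y l' p)"
      using C1_strip_diff[OF smooth_fun_K_lift[OF y[of l]] smooth_fun_K_lift[OF y[of l']]] by (simp add: case_prod_beta')
    have "form_M \<omega> (s k) (tensor P (y l)) - form_M \<omega> (s k) (tensor P (y l')) = form_M \<omega> (s k) (tensor P (\<lambda>p. y l p - y l' p))"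
      using form_M_diff_right[OF s T T, of \<omega> k l l'] unfolding eq by simp
    also have "cmod \<dots> \<le> w * (t * energy_M (s k) + energy_M (tensor P (\<lambda>p. y l p - y l' p)) / t)"
      unfolding w_def by (rule form_M_bound[OF s T' t])
    also have "\<dots> \<le> w * (t * (\<bar>E\<bar> + 1) + (C * (e * t / (2 * w * C))) / t)"
    proof (intro mult_left_mono add_mono divide_right_mono)
      show "energy_M (s k) \<le> \<bar>E\<bar> + 1" by (rule order_trans[OF E]) (use k in auto)
      have "energy_M (tensor P (\<lambda>p. y l p - y l' p)) \<le> C * energy_K (\<lambda>p. y l p - y l' p)" by (rule C(2)[OF T' d])
      also have "\<dots> \<le> C * (e * t / (2 * w * C))" using N l C(1) by (intro mult_left_mono) (auto intro: less_imp_le)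
      finally show "energy_M (tensor P (\<lambda>p. y l p - y l' p)) \<le> C * (e * t / (2 * w * C))" .
    qed (use w t in auto)
    also have "\<dots> = w * (t * (\<bar>E\<bar> + 1)) + e / 2" using w t C(1) by (simp add: field_simps)
    also have "w * (t * (\<bar>E\<bar> + 1)) = e / 2" 
    proof -
      define d where "d = \<bar>E\<bar> + 1"
      have "d \<noteq> 0" unfolding d_def by linarith
      then show ?thesis unfolding t_def d_def[symmetric] using w by simp
    qed
    finally show "cmod (form_M \<omega> (s k) (tensor P (y l)) - form_M \<omega> (s k) (tensor P (y l'))) \<le> e" by simp
  qed
qed

lemma cont_L2_\<sigma>:
  assumes F: "continuous_on ({0..1} \<times> UNIV) F" shows "(F :: real \<times> 'k \<Rightarrow> complex) \<in> L2 \<sigma>"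
proof -
  obtain C where C: "C > 0" "\<And>x p. x \<in> {0..1} \<Longrightarrow> norm (F (x, p)) \<le> C" by (rule cont_bounded_strip[OF F]) blast
  interpret finite_measure \<sigma> by (rule finite_\<sigma>)
  have sp: "space \<sigma> = {0, 1} \<times> UNIV" using sets_eq_imp_space_eq[OF sets_\<sigma>] by (simp add: space_restrict_space)
  have m: "F \<in> borel_measurable \<sigma>" by (rule cont_measurable_\<sigma>[OF F])
  have "integrable \<sigma> (\<lambda>q. (cmod (F q))\<^sup>2)"
  proof (rule integrable_const_bound[where B = "C\<^sup>2"])
    show "AE q in \<sigma>. norm ((cmod (F q))\<^sup>2) \<le> C\<^sup>2"
      using C by (intro AE_I2) (auto simp: sp intro!: power_mono)
    show "(\<lambda>q. (cmod (F q))\<^sup>2) \<in> borel_measurable \<sigma>" using m by measurable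
  qed
  then show ?thesis using m unfolding L2_def by blast
qed

text \<open>Green's formula tested with \<open>P \<otimes> y l\<close>: its right-hand side tends to \<open>\<kappa> (a * P 0 + b * P 1)\<close> as \<open>l\<close> grows, because
the pairing of \<open>Y\<close> with \<open>y l\<close> tends to \<open>1\<close>. The factor \<open>f 0\<close> stands for both ends, as \<open>f 0 = f 1\<close>.\<close>

lemma radial_weak_form:
  assumes dn: "dn_graph W M (points (warped_boundary f K)) \<sigma> \<omega> (boundary_mode Y a b) (\<lambda>q. complex_of_real ev * boundary_mode Y a b q)"
    and f01: "f 0 = f 1"
  obtains s where "\<And>k. smooth_fun W (s k)" "\<And>e. e > 0 \<Longrightarrow> \<exists>N. \<forall>k\<ge>N. \<forall>l\<ge>N. energy_M (\<lambda>q. s k q - s l q) < e"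
    "(\<lambda>k. mode_coeff (s k) 0) \<longlonglongrightarrow> a" "(\<lambda>k. mode_coeff (s k) 1) \<longlonglongrightarrow> b"
    "\<And>P. (\<lambda>k. LINT x|radial_measure. radial_density \<omega> P (s k) x) \<longlonglongrightarrow> of_real (sqrt (f 0 ^ DIM('e)) * ev) * (a * poly P 0 + b * poly P 1)"
proof -
  define c where "c = sqrt (f 0 ^ DIM('e))"
  have c: "c > 0" unfolding c_def using f_pos[of 0] by simp
  let ?\<psi> = "boundary_mode Y a b"
  have \<psi>0: "?\<psi> (0, p) = a * Y p" "?\<psi> (1, p) = b * Y p" for p unfolding boundary_mode_def by auto
  obtain s u where su: "helmholtz_solution W M (points (warped_boundary f K)) \<omega> s u" "L2_tendsto \<sigma> s ?\<psi>"
    and green: "\<And>\<phi>. smooth_fun W \<phi> \<Longrightarrow> (\<lambda>k. form_M \<omega> (s k) \<phi>) \<longlonglongrightarrow> (LINT p|\<sigma>. (complex_of_real ev * ?\<psi> p) * cnj (\<phi> p))"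
    using dn unfolding dn_graph_def form_M_def by blast
  have \<psi>: "?\<psi> \<in> L2 \<sigma>" and ev\<psi>: "(\<lambda>q. complex_of_real ev * ?\<psi> q) \<in> L2 \<sigma>" using dn unfolding dn_graph_def by auto
  have s: "smooth_fun W (s k)" for k using su(1) unfolding helmholtz_solution_def H1_element_def by blast
  note s1 = smooth_fun_C1_strip[OF s]
  have cauchy: "\<exists>N. \<forall>k\<ge>N. \<forall>l\<ge>N. energy_M (\<lambda>q. s k q - s l q) < e" if e: "e > 0" for e
  proof -
    have "sqrt e > 0" using e by simp
    then obtain N where N: "\<forall>k\<ge>N. \<forall>l\<ge>N. H1_norm W M (\<lambda>p. s k p - s l p) < sqrt e"
      using su(1) unfolding helmholtz_solution_def H1_element_def by blast
    have "energy_M (\<lambda>q. s k q - s l q) < e" if "k \<ge> N" "l \<ge> N" for k l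
    proof -
      note d = C1_strip_diff[OF s1[of k] s1[of l]]
      have "H1_norm W M (\<lambda>p. s k p - s l p) \<ge> 0" using energy_M_nonneg[OF d] unfolding H1_norm_def energy_M_def by simp
      then have "(H1_norm W M (\<lambda>p. s k p - s l p))\<^sup>2 < (sqrt e)\<^sup>2" using N that by (intro power_strict_mono) auto
      then show ?thesis using H1_norm_W[OF d] e by simp
    qed
    then show ?thesis by blast
  qed
  obtain N where N: "\<forall>k\<ge>N. \<forall>l\<ge>N. energy_M (\<lambda>q. s k q - s l q) < 1" using cauchy[of 1] by auto
  have E: "energy_M (s k) \<le> 3 * 1 + 3 * energy_M (s N)" if "k \<ge> N" for k
    using energy_M_le[OF s1[of k] s1[of N]] N that by fastforce
  have trace: "(cmod (mode_coeff (s k) 0 - a))\<^sup>2 \<le> (1 / c) * (LINT q|\<sigma>. (cmod (s k q - ?\<psi> q))\<^sup>2)"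
    "(cmod (mode_coeff (s k) 1 - b))\<^sup>2 \<le> (1 / c) * (LINT q|\<sigma>. (cmod (s k q - ?\<psi> q))\<^sup>2)" for k
  proof -
    have dL: "(\<lambda>q. s k q - ?\<psi> q) \<in> L2 \<sigma>" by (intro L2_diff \<psi> cont_L2_\<sigma> C1_strip_cont s1)
    have I: "(LINT q|\<sigma>. (cmod (s k q - ?\<psi> q))\<^sup>2) = c * (LINT p|V. (cmod (s k (0, p) - a * Y p))\<^sup>2) + c * (LINT p|V. (cmod (s k (1, p) - b * Y p))\<^sup>2)"
      using integral_\<sigma>[OF L2_D(2)[OF dL]] unfolding f01[symmetric] c_def[symmetric] \<psi>0 by simp
    have bs: "(cmod (mode_coeff (s k) x - z))\<^sup>2 \<le> (LINT p|V. (cmod (s k (x, p) - z * Y p))\<^sup>2)" if x: "x \<in> {0..1}" for x z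
    proof -
      have zY: "(\<lambda>p. z * Y p) \<in> L2 V" by (rule L2_scale[OF Y])
      note sL = cont_L2_V[OF C1_strip_cont[OF s1[of k]] x]
      have "(LINT p|V. (s k (x, p) - z * Y p) * cnj (Y p)) = (LINT p|V. s k (x, p) * cnj (Y p) - z * (Y p * cnj (Y p)))"
        by (simp add: algebra_simps)
      also have "\<dots> = mode_coeff (s k) x - z"
        using L2_prod_integrable[OF sL Y] L2_prod_integrable[OF Y Y] Y1 unfolding mode_coeff_def L2_inner_def by simp
      finally show ?thesis using Bessel[OF Y Y1 L2_diff[OF sL zY]] by simp
    qed
    have nn: "0 \<le> (LINT p|V. (cmod (s k (0, p) - a * Y p))\<^sup>2)" "0 \<le> (LINT p|V. (cmod (s k (1, p) - b * Y p))\<^sup>2)"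
      by (rule Bochner_Integration.integral_nonneg, simp)+
    have J: "(1 / c) * (LINT q|\<sigma>. (cmod (s k q - ?\<psi> q))\<^sup>2) = (LINT p|V. (cmod (s k (0, p) - a * Y p))\<^sup>2) + (LINT p|V. (cmod (s k (1, p) - b * Y p))\<^sup>2)"
      unfolding I using c by (simp add: field_simps)
    show "(cmod (mode_coeff (s k) 0 - a))\<^sup>2 \<le> (1 / c) * (LINT q|\<sigma>. (cmod (s k q - ?\<psi> q))\<^sup>2)"
      "(cmod (mode_coeff (s k) 1 - b))\<^sup>2 \<le> (1 / c) * (LINT q|\<sigma>. (cmod (s k q - ?\<psi> q))\<^sup>2)"
    proof -
      show "(cmod (mode_coeff (s k) 0 - a))\<^sup>2 \<le> (1 / c) * (LINT q|\<sigma>. (cmod (s k q - ?\<psi> q))\<^sup>2)"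
        unfolding J using add_increasing2[OF nn(2) bs[of 0 a]] by simp
      show "(cmod (mode_coeff (s k) 1 - b))\<^sup>2 \<le> (1 / c) * (LINT q|\<sigma>. (cmod (s k q - ?\<psi> q))\<^sup>2)"
        unfolding J using add_increasing[OF nn(1) bs[of 1 b]] by simp
    qed
  qed
  have "(\<lambda>k. (1 / c) * (LINT q|\<sigma>. (cmod (s k q - ?\<psi> q))\<^sup>2)) \<longlonglongrightarrow> (1 / c) * 0"
    using su(2) unfolding L2_tendsto_def by (rule tendsto_mult_left)
  then have lim0: "(\<lambda>k. (1 / c) * (LINT q|\<sigma>. (cmod (s k q - ?\<psi> q))\<^sup>2)) \<longlonglongrightarrow> 0" by simp
  have squeeze: "z \<longlonglongrightarrow> z0" if "\<And>k. (cmod (z k - z0))\<^sup>2 \<le> (1 / c) * (LINT q|\<sigma>. (cmod (s k q - ?\<psi> q))\<^sup>2)" for z z0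
  proof -
    have "(\<lambda>k. (cmod (z k - z0))\<^sup>2) \<longlonglongrightarrow> 0"
      by (rule tendsto_sandwich[OF _ _ tendsto_const lim0]) (use that in auto)
    then have "(\<lambda>k. sqrt ((cmod (z k - z0))\<^sup>2)) \<longlonglongrightarrow> sqrt 0" by (intro tendsto_intros)
    then show ?thesis by (simp add: tendsto_norm_zero_iff LIM_zero_iff)
  qed
  obtain y where y: "\<And>l. smooth_fun K (y l)" "\<And>e. e > 0 \<Longrightarrow> \<exists>N. \<forall>k\<ge>N. \<forall>l\<ge>N. energy_K (\<lambda>p. y k p - y l p) < e"
    "L2_tendsto V y Y" "\<And>\<phi>. smooth_fun K \<phi> \<Longrightarrow> (\<lambda>l. LINT p|V. grad_inner K \<phi> (y l) p) \<longlonglongrightarrow> of_real \<mu> * (LINT p|V. \<phi> p * cnj (Y p))"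
    by (rule eigen_sequence) blast
  have yL: "y l \<in> L2 V" for l using cont_L2_V[OF C1_strip_cont[OF smooth_fun_K_lift[OF y(1)[of l]]], of 0] by simp
  have "(\<lambda>k. LINT x|radial_measure. radial_density \<omega> P (s k) x) \<longlonglongrightarrow> of_real (c * ev) * (a * poly P 0 + b * poly P 1)" for P
  proof (rule tendsto_interchange[where A = "\<lambda>k l. form_M \<omega> (s k) (tensor P (y l))"])
    fix l
    show "(\<lambda>k. form_M \<omega> (s k) (tensor P (y l))) \<longlonglongrightarrow> (LINT q|\<sigma>. (complex_of_real ev * ?\<psi> q) * cnj (tensor P (y l) q))"
      by (rule green[OF tensor_smooth[OF y(1)]])
  next
    fix k
    show "(\<lambda>l. form_M \<omega> (s k) (tensor P (y l))) \<longlonglongrightarrow> (LINT x|radial_measure. radial_density \<omega> P (s k) x)"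
      by (rule form_tensor_tendsto[OF s y])
  next
    fix e :: real assume "e > 0"
    then show "\<exists>N. \<forall>k\<ge>N. \<forall>l\<ge>N. \<forall>l'\<ge>N. cmod (form_M \<omega> (s k) (tensor P (y l)) - form_M \<omega> (s k) (tensor P (y l'))) \<le> e"
      by (intro form_tensor_uniform[OF s1 E y(1,2)])
  next
    have T: "tensor P (y l) \<in> L2 \<sigma>" for l by (rule cont_L2_\<sigma>[OF C1_strip_cont[OF smooth_fun_C1_strip[OF tensor_smooth[OF y(1)]]]])
    have eq: "(LINT q|\<sigma>. (complex_of_real ev * ?\<psi> q) * cnj (tensor P (y l) q)) = of_real (c * ev) * (a * poly P 0 + b * poly P 1) * (LINT p|V. Y p * cnj (y l p))" for l
    proof -
      have "(LINT q|\<sigma>. (complex_of_real ev * ?\<psi> q) * cnj (tensor P (y l) q)) =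
        c *\<^sub>R (LINT p|V. (complex_of_real ev * (a * Y p)) * cnj (tensor P (y l) (0, p))) + c *\<^sub>R (LINT p|V. (complex_of_real ev * (b * Y p)) * cnj (tensor P (y l) (1, p)))"
        using integral_\<sigma>[OF L2_prod_integrable[OF ev\<psi> T[of l]]] unfolding f01[symmetric] c_def[symmetric] \<psi>0 .
      also have "(LINT p|V. (complex_of_real ev * (a * Y p)) * cnj (tensor P (y l) (0, p))) = (LINT p|V. (of_real ev * a * of_real (poly P 0)) * (Y p * cnj (y l p)))"
        by (rule Bochner_Integration.integral_cong) (auto simp: tensor_def scaleR_conv_of_real)
      also have "(LINT p|V. (complex_of_real ev * (b * Y p)) * cnj (tensor P (y l) (1, p))) = (LINT p|V. (of_real ev * b * of_real (poly P 1)) * (Y p * cnj (y l p)))"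
        by (rule Bochner_Integration.integral_cong) (auto simp: tensor_def scaleR_conv_of_real)
      finally show ?thesis unfolding integral_mult_right_zero by (simp add: scaleR_conv_of_real algebra_simps)
    qed
    have "(\<lambda>l. of_real (c * ev) * (a * poly P 0 + b * poly P 1) * (LINT p|V. Y p * cnj (y l p))) \<longlonglongrightarrow> of_real (c * ev) * (a * poly P 0 + b * poly P 1) * (LINT p|V. Y p * cnj (Y p))"
      by (intro tendsto_intros L2_tendsto_inner[OF Y yL Y y(3)])
    then show "(\<lambda>l. LINT q|\<sigma>. (complex_of_real ev * ?\<psi> q) * cnj (tensor P (y l) q)) \<longlonglongrightarrow> of_real (c * ev) * (a * poly P 0 + b * poly P 1)"
      unfolding eq using Y1 unfolding L2_inner_def by simp
  qed
  then show ?thesis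
    using that[OF s cauchy squeeze[OF trace(1)] squeeze[OF trace(2)]] unfolding c_def by blast
qed

text \<open>The coefficients are complex, but the form and \<open>\<kappa>\<close> are real; so the real and the imaginary parts both
satisfy the weak equation, and one of them has nonzero boundary values.\<close>

lemma steklov_weak_mode:
  assumes ev: "ev \<in> steklov_eigenvalues f K M \<sigma> \<omega> Y" and f01: "f 0 = f 1"
  obtains a b u u' where "(a, b) \<noteq> (0, 0)"
    "weak_mode (grad_weight n f) (\<lambda>x. \<mu> * grad_weight n f x - \<omega> * vol_weight n f x) (sqrt (f 0 ^ DIM('e)) * ev) a b u u'"
proof -
  obtain a b where ab: "(a, b) \<noteq> (0, 0)" and
    dn: "dn_graph W M (points (warped_boundary f K)) \<sigma> \<omega> (boundary_mode Y a b) (\<lambda>q. complex_of_real ev * boundary_mode Y a b q)"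
    using ev unfolding steklov_eigenvalues_def by blast
  obtain s where s: "\<And>k. smooth_fun W (s k)" and cauchy: "\<And>e. e > 0 \<Longrightarrow> \<exists>N. \<forall>k\<ge>N. \<forall>l\<ge>N. energy_M (\<lambda>q. s k q - s l q) < e"
    and tr: "(\<lambda>k. mode_coeff (s k) 0) \<longlonglongrightarrow> a" "(\<lambda>k. mode_coeff (s k) 1) \<longlonglongrightarrow> b"
    and weak: "\<And>P. (\<lambda>k. LINT x|radial_measure. radial_density \<omega> P (s k) x) \<longlonglongrightarrow> of_real (sqrt (f 0 ^ DIM('e)) * ev) * (a * poly P 0 + b * poly P 1)"
    by (rule radial_weak_form[OF dn f01]) blast
  note s1 = smooth_fun_C1_strip[OF s]
  obtain T :: "complex \<Rightarrow> real" where T: "T = Re \<or> T = Im" and Tab: "(T a, T b) \<noteq> (0, 0)"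
  proof (cases "(Re a, Re b) = (0, 0)")
    case True
    then have "(Im a, Im b) \<noteq> (0, 0)" using ab by (auto simp: complex_eq_iff)
    then show ?thesis using that by blast
  next
    case False
    then show ?thesis using that by blast
  qed
  have Tb: "bounded_linear T" using T bounded_linear_Re bounded_linear_Im by blast
  have Tm: "T (of_real r * z) = r * T z" "T (z * of_real r) = r * T z" "T (z + z') = T z + T z'" "T (z - z') = T z - T z'" for r z z' using T by auto
  have Tn: "(T z)\<^sup>2 \<le> (cmod z)\<^sup>2" for z using T by (auto simp: cmod_power2)
  let ?p = "grad_weight n f" and ?q = "\<lambda>x. \<mu> * grad_weight n f x - \<omega> * vol_weight n f x"
  define u where "u k x = T (mode_coeff (s k) x)" for k x
  define u' where "u' k x = T (mode_coeff (dx (s k)) x)" for k x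
  have pc: "continuous_on {0..1} ?p"
    unfolding grad_weight_def by (intro continuous_intros vol_weight_cont f_cont) (use f_pos in force)
  have qc: "continuous_on {0..1} ?q" by (intro continuous_intros pc vol_weight_cont)
  have C1: "C1 (u k) (u' k)" for k
    unfolding C1_def has_real_derivative_iff_has_vector_derivative u_def u'_def
  proof (intro conjI ballI)
    show "((\<lambda>x. T (mode_coeff (s k) x)) has_vector_derivative T (mode_coeff (dx (s k)) x)) (at x within {0..1})" if "x \<in> {0..1}" for x
      by (rule bounded_linear.has_vector_derivative[OF Tb mode_coeff_has_vector_derivative[OF s1 that]])
    show "continuous_on {0..1} (\<lambda>x. T (mode_coeff (dx (s k)) x))"
      by (rule bounded_linear.continuous_on[OF Tb mode_coeff_cont[OF dx_cont[OF s1]]])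
  qed
  have sc: "sobolev_cauchy u u'"
    unfolding sobolev_cauchy_def
  proof (intro conjI allI impI C1)
    fix e :: real assume e: "e > 0"
    obtain C where C: "C > 0" "\<And>u. C1_strip u \<Longrightarrow> integral {0..1} (\<lambda>x. (cmod (mode_coeff (dx u) x))\<^sup>2 + (cmod (mode_coeff u x))\<^sup>2) \<le> C * energy_M u"
      by (rule mode_coeff_energy_le) blast
    have "e / C > 0" using e C(1) by simp
    from cauchy[OF this] obtain N where N: "\<forall>k\<ge>N. \<forall>l\<ge>N. energy_M (\<lambda>q. s k q - s l q) < e / C" by blast
    have "sobolev_sq (\<lambda>x. u k x - u l x) (\<lambda>x. u' k x - u' l x) < e" if "k \<ge> N" "l \<ge> N" for k l
    proof -
      note d = C1_strip_diff[OF s1[of k] s1[of l]]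
      let ?d = "\<lambda>q. s k q - s l q"
      have "sobolev_sq (\<lambda>x. u k x - u l x) (\<lambda>x. u' k x - u' l x) \<le> integral {0..1} (\<lambda>x. (cmod (mode_coeff (dx ?d) x))\<^sup>2 + (cmod (mode_coeff ?d x))\<^sup>2)"
        unfolding sobolev_sq_def
      proof (rule integral_mono01)
        show "continuous_on {0..1} (\<lambda>x. (u' k x - u' l x)\<^sup>2 + (u k x - u l x)\<^sup>2)"
          by (intro continuous_intros C1_cont[OF C1])
        show "continuous_on {0..1} (\<lambda>x. (cmod (mode_coeff (dx ?d) x))\<^sup>2 + (cmod (mode_coeff ?d x))\<^sup>2)"
          by (intro continuous_intros mode_coeff_cont dx_cont[OF d] C1_strip_cont[OF d])
        fix x :: real assume x: "x \<in> {0..1}"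
        have 1: "mode_coeff ?d x = mode_coeff (s k) x - mode_coeff (s l) x" by (rule mode_coeff_diff[OF C1_strip_cont[OF s1] C1_strip_cont[OF s1] x])
        have "mode_coeff (dx ?d) x = mode_coeff (\<lambda>q. dx (s k) q - dx (s l) q) x"
          unfolding mode_coeff_def by (simp add: dx_diff[OF s1 s1 x])
        then have 2: "mode_coeff (dx ?d) x = mode_coeff (dx (s k)) x - mode_coeff (dx (s l)) x"
          using mode_coeff_diff[OF dx_cont[OF s1[of k]] dx_cont[OF s1[of l]] x] by simp
        show "(u' k x - u' l x)\<^sup>2 + (u k x - u l x)\<^sup>2 \<le> (cmod (mode_coeff (dx ?d) x))\<^sup>2 + (cmod (mode_coeff ?d x))\<^sup>2"
          unfolding 1 2 u_def u'_def Tm(4)[symmetric] by (intro add_mono Tn)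
      qed
      also have "\<dots> \<le> C * energy_M ?d" by (rule C(2)[OF d])
      also have "\<dots> < e" using N that C(1) by (simp add: pos_less_divide_eq mult.commute)
      finally show ?thesis .
    qed
    then show "\<exists>N. \<forall>k\<ge>N. \<forall>l\<ge>N. sobolev_sq (\<lambda>x. u k x - u l x) (\<lambda>x. u' k x - u' l x) < e" by blast
  qed
  have "weak_mode ?p ?q (sqrt (f 0 ^ DIM('e)) * ev) (T a) (T b) u u'"
  proof (rule weak_mode_of_polynomials[OF sc _ _ pc qc])
    show "(\<lambda>k. u k 0) \<longlonglongrightarrow> T a" "(\<lambda>k. u k 1) \<longlonglongrightarrow> T b"
      unfolding u_def by (rule bounded_linear.tendsto[OF Tb tr(1)], rule bounded_linear.tendsto[OF Tb tr(2)])
    fix P :: "real poly"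
    have eq: "T (LINT x|radial_measure. radial_density \<omega> P (s k) x) = bform ?p ?q (u k) (u' k) (poly P) (poly (pderiv P))" for k
    proof -
      have rc: "continuous_on {0..1} (radial_density \<omega> P (s k))"
        unfolding radial_density_def[abs_def]
        by (intro continuous_intros mode_coeff_cont dx_cont[OF s1] C1_strip_cont[OF s1] f_cont) (use f_pos in force)+
      have int: "(\<lambda>x. vol_weight n f x *\<^sub>R radial_density \<omega> P (s k) x) integrable_on {0..1}"
        by (intro integrable_continuous_interval continuous_intros vol_weight_cont rc)
      have "T (LINT x|radial_measure. radial_density \<omega> P (s k) x) = integral {0..1} (T \<circ> (\<lambda>x. vol_weight n f x *\<^sub>R radial_density \<omega> P (s k) x))"
        unfolding integral_radial[OF rc] by (rule integral_linear[OF int Tb, symmetric])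
      also have "\<dots> = bform ?p ?q (u k) (u' k) (poly P) (poly (pderiv P))"
        unfolding bform_def o_def
      proof (rule integral_cong)
        fix x :: real assume x: "x \<in> {0..1}"
        show "T (vol_weight n f x *\<^sub>R radial_density \<omega> P (s k) x) = ?p x * (u' k x * poly (pderiv P) x) + ?q x * (u k x * poly P x)"
          unfolding radial_density_def scaleR_conv_of_real Tm u_def u'_def grad_weight_def by (simp add: algebra_simps)
      qed
      finally show ?thesis .
    qed
    have "(\<lambda>k. T (LINT x|radial_measure. radial_density \<omega> P (s k) x)) \<longlonglongrightarrow> T (of_real (sqrt (f 0 ^ DIM('e)) * ev) * (a * poly P 0 + b * poly P 1))"
      by (rule bounded_linear.tendsto[OF Tb weak])
    then show "(\<lambda>k. bform ?p ?q (u k) (u' k) (poly P) (poly (pderiv P))) \<longlonglongrightarrow> sqrt (f 0 ^ DIM('e)) * ev * (T a * poly P 0 + T b * poly P 1)"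
      unfolding eq Tm by (simp add: mult.commute)
  qed
  then show ?thesis using that Tab by blast
qed

end

section \<open>The gap between the Steklov eigenvalues\<close>

text \<open>For an infinite or empty set, \<open>Max\<close> and \<open>Min\<close> take the same default value. Hence a bound on the distances
within the set is enough.\<close>

lemma Max_minus_Min_le:
  fixes E :: "real set"
  assumes "\<And>x y. x \<in> E \<Longrightarrow> y \<in> E \<Longrightarrow> \<bar>x - y\<bar> \<le> C" and "C \<ge> 0"
  shows "\<bar>Max E - Min E\<bar> \<le> C"
proof (cases "finite E \<and> E \<noteq> {}")
  case True
  then show ?thesis using assms(1) Max_in[of E] Min_in[of E] by blast
next
  case False
  then have "Max E = the None" "Min E = the None"
    unfolding Max.eq_fold' Min.eq_fold' by auto
  then show ?thesis using assms(2) by simp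
qed

theorem corollary1p1:
  fixes n :: nat
    and K :: "('i, 'k::{second_countable_topology, t2_space}, 'e::euclidean_space) riem"
    and vol_K :: "'k measure"
    and f :: "real \<Rightarrow> real"
    and vol_M vol_bdry :: "(real \<times> 'k) measure"
    and \<omega> :: real
    and \<mu> :: "nat \<Rightarrow> real"
    and Y :: "nat \<Rightarrow> 'k \<Rightarrow> complex"
  assumes "n \<ge> 2" and "DIM('e) = n - 1"
    and "closed_riemannian_manifold K" and "connected (UNIV :: 'k set)"
    and "smooth_on {0..1} f" and "\<forall>x\<in>{0..1}. f x > 0"
    and "riemannian_volume K vol_K"
    and "riemannian_volume (warped_product f K) vol_M"
    and "riemannian_volume (warped_boundary f K) vol_bdry"
    and "\<omega> \<notin> dirichlet_spectrum (warped_product f K) vol_M (points (warped_boundary f K)) vol_bdry"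
    and "laplace_eigenbasis K vol_K \<mu> Y"
    and "(n = 2 \<and> \<omega> \<noteq> 0) \<or> n \<ge> 3"
    and "\<forall>j. deriv01 j f 0 = (-1) ^ j * deriv01 j f 1"
  shows "\<forall>p::real. p \<ge> 0 \<longrightarrow>
    (\<lambda>m. steklov_plus f K vol_M vol_bdry \<omega> (Y m) - steklov_minus f K vol_M vol_bdry \<omega> (Y m))
      \<in> O(\<lambda>m. \<mu> m powr (-p))"
proof (intro allI impI)
  fix p :: real assume "p \<ge> 0"
  interpret warped_measure K vol_K f n vol_M vol_bdry
  proof
    show "continuous_on {0..1} f" using smooth_on_imp_Ck[OF assms(5), of 0] by simp
  qed (use assms in auto)
  have f01: "f 0 = f 1" using assms(13)[rule_format, of 0] by simp
  define c where "c = sqrt (f 0 ^ DIM('e))"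
  have c: "c > 0" unfolding c_def using f_pos[of 0] by simp
  \<comment> \<open>one more than \<open>p\<close>, because the energy contributes a factor \<open>\<mu>\<close>\<close>
  define N where "N = nat \<lceil>p\<rceil> + 1"
  have N: "real N \<ge> p + 1" unfolding N_def using \<open>p \<ge> 0\<close> by linarith
  obtain C B where CB: "\<forall>\<mu>\<ge>B. \<forall>\<kappa>1 a1 b1 u u' \<kappa>2 a2 b2 v v'.
     (a1, b1) \<noteq> (0, 0) \<longrightarrow> (a2, b2) \<noteq> (0, 0) \<longrightarrow>
     weak_mode (grad_weight n f) (\<lambda>x. \<mu> * grad_weight n f x - \<omega> * vol_weight n f x) \<kappa>1 a1 b1 u u' \<longrightarrow>
     weak_mode (grad_weight n f) (\<lambda>x. \<mu> * grad_weight n f x - \<omega> * vol_weight n f x) \<kappa>2 a2 b2 v v' \<longrightarrow>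
     \<bar>\<kappa>1 - \<kappa>2\<bar> \<le> C * (\<mu> / \<mu> ^ N)"
    using radial_gap[OF assms(5,6,13), of n \<omega> N] by blast
  have "filterlim \<mu> at_top sequentially" using assms(11) unfolding laplace_eigenbasis_def by blast
  then have large: "eventually (\<lambda>m. \<mu> m \<ge> max 1 B) sequentially" unfolding filterlim_at_top by blast
  show "(\<lambda>m. steklov_plus f K vol_M vol_bdry \<omega> (Y m) - steklov_minus f K vol_M vol_bdry \<omega> (Y m)) \<in> O(\<lambda>m. \<mu> m powr (-p))"
  proof (rule bigoI)
    show "eventually (\<lambda>m. norm (steklov_plus f K vol_M vol_bdry \<omega> (Y m) - steklov_minus f K vol_M vol_bdry \<omega> (Y m)) \<le> (\<bar>C\<bar> / c) * norm (\<mu> m powr (-p))) sequentially"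
      using large
    proof eventually_elim
      case (elim m)
      then have \<mu>: "\<mu> m \<ge> 1" "\<mu> m \<ge> B" by auto
      have basis: "L2_orthonormal_basis vol_K Y" "laplace_eigenfunction K vol_K (\<mu> m) (Y m)"
        using assms(11) unfolding laplace_eigenbasis_def by auto
      interpret cross_section_mode K vol_K f n vol_M vol_bdry "Y m" "\<mu> m"
        by unfold_locales (use basis in \<open>auto simp: L2_orthonormal_basis_def\<close>)
      have pow: "\<mu> m / \<mu> m ^ N \<le> \<mu> m powr (- p)"
      proof -
        have "\<mu> m / \<mu> m ^ N = \<mu> m powr (1 - real N)" using \<mu>(1) by (simp add: powr_diff powr_realpow)
        also have "\<dots> \<le> \<mu> m powr (- p)" using \<mu>(1) N by (intro powr_mono) auto
        finally show ?thesis .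
      qed
      have gap: "\<bar>x - y\<bar> \<le> (\<bar>C\<bar> / c) * \<mu> m powr (- p)"
        if x: "x \<in> steklov_eigenvalues f K vol_M vol_bdry \<omega> (Y m)" and y: "y \<in> steklov_eigenvalues f K vol_M vol_bdry \<omega> (Y m)" for x y
      proof -
        obtain a1 b1 u u' where 1: "(a1, b1) \<noteq> (0, 0)" "weak_mode (grad_weight n f) (\<lambda>x. \<mu> m * grad_weight n f x - \<omega> * vol_weight n f x) (c * x) a1 b1 u u'"
          unfolding c_def by (rule steklov_weak_mode[OF x f01]) blast
        obtain a2 b2 v v' where 2: "(a2, b2) \<noteq> (0, 0)" "weak_mode (grad_weight n f) (\<lambda>x. \<mu> m * grad_weight n f x - \<omega> * vol_weight n f x) (c * y) a2 b2 v v'"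
          unfolding c_def by (rule steklov_weak_mode[OF y f01]) blast
        have "c * \<bar>x - y\<bar> = \<bar>c * x - c * y\<bar>" using c by (simp add: abs_mult flip: right_diff_distrib)
        also have "\<dots> \<le> C * (\<mu> m / \<mu> m ^ N)" using CB \<mu>(2) 1 2 by blast
        also have "\<dots> \<le> \<bar>C\<bar> * (\<mu> m / \<mu> m ^ N)" using \<mu>(1) by (intro mult_right_mono) auto
        also have "\<dots> \<le> \<bar>C\<bar> * \<mu> m powr (- p)" by (intro mult_left_mono pow) auto
        finally show ?thesis using c by (simp add: field_simps)
      qed
      have "\<bar>Max (steklov_eigenvalues f K vol_M vol_bdry \<omega> (Y m)) - Min (steklov_eigenvalues f K vol_M vol_bdry \<omega> (Y m))\<bar> \<le> (\<bar>C\<bar> / c) * \<mu> m powr (- p)"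
        by (rule Max_minus_Min_le[OF gap]) (use c in auto)
      then show ?case unfolding steklov_plus_def steklov_minus_def by simp
    qed
  qed
qed

end
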